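(* Let $V=\{V_x\}_{x\in P}$ be an isometric representation of $P$ on a separable Hilbert space $\mathcal{H}$. Then the CCR flow $\alpha^V$ associated to $V$ on $B(\Gamma(\mathcal{H}))$ is decomposable.
   Context: $P\subset\mathbb{R}^d$ is a closed convex cone with $P-P=\mathbb{R}^d$ and $P\cap -P=\{0\}$. For $x,y\in\mathbb{R}^d$, $x\le y$ means $y-x\in P$. Inner products are linear in the first variable. An isometric representation of $P$ is a strongly continuous semigroup $\{V_x\}_{x\in P}$ of isometries ($V_xV_y=V_{x+y}$). An $E_0$-semigroup on $B(\mathcal{K})$ is a family $\{\alpha_x\}_{x\in P}$ of unital normal $*$-endomorphisms of $B(\mathcal{K})$ with $\alpha_x\circ\alpha_y=\alpha_{x+y}$ and such that $x\mapsto\langle\alpha_x(A)\xi|\eta\rangle$ is continuous on $P$ for all $A\in B(\mathcal{K})$, $\xi,\eta\in\mathcal{K}$. $\Gamma(\mathcal{H})$ is the symmetric Fock space, with exponential vectors $e(\eta)$ and Weyl operators $W(\xi)e(\eta)=e^{-\frac{\|\xi\|^2}{2}-\langle\eta|\xi\rangle}e(\xi+\eta)$. The CCR flow $\alpha^V=\{\alpha_x\}_{x\in P}$ is the unique $E_0$-semigroup on $B(\Gamma(\mathcal{H}))$ with $\alpha_x(W(\xi))=W(V_x\xi)$ for all $x\in P$, $\xi\in\mathcal{H}$. Product system of an $E_0$-semigroup $\alpha$ on $B(\mathcal{K})$: $E(x)=\{T\in B(\mathcal{K}):\alpha_x(A)T=TA\ \forall A\in B(\mathcal{K})\}$ for $x\in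 P$, a separable Hilbert space with inner product determined by $\langle S|T\rangle1=T^*S$; composition of operators gives the multiplication $E(x)\times E(y)\to E(x+y)$. A vector $u\in E(x)$ is decomposable if $u\ne0$ and for every $y\in P$ with $y\le x$ there exist $v\in E(y)$, $w\in E(x-y)$ with $u=vw$. $D(x)$ is the set of decomposable vectors in $E(x)$. The $E_0$-semigroup $\alpha$ is called decomposable if (1) $D(x)D(y)\subset D(x+y)$ for all $x,y\in P$, and (2) for every $x\in P$, $D(x)$ is total in $E(x)$. *)

theory Defs
  imports "HOL-Analysis.Analysis"
begin

section \<open>Complex Hilbert spaces\<close>

class scaleC =
  fixes scaleC :: "complex \<Rightarrow> 'a \<Rightarrow> 'a"  (infixr \<open>*\<^sub>C\<close> 75)

class complex_vector = real_vector + scaleC +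
  assumes scaleC_add_right: "c *\<^sub>C (x + y) = c *\<^sub>C x + c *\<^sub>C y"
    and scaleC_add_left: "(c + d) *\<^sub>C x = c *\<^sub>C x + d *\<^sub>C x"
    and scaleC_scaleC: "c *\<^sub>C (d *\<^sub>C x) = (c * d) *\<^sub>C x"
    and scaleC_one: "1 *\<^sub>C x = x"
    and scaleR_scaleC: "r *\<^sub>R x = complex_of_real r *\<^sub>C x"

global_interpretation complex_vector: vector_space "scaleC :: complex \<Rightarrow> 'a \<Rightarrow> 'a::complex_vector"
  defines cspan = complex_vector.span
  by unfold_locales (auto simp: scaleC_add_right scaleC_add_left scaleC_scaleC scaleC_one)

text \<open>The inner product is linear in the first variable. The underlying real Hilbert space
  structure, with its norm and topology, is the one given by the real part.\<close>

class complex_inner = real_inner + complex_vector +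
  fixes cinner :: "'a \<Rightarrow> 'a \<Rightarrow> complex"
  assumes cinner_commute: "cinner x y = cnj (cinner y x)"
    and cinner_add_left: "cinner (x + y) z = cinner x z + cinner y z"
    and cinner_scaleC_left: "cinner (c *\<^sub>C x) y = c * cinner x y"
    and inner_eq_Re_cinner: "inner x y = Re (cinner x y)"

class chilbert_space = complex_inner + complete_space

lemma cinner_add_right: "cinner x (y + z) = cinner x y + cinner x (z::'a::complex_inner)"
  by (metis cinner_add_left cinner_commute complex_cnj_add)

lemma cinner_scaleC_right: "cinner x (c *\<^sub>C y) = cnj c * cinner x (y::'a::complex_inner)"
  by (metis cinner_commute cinner_scaleC_left complex_cnj_mult)

lemma cinner_zero_left [simp]: "cinner 0 (x::'a::complex_inner) = 0"
  using cinner_add_left[of 0 0 x] by simp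

lemma cinner_zero_right [simp]: "cinner (x::'a::complex_inner) 0 = 0"
  using cinner_add_right[of x 0 0] by simp

lemma cinner_diff_left: "cinner (x - y) z = cinner x z - cinner y (z::'a::complex_inner)"
  using cinner_add_left[of "x - y" y z] by simp

lemma cinner_diff_right: "cinner z (x - y) = cinner z x - cinner z (y::'a::complex_inner)"
  using cinner_add_right[of z "x - y" y] by simp

lemma cinner_sum_left: "cinner (\<Sum>i\<in>A. f i) y = (\<Sum>i\<in>A. cinner (f i) (y::'a::complex_inner))"
  by (induction A rule: infinite_finite_induct) (auto simp: cinner_add_left)

lemma cinner_sum_right: "cinner y (\<Sum>i\<in>A. f i) = (\<Sum>i\<in>A. cinner (y::'a::complex_inner) (f i))"
  by (induction A rule: infinite_finite_induct) (auto simp: cinner_add_right)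

lemma cinner_self: "cinner x x = complex_of_real ((norm (x::'a::complex_inner))\<^sup>2)"
proof -
  have "Im (cinner x x) = 0"
    using arg_cong[OF cinner_commute[of x x], of Im] by simp
  moreover have "Re (cinner x x) = (norm x)\<^sup>2"
    by (simp add: power2_norm_eq_inner inner_eq_Re_cinner)
  ultimately show ?thesis by (simp add: complex_eq_iff)
qed

lemma norm_scaleC [simp]: "norm (c *\<^sub>C x) = cmod c * norm (x::'a::complex_inner)"
proof -
  have "complex_of_real ((norm (c *\<^sub>C x))\<^sup>2) = complex_of_real ((cmod c * norm x)\<^sup>2)"
    unfolding cinner_self[symmetric] cinner_scaleC_left cinner_scaleC_right
    by (simp only: cinner_self power_mult_distrib of_real_mult complex_norm_square mult_ac)
  then show ?thesis
    by (simp only: of_real_eq_iff) (auto intro: power2_eq_imp_eq)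
qed

lemma cmod_cinner_le: "cmod (cinner x y) \<le> norm x * norm (y::'a::complex_inner)"
proof (cases "cinner x y = 0")
  case False
  define c where "c = cnj (sgn (cinner x y))"
  have c: "cmod c = 1" using False by (simp add: c_def norm_sgn)
  have "c * cinner x y = complex_of_real (cmod (cinner x y))"
    using False by (simp add: c_def sgn_eq field_simps complex_norm_square[symmetric] power2_eq_square)
  then have "cmod (cinner x y) = inner (c *\<^sub>C x) y"
    by (simp add: inner_eq_Re_cinner cinner_scaleC_left)
  also have "\<dots> \<le> norm (c *\<^sub>C x) * norm y" by (rule norm_cauchy_schwarz)
  finally show ?thesis using c by simp
qed simp

lemma tendsto_cinner_left:
  assumes "(f \<longlongrightarrow> (x::'a::complex_inner)) F"
  shows "((\<lambda>i. cinner (f i) y) \<longlongrightarrow> cinner x y) F"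
proof -
  have "((\<lambda>i. norm (f i - x) * norm y) \<longlongrightarrow> 0) F"
    using assms by (auto intro!: tendsto_mult_left_zero tendsto_norm_zero simp: LIM_zero)
  then have "((\<lambda>i. cinner (f i) y - cinner x y) \<longlongrightarrow> 0) F"
    by (rule Lim_null_comparison[rotated])
       (auto simp: cinner_diff_left[symmetric] cmod_cinner_le)
  then show ?thesis by (simp add: LIM_zero_iff)
qed

definition is_onb :: "'a::complex_inner set \<Rightarrow> bool" where
  "is_onb B \<longleftrightarrow> (\<forall>b\<in>B. norm b = 1) \<and> (\<forall>b\<in>B. \<forall>c\<in>B. b \<noteq> c \<longrightarrow> cinner b c = 0)
     \<and> closure (cspan B) = UNIV"

lemma cinner_orthonormal_sum:
  fixes F :: "'a::complex_inner set"
  assumes "finite F" "\<And>b. b \<in> F \<Longrightarrow> norm b = 1"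
    "\<And>b c. b \<in> F \<Longrightarrow> c \<in> F \<Longrightarrow> b \<noteq> c \<Longrightarrow> cinner b c = 0" "c \<in> F"
  shows "cinner (\<Sum>b\<in>F. g b *\<^sub>C b) c = g c"
proof -
  have "cinner (\<Sum>b\<in>F. g b *\<^sub>C b) c = (\<Sum>b\<in>F. if b = c then g c else 0)"
    unfolding cinner_sum_left cinner_scaleC_left
    by (intro sum.cong) (use assms in \<open>auto simp: cinner_self\<close>)
  then show ?thesis using assms by simp
qed

lemma norm_orthonormal_sum:
  fixes F :: "'a::complex_inner set"
  assumes "finite F" "\<And>b. b \<in> F \<Longrightarrow> norm b = 1"
    "\<And>b c. b \<in> F \<Longrightarrow> c \<in> F \<Longrightarrow> b \<noteq> c \<Longrightarrow> cinner b c = 0"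
  shows "(norm (\<Sum>b\<in>F. g b *\<^sub>C b))\<^sup>2 = (\<Sum>b\<in>F. (cmod (g b))\<^sup>2)"
proof -
  have "complex_of_real ((norm (\<Sum>b\<in>F. g b *\<^sub>C b))\<^sup>2) =
      (\<Sum>c\<in>F. cnj (g c) * cinner (\<Sum>b\<in>F. g b *\<^sub>C b) c)"
    unfolding cinner_self[symmetric] by (simp add: cinner_sum_right cinner_scaleC_right)
  also have "\<dots> = (\<Sum>c\<in>F. cnj (g c) * g c)"
    using assms by (intro sum.cong) (auto simp: cinner_orthonormal_sum)
  also have "\<dots> = complex_of_real (\<Sum>b\<in>F. (cmod (g b))\<^sup>2)"
    by (simp only: of_real_sum complex_norm_square mult.commute)
  finally show ?thesis using of_real_eq_iff by blast
qed

lemma bessel: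
  fixes F :: "'a::complex_inner set"
  assumes F: "finite F" "\<And>b. b \<in> F \<Longrightarrow> norm b = 1"
    "\<And>b c. b \<in> F \<Longrightarrow> c \<in> F \<Longrightarrow> b \<noteq> c \<Longrightarrow> cinner b c = 0"
  shows "(\<Sum>b\<in>F. (cmod (cinner x b))\<^sup>2) \<le> (norm x)\<^sup>2"
proof -
  define y where "y = (\<Sum>b\<in>F. cinner x b *\<^sub>C b)"
  have ny: "(norm y)\<^sup>2 = (\<Sum>b\<in>F. (cmod (cinner x b))\<^sup>2)"
    unfolding y_def by (rule norm_orthonormal_sum[OF F])
  have "cinner x y = (\<Sum>b\<in>F. cnj (cinner x b) * cinner x b)"
    by (simp add: y_def cinner_sum_right cinner_scaleC_right)
  also have "\<dots> = complex_of_real ((norm y)\<^sup>2)"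
    by (simp only: ny of_real_sum complex_norm_square mult.commute)
  finally have "(norm y)\<^sup>2 \<le> norm x * norm y"
    using cmod_cinner_le[of x y] by (simp only: norm_of_real abs_power2 abs_norm_cancel)
  then have "norm y \<le> norm x"
    by (cases "norm y = 0") (auto simp: power2_eq_square)
  then show ?thesis by (simp flip: ny)
qed

lemma closure_cspan_of_maximal:
  fixes B :: "'a::chilbert_space set"
  assumes n: "\<And>b. b \<in> B \<Longrightarrow> norm b = 1"
    and o: "\<And>b c. b \<in> B \<Longrightarrow> c \<in> B \<Longrightarrow> b \<noteq> c \<Longrightarrow> cinner b c = 0"
    and m: "\<And>x. (\<And>b. b \<in> B \<Longrightarrow> cinner x b = 0) \<Longrightarrow> x = 0"
  shows "closure (cspan B) = UNIV"
proof -
  have "x \<in> closure (cspan B)" for x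
  proof -
    define \<Phi> where "\<Phi> F = (\<Sum>b\<in>F. (cmod (cinner x b))\<^sup>2)" for F
    define A where "A = \<Phi> ` {F. finite F \<and> F \<subseteq> B}"
    have A_bdd: "bdd_above A"
    proof (rule bdd_aboveI)
      fix r assume "r \<in> A"
      then obtain F where F: "finite F" "F \<subseteq> B" "r = \<Phi> F" by (auto simp: A_def)
      show "r \<le> (norm x)\<^sup>2"
        unfolding F(3) \<Phi>_def using F by (intro bessel[OF F(1)] n o) auto
    qed
    have A_ne: "A \<noteq> {}" by (auto simp: A_def)
    define s where "s = Sup A"
    have le_s: "\<Phi> F \<le> s" if "finite F" "F \<subseteq> B" for F
      unfolding s_def using that A_bdd by (intro cSup_upper) (auto simp: A_def)
    have "\<exists>F. finite F \<and> F \<subseteq> B \<and> \<Phi> F > s - 1 / Suc k" for k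
    proof -
      have "s - 1 / Suc k < Sup A" by (simp add: s_def)
      then show ?thesis using less_cSup_iff[OF A_ne A_bdd] by (auto simp: A_def)
    qed
    then obtain G where G: "\<And>k. finite (G k)" "\<And>k. G k \<subseteq> B" "\<And>k. \<Phi> (G k) > s - 1 / Suc k"
      by metis
    define F where "F k = (\<Union>i\<le>k. G i)" for k
    have F: "finite (F k)" "F k \<subseteq> B" for k using G by (auto simp: F_def)
    have F_mono: "F k \<subseteq> F l" if "k \<le> l" for k l using that by (fastforce simp: F_def)
    have F_ge: "\<Phi> (F k) > s - 1 / Suc k" for k
    proof -
      have "\<Phi> (G k) \<le> \<Phi> (F k)"
        unfolding \<Phi>_def using F by (intro sum_mono2) (auto simp: F_def)
      then show ?thesis using G(3)[of k] by simp
    qed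
    define y where "y k = (\<Sum>b\<in>F k. cinner x b *\<^sub>C b)" for k
    have y_diff: "(norm (y l - y k))\<^sup>2 \<le> 1 / Suc k" if "k \<le> l" for k l
    proof -
      have "y l - y k = (\<Sum>b\<in>F l - F k. cinner x b *\<^sub>C b)"
        using F_mono[OF that] F by (simp add: y_def sum_diff)
      then have "(norm (y l - y k))\<^sup>2 = \<Phi> (F l - F k)"
        unfolding \<Phi>_def by (simp only:) (intro norm_orthonormal_sum n o; use F in blast)
      also have "\<dots> = \<Phi> (F l) - \<Phi> (F k)"
        unfolding \<Phi>_def using F_mono[OF that] F by (simp add: sum_diff)
      also have "\<dots> \<le> 1 / Suc k" using le_s[OF F, of l] F_ge[of k] by simp
      finally show ?thesis .
    qed
    have "Cauchy y"
    proof (rule CauchyI')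
      fix e :: real assume e: "e > 0"
      obtain N where N: "1 / Suc N < e\<^sup>2"
        using nat_approx_posE[of "e\<^sup>2"] e by auto
      have "dist (y k) (y l) < e" if "N \<le> k" "k < l" for k l
      proof -
        have "(norm (y l - y k))\<^sup>2 \<le> 1 / Suc k" using y_diff that by simp
        also have "\<dots> \<le> 1 / Suc N" using that by (simp add: frac_le)
        also have "\<dots> < e\<^sup>2" by fact
        finally show ?thesis using e by (simp add: dist_norm norm_minus_commute power2_less_imp_less)
      qed
      then show "\<exists>M. \<forall>m\<ge>M. \<forall>n>m. dist (y m) (y n) < e" by blast
    qed
    then obtain z where z: "y \<longlonglongrightarrow> z" using Cauchy_convergent convergent_def by blast
    have "x - z = 0"
    proof (rule m)
      fix b assume b: "b \<in> B"
      have lim: "(\<lambda>k. cinner (y k) b) \<longlonglongrightarrow> cinner z b" by (rule tendsto_cinner_left[OF z])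
      have "(\<lambda>k. cinner (y k) b) \<longlonglongrightarrow> cinner x b"
      proof (cases "\<exists>k. b \<in> F k")
        case True
        then obtain k where k: "b \<in> F k" by blast
        have "cinner (y l) b = cinner x b" if "l \<ge> k" for l
          unfolding y_def
          by (intro cinner_orthonormal_sum n o; use F k F_mono[OF that] in blast)
        then have "\<forall>\<^sub>F l in sequentially. cinner (y l) b = cinner x b"
          using eventually_sequentially by blast
        then show ?thesis by (rule tendsto_eventually)
      next
        case False
        have yb: "cinner (y k) b = 0" for k
        proof -
          have "cinner a b = 0" if "a \<in> F k" for a
            using that False b F(2)[of k] by (intro o) blast+
          then show ?thesis by (simp add: y_def cinner_sum_left cinner_scaleC_left)
        qed
        have small: "(cmod (cinner x b))\<^sup>2 \<le> 1 / Suc k" for k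
        proof -
          have "\<Phi> (insert b (F k)) \<le> s" by (rule le_s) (use F b in auto)
          moreover have "\<Phi> (insert b (F k)) = (cmod (cinner x b))\<^sup>2 + \<Phi> (F k)"
            unfolding \<Phi>_def using False F by simp
          ultimately show ?thesis using F_ge[of k] by simp
        qed
        have "(cmod (cinner x b))\<^sup>2 \<le> 0"
          by (rule LIMSEQ_le_const[OF LIMSEQ_inverse_real_of_nat])
             (use small in \<open>auto simp: inverse_eq_divide\<close>)
        then show ?thesis using yb by simp
      qed
      then show "cinner (x - z) b = 0"
        using LIMSEQ_unique[OF lim] by (simp add: cinner_diff_left)
    qed
    moreover have "y k \<in> cspan B" for k
      unfolding y_def using F(2)[of k]
      by (intro complex_vector.span_sum complex_vector.span_scale complex_vector.span_base) auto
    ultimately show ?thesis using z closure_sequential by auto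
  qed
  then show ?thesis by blast
qed

lemma onb_exists: "\<exists>B :: 'a::chilbert_space set. is_onb B"
proof -
  define OS where "OS = {B :: 'a set. (\<forall>b\<in>B. norm b = 1) \<and> (\<forall>b\<in>B. \<forall>c\<in>B. b \<noteq> c \<longrightarrow> cinner b c = 0)}"
  have "\<exists>M\<in>OS. \<forall>X\<in>OS. M \<subseteq> X \<longrightarrow> X = M"
  proof (rule subset_Zorn_nonempty)
    show "OS \<noteq> {}" by (auto simp: OS_def)
    fix C assume C: "C \<noteq> {}" "subset.chain OS C"
    have "norm b = 1" if "b \<in> \<Union>C" for b
      using that C unfolding OS_def subset.chain_def by auto
    moreover have "cinner b c = 0" if bc: "b \<in> \<Union>C" "c \<in> \<Union>C" "b \<noteq> c" for b c
    proof -
      obtain X Y where XY: "X \<in> C" "Y \<in> C" "b \<in> X" "c \<in> Y" using bc by blast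
      then obtain Z where "Z \<in> C" "b \<in> Z" "c \<in> Z"
        using C(2) unfolding subset_chain_def by blast
      moreover from this have "Z \<in> OS" using C(2) unfolding subset_chain_def by blast
      ultimately show ?thesis using bc(3) by (auto simp: OS_def)
    qed
    ultimately show "\<Union>C \<in> OS" by (auto simp: OS_def)
  qed
  then obtain M where M: "M \<in> OS" "\<And>X. X \<in> OS \<Longrightarrow> M \<subseteq> X \<Longrightarrow> X = M" by blast
  have Mn: "norm b = 1" if "b \<in> M" for b using M that by (auto simp: OS_def)
  have Mo: "cinner b c = 0" if "b \<in> M" "c \<in> M" "b \<noteq> c" for b c using M that by (auto simp: OS_def)
  have "closure (cspan M) = UNIV"
  proof (rule closure_cspan_of_maximal[OF Mn Mo])
    fix x assume x: "\<And>b. b \<in> M \<Longrightarrow> cinner x b = 0"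
    show "x = 0"
    proof (rule ccontr)
      assume nz: "x \<noteq> 0"
      define u where "u = complex_of_real (1 / norm x) *\<^sub>C x"
      have u: "norm u = 1" using nz by (simp add: u_def norm_divide)
      have uM: "cinner u b = 0" "cinner b u = 0" if "b \<in> M" for b
        using x[OF that] cinner_commute[of b x]
        by (auto simp: u_def cinner_scaleC_left cinner_scaleC_right)
      have "insert u M \<in> OS" using Mn Mo u uM by (auto simp: OS_def)
      then have "u \<in> M" using M(2) by blast
      then have "cinner u u = 0" using uM by blast
      then show False using u by (simp add: cinner_self)
    qed
  qed
  then show ?thesis using Mn Mo unfolding is_onb_def by blast
qed

definition onb :: "'a::chilbert_space set" where
  "onb = (SOME B. is_onb B)"

lemma is_onb_onb: "is_onb onb"
  unfolding onb_def using onb_exists by (rule someI_ex)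

lemma antilinear_family_bound:
  fixes B :: "'a::complex_inner set" and \<phi> :: "'b \<Rightarrow> 'a \<Rightarrow> complex"
  assumes B: "is_onb B" and L: "finite L"
    and add: "\<And>l x y. l \<in> L \<Longrightarrow> \<phi> l (x + y) = \<phi> l x + \<phi> l y"
    and scale: "\<And>l c x. l \<in> L \<Longrightarrow> \<phi> l (c *\<^sub>C x) = cnj c * \<phi> l x"
    and bdd: "\<And>l. l \<in> L \<Longrightarrow> \<exists>C. \<forall>x. cmod (\<phi> l x) \<le> C * norm x"
    and S: "\<And>F. finite F \<Longrightarrow> F \<subseteq> B \<Longrightarrow> (\<Sum>l\<in>L. \<Sum>b\<in>F. (cmod (\<phi> l b))\<^sup>2) \<le> S"
  shows "(\<Sum>l\<in>L. (cmod (\<phi> l x))\<^sup>2) \<le> (norm x)\<^sup>2 * S"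
proof -
  have zero: "\<phi> l 0 = 0" if "l \<in> L" for l using add[OF that, of 0 0] by simp
  have sum: "\<phi> l (\<Sum>b\<in>F. r b *\<^sub>C b) = (\<Sum>b\<in>F. cnj (r b) * \<phi> l b)" if "l \<in> L" for l F r
    by (induction F rule: infinite_finite_induct) (auto simp: zero add scale that)
  have fin: "(\<Sum>l\<in>L. (cmod (\<phi> l x))\<^sup>2) \<le> (norm x)\<^sup>2 * S" if x: "x \<in> cspan B" for x
  proof -
    obtain F r where F: "finite F" "F \<subseteq> B" and xF: "x = (\<Sum>b\<in>F. r b *\<^sub>C b)"
      using x unfolding complex_vector.span_explicit by blast
    have nx: "(norm x)\<^sup>2 = (\<Sum>b\<in>F. (cmod (r b))\<^sup>2)"
      unfolding xF
    proof (rule norm_orthonormal_sum[OF F(1)])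
      show "norm b = 1" if "b \<in> F" for b using B F(2) that unfolding is_onb_def by blast
      show "cinner b c = 0" if "b \<in> F" "c \<in> F" "b \<noteq> c" for b c
        using B F(2) that unfolding is_onb_def by blast
    qed
    have "(cmod (\<phi> l x))\<^sup>2 \<le> (norm x)\<^sup>2 * (\<Sum>b\<in>F. (cmod (\<phi> l b))\<^sup>2)" if l: "l \<in> L" for l
    proof -
      have "cmod (\<phi> l x) \<le> (\<Sum>b\<in>F. cmod (r b) * cmod (\<phi> l b))"
        unfolding xF sum[OF l] by (rule order_trans[OF norm_sum]) (simp add: norm_mult)
      then have "(cmod (\<phi> l x))\<^sup>2 \<le> (\<Sum>b\<in>F. cmod (r b) * cmod (\<phi> l b))\<^sup>2"
        by (intro power_mono) auto
      also have "\<dots> \<le> (\<Sum>b\<in>F. (cmod (r b))\<^sup>2) * (\<Sum>b\<in>F. (cmod (\<phi> l b))\<^sup>2)"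
        by (rule Cauchy_Schwarz_ineq_sum)
      finally show ?thesis by (simp add: nx)
    qed
    then have "(\<Sum>l\<in>L. (cmod (\<phi> l x))\<^sup>2) \<le> (\<Sum>l\<in>L. (norm x)\<^sup>2 * (\<Sum>b\<in>F. (cmod (\<phi> l b))\<^sup>2))"
      by (rule sum_mono)
    also have "\<dots> = (norm x)\<^sup>2 * (\<Sum>l\<in>L. \<Sum>b\<in>F. (cmod (\<phi> l b))\<^sup>2)"
      by (simp add: sum_distrib_left)
    also have "\<dots> \<le> (norm x)\<^sup>2 * S" using S[OF F] by (simp add: mult_left_mono)
    finally show ?thesis .
  qed
  obtain y where y: "\<And>k. y k \<in> cspan B" "y \<longlonglongrightarrow> x"
    using B unfolding is_onb_def by (metis UNIV_I closure_sequential)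
  have "(\<lambda>k. \<phi> l (y k)) \<longlonglongrightarrow> \<phi> l x" if l: "l \<in> L" for l
  proof -
    obtain C where C: "\<And>x. cmod (\<phi> l x) \<le> C * norm x" using bdd[OF l] by blast
    have diff: "\<phi> l (u - v) = \<phi> l u - \<phi> l v" for u v
      using add[OF l, of "u - v" v] by simp
    have "(\<lambda>k. C * norm (y k - x)) \<longlonglongrightarrow> 0"
      using y(2) by (auto intro!: tendsto_mult_right_zero tendsto_norm_zero simp: LIM_zero)
    then have "(\<lambda>k. \<phi> l (y k) - \<phi> l x) \<longlonglongrightarrow> 0"
      by (rule Lim_null_comparison[rotated]) (auto simp: diff[symmetric] C)
    then show ?thesis by (simp add: LIM_zero_iff)
  qed
  then have "(\<lambda>k. \<Sum>l\<in>L. (cmod (\<phi> l (y k)))\<^sup>2) \<longlonglongrightarrow> (\<Sum>l\<in>L. (cmod (\<phi> l x))\<^sup>2)"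
    by (intro tendsto_sum tendsto_power tendsto_norm)
  moreover have "(\<lambda>k. (norm (y k))\<^sup>2 * S) \<longlonglongrightarrow> (norm x)\<^sup>2 * S"
    using y(2) by (intro tendsto_mult tendsto_power tendsto_norm tendsto_const)
  ultimately show ?thesis by (rule LIMSEQ_le) (auto simp: fin y)
qed

section \<open>The symmetric Fock space\<close>

text \<open>The \<open>n\<close>-fold Hilbert space tensor power of \<open>H\<close> is realised as the space of bounded
  conjugate-multilinear Hilbert--Schmidt functionals on \<open>H\<^sup>n\<close>, with the elementary tensor
  \<open>\<xi>\<^sub>1 \<otimes> \<dots> \<otimes> \<xi>\<^sub>n\<close> given by \<open>(\<zeta>\<^sub>1, \<dots>, \<zeta>\<^sub>n) \<mapsto> \<langle>\<xi>\<^sub>1|\<zeta>\<^sub>1\<rangle> \<cdots> \<langle>\<xi>\<^sub>n|\<zeta>\<^sub>n\<rangle>\<close> and with inner product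
  \<open>\<langle>f|g\<rangle> = (\<Sum>b\<^sub>1\<dots>b\<^sub>n. f(b\<^sub>1,\<dots>,b\<^sub>n) cnj (g(b\<^sub>1,\<dots>,b\<^sub>n)))\<close>, the sum extending over any orthonormal basis.
  A function on lists collects one functional for each \<open>n\<close>: the condition of square summability over
  the lists of basis vectors of all lengths gives the Hilbert direct sum over \<open>n\<close>, and invariance under
  permutations singles out the symmetric tensors.\<close>

definition fock_vectors :: "('h::chilbert_space list \<Rightarrow> complex) set" where
  "fock_vectors = {f.
     (\<forall>xs x y ys. f (xs @ (x + y) # ys) = f (xs @ x # ys) + f (xs @ y # ys)) \<and>
     (\<forall>xs c x ys. f (xs @ (c *\<^sub>C x) # ys) = cnj c * f (xs @ x # ys)) \<and>
     (\<forall>n. \<exists>C. \<forall>xs. length xs = n \<longrightarrow> cmod (f xs) \<le> C * (\<Prod>x\<leftarrow>xs. norm x)) \<and>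
     (\<forall>xs ys. mset xs = mset ys \<longrightarrow> f xs = f ys) \<and>
     (\<lambda>xs. (cmod (f xs))\<^sup>2) summable_on lists onb}"

lemma fock_vectorsI:
  assumes "\<And>xs x y ys. f (xs @ (x + y) # ys) = f (xs @ x # ys) + f (xs @ y # ys)"
    and "\<And>xs c x ys. f (xs @ (c *\<^sub>C x) # ys) = cnj c * f (xs @ x # ys)"
    and "\<And>n. \<exists>C. \<forall>xs. length xs = n \<longrightarrow> cmod (f xs) \<le> C * (\<Prod>x\<leftarrow>xs. norm x)"
    and "\<And>xs ys. mset xs = mset ys \<Longrightarrow> f xs = f ys"
    and "(\<lambda>xs. (cmod (f xs))\<^sup>2) summable_on lists onb"
  shows "f \<in> fock_vectors"
  unfolding fock_vectors_def
  by (intro CollectI conjI allI impI) (rule assms; assumption)+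

lemma fock_vectorsD:
  assumes "f \<in> fock_vectors"
  shows "f (xs @ (x + y) # ys) = f (xs @ x # ys) + f (xs @ y # ys)"
    and "f (xs @ (c *\<^sub>C x) # ys) = cnj c * f (xs @ x # ys)"
    and "\<exists>C. \<forall>xs. length xs = n \<longrightarrow> cmod (f xs) \<le> C * (\<Prod>x\<leftarrow>xs. norm x)"
    and "mset us = mset vs \<Longrightarrow> f us = f vs"
    and "(\<lambda>xs. (cmod (f xs))\<^sup>2) summable_on lists onb"
  using assms unfolding fock_vectors_def mem_Collect_eq by blast+

lemma fock_vectors_zero: "(\<lambda>_. 0) \<in> fock_vectors"
  by (rule fock_vectorsI) (auto intro: exI[of _ 0])

lemma fock_vectors_add:
  assumes f: "f \<in> fock_vectors" and g: "g \<in> fock_vectors"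
  shows "(\<lambda>xs. f xs + g xs) \<in> fock_vectors"
proof (rule fock_vectorsI)
  fix n
  obtain C D where "\<And>xs. length xs = n \<Longrightarrow> cmod (f xs) \<le> C * (\<Prod>x\<leftarrow>xs. norm x)"
    "\<And>xs. length xs = n \<Longrightarrow> cmod (g xs) \<le> D * (\<Prod>x\<leftarrow>xs. norm x)"
    using fock_vectorsD(3)[OF f, of n] fock_vectorsD(3)[OF g, of n] by blast
  then have "cmod (f xs + g xs) \<le> (C + D) * (\<Prod>x\<leftarrow>xs. norm x)" if "length xs = n" for xs
    using that unfolding distrib_right by (intro norm_triangle_le add_mono)
  then show "\<exists>C. \<forall>xs. length xs = n \<longrightarrow> cmod (f xs + g xs) \<le> C * (\<Prod>x\<leftarrow>xs. norm x)" by blast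
next
  show "(\<lambda>xs. (cmod (f xs + g xs))\<^sup>2) summable_on lists onb"
  proof (rule summable_on_comparison_test)
    show "(\<lambda>xs. 2 * (cmod (f xs))\<^sup>2 + 2 * (cmod (g xs))\<^sup>2) summable_on lists onb"
      by (intro summable_on_add summable_on_cmult_right fock_vectorsD(5) f g)
    show "(cmod (f xs + g xs))\<^sup>2 \<le> 2 * (cmod (f xs))\<^sup>2 + 2 * (cmod (g xs))\<^sup>2" for xs
    proof -
      have "(cmod (f xs + g xs))\<^sup>2 \<le> (cmod (f xs) + cmod (g xs))\<^sup>2"
        by (intro power_mono norm_triangle_ineq) auto
      then show ?thesis
        using zero_le_power2[of "cmod (f xs) - cmod (g xs)"] by (simp add: power2_eq_square algebra_simps)
    qed
  qed auto
next
  show "f xs + g xs = f ys + g ys" if "mset xs = mset ys" for xs ys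
    using fock_vectorsD(4)[OF f that] fock_vectorsD(4)[OF g that] by simp
qed (auto simp: fock_vectorsD(1,2)[OF f] fock_vectorsD(1,2)[OF g] algebra_simps)

lemma fock_vectors_scale:
  assumes f: "f \<in> fock_vectors"
  shows "(\<lambda>xs. c * f xs) \<in> fock_vectors"
proof (rule fock_vectorsI)
  fix n
  obtain C where "\<And>xs. length xs = n \<Longrightarrow> cmod (f xs) \<le> C * (\<Prod>x\<leftarrow>xs. norm x)"
    using fock_vectorsD(3)[OF f, of n] by blast
  then have "cmod (c * f xs) \<le> (cmod c * C) * (\<Prod>x\<leftarrow>xs. norm x)" if "length xs = n" for xs
    using that by (simp add: norm_mult mult.assoc mult_left_mono)
  then show "\<exists>C. \<forall>xs. length xs = n \<longrightarrow> cmod (c * f xs) \<le> C * (\<Prod>x\<leftarrow>xs. norm x)" by blast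
next
  show "(\<lambda>xs. (cmod (c * f xs))\<^sup>2) summable_on lists onb"
    unfolding norm_mult power_mult_distrib
    by (intro summable_on_cmult_right fock_vectorsD(5) f)
next
  show "c * f xs = c * f ys" if "mset xs = mset ys" for xs ys
    using fock_vectorsD(4)[OF f that] by simp
qed (auto simp: fock_vectorsD(1,2)[OF f] algebra_simps)

lemma fock_vectors_bound:
  assumes f: "f \<in> fock_vectors"
  shows "(cmod (f xs))\<^sup>2 \<le> (\<Prod>x\<leftarrow>xs. (norm x)\<^sup>2) * infsum (\<lambda>xs. (cmod (f xs))\<^sup>2) (lists onb)"
proof -
  have gen: "(\<Sum>l\<in>L. (cmod (f (xs @ l)))\<^sup>2)
      \<le> (\<Prod>x\<leftarrow>xs. (norm x)\<^sup>2) * infsum (\<lambda>xs. (cmod (f xs))\<^sup>2) (lists onb)"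
    if "finite L" "L \<subseteq> lists onb" for L xs
    using that
  proof (induction xs arbitrary: L rule: rev_induct)
    case Nil
    then show ?case
      using finite_sum_le_infsum[OF fock_vectorsD(5)[OF f]] by auto
  next
    case (snoc x xs)
    let ?S = "(\<Prod>x\<leftarrow>xs. (norm x)\<^sup>2) * infsum (\<lambda>xs. (cmod (f xs))\<^sup>2) (lists onb)"
    have "(\<Sum>l\<in>L. (cmod (f (xs @ x # l)))\<^sup>2) \<le> (norm x)\<^sup>2 * ?S"
    proof (rule antilinear_family_bound[OF is_onb_onb snoc.prems(1)])
      show "f (xs @ (x + y) # l) = f (xs @ x # l) + f (xs @ y # l)" for x y l
        by (rule fock_vectorsD(1)[OF f])
      show "f (xs @ (c *\<^sub>C x) # l) = cnj c * f (xs @ x # l)" for c x l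
        by (rule fock_vectorsD(2)[OF f])
      show "\<exists>C. \<forall>x. cmod (f (xs @ x # l)) \<le> C * norm x" for l
      proof -
        obtain C where C: "\<And>ys. length ys = length (xs @ undefined # l) \<Longrightarrow>
            cmod (f ys) \<le> C * (\<Prod>x\<leftarrow>ys. norm x)"
          using fock_vectorsD(3)[OF f] by blast
        have "cmod (f (xs @ x # l)) \<le>
            (C * (\<Prod>x\<leftarrow>xs. norm x) * (\<Prod>x\<leftarrow>l. norm x)) * norm x" for x
          using C[of "xs @ x # l"] by (simp add: mult_ac)
        then show ?thesis by blast
      qed
      fix F :: "'a set" assume F: "finite F" "F \<subseteq> onb"
      have "(\<Sum>l\<in>L. \<Sum>b\<in>F. (cmod (f (xs @ b # l)))\<^sup>2)
          = (\<Sum>(l, b)\<in>L \<times> F. (cmod (f (xs @ b # l)))\<^sup>2)"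
        by (rule sum.cartesian_product)
      also have "\<dots> = (\<Sum>l\<in>(\<lambda>(l, b). b # l) ` (L \<times> F). (cmod (f (xs @ l)))\<^sup>2)"
        by (subst sum.reindex) (auto simp: inj_on_def case_prod_unfold)
      also have "\<dots> \<le> ?S"
        by (rule snoc.IH) (use snoc.prems F in \<open>auto dest!: subsetD\<close>)
      finally show "(\<Sum>l\<in>L. \<Sum>b\<in>F. (cmod (f (xs @ b # l)))\<^sup>2) \<le> ?S" .
    qed
    then show ?case by (simp add: mult_ac)
  qed
  show ?thesis using gen[of "{[]}" xs] by simp
qed

typedef (overloaded) 'h fock = "fock_vectors :: ('h::chilbert_space list \<Rightarrow> complex) set"
  using fock_vectors_zero by blast

setup_lifting type_definition_fock

instantiation fock :: (chilbert_space) complex_inner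
begin

lift_definition zero_fock :: "'a fock" is "\<lambda>_. 0"
  by (rule fock_vectors_zero)

lift_definition plus_fock :: "'a fock \<Rightarrow> 'a fock \<Rightarrow> 'a fock" is "\<lambda>f g xs. f xs + g xs"
  by (rule fock_vectors_add)

lift_definition scaleC_fock :: "complex \<Rightarrow> 'a fock \<Rightarrow> 'a fock" is "\<lambda>c f xs. c * f xs"
  by (rule fock_vectors_scale)

lift_definition uminus_fock :: "'a fock \<Rightarrow> 'a fock" is "\<lambda>f xs. - f xs"
  using fock_vectors_scale[of _ "-1"] by simp

lift_definition minus_fock :: "'a fock \<Rightarrow> 'a fock \<Rightarrow> 'a fock" is "\<lambda>f g xs. f xs - g xs"
  using fock_vectors_add[OF _ fock_vectors_scale[of _ "-1"]] by simp

definition scaleR_fock :: "real \<Rightarrow> 'a fock \<Rightarrow> 'a fock" where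
  "scaleR_fock r u = complex_of_real r *\<^sub>C u"

definition cinner_fock :: "'a fock \<Rightarrow> 'a fock \<Rightarrow> complex" where
  "cinner_fock u v = (\<Sum>\<^sub>\<infinity>xs\<in>lists onb. Rep_fock u xs * cnj (Rep_fock v xs))"

definition inner_fock :: "'a fock \<Rightarrow> 'a fock \<Rightarrow> real" where
  "inner_fock u v = Re (cinner u v)"

definition norm_fock :: "'a fock \<Rightarrow> real" where
  "norm_fock u = sqrt (inner u u)"

definition sgn_fock :: "'a fock \<Rightarrow> 'a fock" where
  "sgn_fock u = inverse (norm u) *\<^sub>R u"

definition dist_fock :: "'a fock \<Rightarrow> 'a fock \<Rightarrow> real" where
  "dist_fock u v = norm (u - v)"

definition uniformity_fock :: "('a fock \<times> 'a fock) filter" where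
  "uniformity_fock = (INF e\<in>{0 <..}. principal {(x, y). dist x y < e})"

definition open_fock :: "'a fock set \<Rightarrow> bool" where
  "open_fock U \<longleftrightarrow> (\<forall>x\<in>U. \<forall>\<^sub>F (x', y) in uniformity. x' = x \<longrightarrow> y \<in> U)"

lemma fock_summable:
  "(\<lambda>xs. Rep_fock u xs * cnj (Rep_fock v xs)) summable_on lists (onb :: 'a set)"
proof (rule abs_summable_summable[OF Infinite_Sum.abs_summable_on_comparison_test'])
  show "(\<lambda>xs. (cmod (Rep_fock u xs))\<^sup>2 + (cmod (Rep_fock v xs))\<^sup>2) summable_on lists onb"
    using Rep_fock[of u] Rep_fock[of v] by (intro summable_on_add fock_vectorsD(5))
  fix xs
  have "2 * (cmod (Rep_fock u xs) * cmod (Rep_fock v xs))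
      \<le> (cmod (Rep_fock u xs))\<^sup>2 + (cmod (Rep_fock v xs))\<^sup>2"
    using zero_le_power2[of "cmod (Rep_fock u xs) - cmod (Rep_fock v xs)"]
    by (simp add: power2_eq_square algebra_simps)
  moreover have "0 \<le> cmod (Rep_fock u xs) * cmod (Rep_fock v xs)" by simp
  ultimately show "cmod (Rep_fock u xs * cnj (Rep_fock v xs))
      \<le> (cmod (Rep_fock u xs))\<^sup>2 + (cmod (Rep_fock v xs))\<^sup>2"
    unfolding norm_mult complex_mod_cnj by linarith
qed

lemma inner_fock_self:
  "inner (u :: 'a fock) u = (\<Sum>\<^sub>\<infinity>xs\<in>lists onb. (cmod (Rep_fock u xs))\<^sup>2)"
  unfolding inner_fock_def cinner_fock_def
  by (subst infsum_Re[OF fock_summable, symmetric], intro infsum_cong)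
     (simp add: complex_norm_square[symmetric] del: of_real_power)

lemma cmod_Rep_fock_le:
  "cmod (Rep_fock u xs) \<le> norm (u :: 'a fock) * (\<Prod>x\<leftarrow>xs. norm x)"
proof (rule power2_le_imp_le)
  have nn: "inner u u \<ge> 0" unfolding inner_fock_self by (rule infsum_nonneg) auto
  have "(\<Prod>x\<leftarrow>xs. (norm x)\<^sup>2) = (\<Prod>x\<leftarrow>xs. norm x)\<^sup>2"
    by (induction xs) (auto simp: power_mult_distrib)
  then show "(cmod (Rep_fock u xs))\<^sup>2 \<le> (norm u * (\<Prod>x\<leftarrow>xs. norm x))\<^sup>2"
    using fock_vectors_bound[OF Rep_fock[of u], of xs] nn
    by (simp add: norm_fock_def power_mult_distrib inner_fock_self[symmetric] mult.commute)
  have "(\<Prod>x\<leftarrow>xs. norm x) \<ge> 0" by (induction xs) auto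
  then show "0 \<le> norm u * (\<Prod>x\<leftarrow>xs. norm x)" using nn by (simp add: norm_fock_def)
qed

instance
proof
  fix u v w :: "'a fock" and a b :: complex and r s :: real
  show "u + v + w = u + (v + w)" by transfer (simp add: add.assoc)
  show "u + v = v + u" by transfer (simp add: add.commute)
  show "0 + u = u" by transfer simp
  show "- u + u = 0" by transfer simp
  show "u - v = u + - v" by transfer simp
  show c1: "a *\<^sub>C (u + v) = a *\<^sub>C u + a *\<^sub>C v" for a and u v :: "'a fock"
    by transfer (simp add: algebra_simps)
  show c2: "(a + b) *\<^sub>C u = a *\<^sub>C u + b *\<^sub>C u" for a b and u :: "'a fock"
    by transfer (simp add: algebra_simps)
  show c3: "a *\<^sub>C (b *\<^sub>C u) = (a * b) *\<^sub>C u" for a b and u :: "'a fock"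
    by transfer (simp add: algebra_simps)
  show c4: "1 *\<^sub>C u = u" for u :: "'a fock" by transfer simp
  show "r *\<^sub>R u = complex_of_real r *\<^sub>C u" by (rule scaleR_fock_def)
  show "r *\<^sub>R (u + v) = r *\<^sub>R u + r *\<^sub>R v" by (simp add: scaleR_fock_def c1)
  show "(r + s) *\<^sub>R u = r *\<^sub>R u + s *\<^sub>R u" by (simp add: scaleR_fock_def c2)
  show "r *\<^sub>R (s *\<^sub>R u) = (r * s) *\<^sub>R u" by (simp add: scaleR_fock_def c3)
  show "1 *\<^sub>R u = u" by (simp add: scaleR_fock_def c4)
  show com: "cinner u v = cnj (cinner v u)" for u v :: "'a fock"
    unfolding cinner_fock_def infsum_cnj[symmetric] by (simp add: mult.commute)
  show add: "cinner (u + v) w = cinner u w + cinner v w"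
    unfolding cinner_fock_def
    by (simp add: plus_fock.rep_eq distrib_right infsum_add fock_summable)
  show scale: "cinner (a *\<^sub>C u) v = a * cinner u v" for a
    unfolding cinner_fock_def
    by (simp add: scaleC_fock.rep_eq mult.assoc infsum_cmult_right')
  show "inner u v = Re (cinner u v)" by (rule inner_fock_def)
  show "inner u v = inner v u" unfolding inner_fock_def by (subst com) simp
  show "inner (u + v) w = inner u w + inner v w" by (simp add: inner_fock_def add)
  show "inner (r *\<^sub>R u) v = r * inner u v" by (simp add: inner_fock_def scaleR_fock_def scale)
  show nn: "0 \<le> inner u u" unfolding inner_fock_self by (rule infsum_nonneg) auto
  show "inner u u = 0 \<longleftrightarrow> u = 0"
  proof
    assume "inner u u = 0"
    then have "Rep_fock u xs = 0" for xs
      using cmod_Rep_fock_le[of u xs] by (simp add: norm_fock_def)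
    then show "u = 0" by transfer auto
  qed (simp add: inner_fock_def cinner_fock_def zero_fock.rep_eq)
  show "norm u = sqrt (inner u u)" by (rule norm_fock_def)
  show "sgn u = inverse (norm u) *\<^sub>R u" by (rule sgn_fock_def)
  show "dist u v = norm (u - v)" by (rule dist_fock_def)
  show "uniformity = (INF e\<in>{0 <..}. principal {(x, y :: 'a fock). dist x y < e})"
    by (rule uniformity_fock_def)
  show "open U \<longleftrightarrow> (\<forall>x\<in>U. \<forall>\<^sub>F (x', y) in uniformity. x' = x \<longrightarrow> y \<in> U)" for U :: "'a fock set"
    by (rule open_fock_def)
qed

end

lemma norm_fock_le_iff:
  fixes u :: "'h::chilbert_space fock"
  assumes "r \<ge> 0"
  shows "norm u \<le> r \<longleftrightarrow> (\<forall>L. finite L \<longrightarrow> L \<subseteq> lists onb \<longrightarrow> (\<Sum>xs\<in>L. (cmod (Rep_fock u xs))\<^sup>2) \<le> r\<^sup>2)"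
proof -
  have eq: "(norm u)\<^sup>2 = (\<Sum>\<^sub>\<infinity>xs\<in>lists onb. (cmod (Rep_fock u xs))\<^sup>2)"
    by (simp add: power2_norm_eq_inner inner_fock_self)
  have sm: "(\<lambda>xs. (cmod (Rep_fock u xs))\<^sup>2) summable_on lists onb"
    by (rule fock_vectorsD(5)[OF Rep_fock])
  have "norm u \<le> r \<longleftrightarrow> (norm u)\<^sup>2 \<le> r\<^sup>2" using assms by (simp add: power_mono_iff)
  also have "\<dots> \<longleftrightarrow> (\<forall>L. finite L \<longrightarrow> L \<subseteq> lists onb \<longrightarrow> (\<Sum>xs\<in>L. (cmod (Rep_fock u xs))\<^sup>2) \<le> r\<^sup>2)"
    unfolding eq
  proof safe
    fix L :: "'h list set"
    assume "(\<Sum>\<^sub>\<infinity>xs\<in>lists onb. (cmod (Rep_fock u xs))\<^sup>2) \<le> r\<^sup>2" "finite L" "L \<subseteq> lists onb"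
    then show "(\<Sum>xs\<in>L. (cmod (Rep_fock u xs))\<^sup>2) \<le> r\<^sup>2"
      by (intro order_trans[OF finite_sum_le_infsum[OF sm]]) auto
  qed (auto intro!: infsum_le_finite_sums[OF sm])
  finally show ?thesis .
qed

instance fock :: (chilbert_space) chilbert_space
proof
  fix X :: "nat \<Rightarrow> 'a fock"
  assume X: "Cauchy X"
  have pt: "cmod (Rep_fock (X k) xs - Rep_fock (X l) xs) \<le> norm (X k - X l) * (\<Prod>x\<leftarrow>xs. norm x)" for k l xs
    using cmod_Rep_fock_le[of "X k - X l" xs] by (simp add: minus_fock.rep_eq)
  have nn: "0 \<le> (\<Prod>x\<leftarrow>xs. norm x)" for xs :: "'a list" by (induction xs) auto
  have "Cauchy (\<lambda>k. Rep_fock (X k) xs)" for xs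
  proof (rule metric_CauchyI)
    fix e :: real assume e: "e > 0"
    define p where "p = (\<Prod>x\<leftarrow>xs. norm x) + 1"
    have p: "p > 0" using nn[of xs] by (simp add: p_def)
    obtain M where M: "\<And>k l. k \<ge> M \<Longrightarrow> l \<ge> M \<Longrightarrow> dist (X k) (X l) < e / p"
      using metric_CauchyD[OF X, of "e / p"] e p by auto
    have "dist (Rep_fock (X k) xs) (Rep_fock (X l) xs) < e" if "k \<ge> M" "l \<ge> M" for k l
    proof -
      have "cmod (Rep_fock (X k) xs - Rep_fock (X l) xs) \<le> norm (X k - X l) * p"
        using pt[of k xs l] by (rule order_trans) (simp add: p_def mult_left_mono)
      also have "\<dots> < e" using M[OF that] p by (simp add: dist_norm field_simps)
      finally show ?thesis by (simp add: dist_norm)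
    qed
    then show "\<exists>M. \<forall>m\<ge>M. \<forall>n\<ge>M. dist (Rep_fock (X m) xs) (Rep_fock (X n) xs) < e" by blast
  qed
  then have "\<exists>l. (\<lambda>k. Rep_fock (X k) xs) \<longlonglongrightarrow> l" for xs
    by (simp add: Cauchy_convergent_iff convergent_def)
  then obtain g where g: "\<And>xs. (\<lambda>k. Rep_fock (X k) xs) \<longlonglongrightarrow> g xs"
    by metis
  obtain M where M: "M > 0" "\<And>k. norm (X k) \<le> M"
    using Cauchy_Bseq[OF X] by (auto simp: Bseq_def)
  have g_fin: "(\<Sum>xs\<in>L. (cmod (g xs))\<^sup>2) \<le> M\<^sup>2" if L: "finite L" "L \<subseteq> lists onb" for L
  proof (rule LIMSEQ_le_const2)
    show "(\<lambda>k. \<Sum>xs\<in>L. (cmod (Rep_fock (X k) xs))\<^sup>2) \<longlonglongrightarrow> (\<Sum>xs\<in>L. (cmod (g xs))\<^sup>2)"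
      by (intro tendsto_sum tendsto_power tendsto_norm g)
    have "(\<Sum>xs\<in>L. (cmod (Rep_fock (X k) xs))\<^sup>2) \<le> M\<^sup>2" for k
      using norm_fock_le_iff[of M "X k"] M L by simp
    then show "\<exists>N. \<forall>n\<ge>N. (\<Sum>xs\<in>L. (cmod (Rep_fock (X n) xs))\<^sup>2) \<le> M\<^sup>2" by blast
  qed
  have g_fock: "g \<in> fock_vectors"
  proof (rule fock_vectorsI)
    fix xs x y ys
    have "(\<lambda>k. Rep_fock (X k) (xs @ (x + y) # ys)) \<longlonglongrightarrow> g (xs @ x # ys) + g (xs @ y # ys)"
      unfolding fock_vectorsD(1)[OF Rep_fock] by (intro tendsto_add g)
    then show "g (xs @ (x + y) # ys) = g (xs @ x # ys) + g (xs @ y # ys)"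
      using LIMSEQ_unique g by blast
  next
    fix xs c x ys
    have "(\<lambda>k. Rep_fock (X k) (xs @ (c *\<^sub>C x) # ys)) \<longlonglongrightarrow> cnj c * g (xs @ x # ys)"
      unfolding fock_vectorsD(2)[OF Rep_fock] by (intro tendsto_mult tendsto_const g)
    then show "g (xs @ (c *\<^sub>C x) # ys) = cnj c * g (xs @ x # ys)"
      using LIMSEQ_unique g by blast
  next
    fix n
    have "cmod (g xs) \<le> M * (\<Prod>x\<leftarrow>xs. norm x)" for xs
    proof (rule LIMSEQ_le_const2)
      show "(\<lambda>k. cmod (Rep_fock (X k) xs)) \<longlonglongrightarrow> cmod (g xs)" by (intro tendsto_norm g)
      have "cmod (Rep_fock (X k) xs) \<le> M * (\<Prod>x\<leftarrow>xs. norm x)" for k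
        by (rule order_trans[OF cmod_Rep_fock_le]) (intro mult_right_mono M nn)
      then show "\<exists>N. \<forall>n\<ge>N. cmod (Rep_fock (X n) xs) \<le> M * (\<Prod>x\<leftarrow>xs. norm x)" by blast
    qed
    then show "\<exists>C. \<forall>xs. length xs = n \<longrightarrow> cmod (g xs) \<le> C * (\<Prod>x\<leftarrow>xs. norm x)" by blast
  next
    fix xs ys :: "'a list" assume "mset xs = mset ys"
    then have "(\<lambda>k. Rep_fock (X k) xs) = (\<lambda>k. Rep_fock (X k) ys)"
      using fock_vectorsD(4)[OF Rep_fock] by blast
    then show "g xs = g ys" using g[of xs] g[of ys] LIMSEQ_unique by metis
  next
    show "(\<lambda>xs. (cmod (g xs))\<^sup>2) summable_on lists onb"
    proof (rule nonneg_bdd_above_summable_on)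
      show "bdd_above (sum (\<lambda>xs. (cmod (g xs))\<^sup>2) ` {F. F \<subseteq> lists onb \<and> finite F})"
        by (rule bdd_aboveI[of _ "M\<^sup>2"]) (use g_fin in blast)
    qed simp
  qed
  define G where "G = Abs_fock g"
  have G: "Rep_fock G = g" using g_fock by (simp add: G_def Abs_fock_inverse)
  have "X \<longlonglongrightarrow> G"
  proof (rule metric_LIMSEQ_I)
    fix e :: real assume e: "e > 0"
    obtain N where N: "\<And>k l. k \<ge> N \<Longrightarrow> l \<ge> N \<Longrightarrow> dist (X k) (X l) < e / 2"
      using metric_CauchyD[OF X, of "e / 2"] e by auto
    have "dist (X k) G < e" if k: "k \<ge> N" for k
    proof -
      have "norm (X k - G) \<le> e / 2"
      proof (subst norm_fock_le_iff, use e in simp, intro allI impI)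
        fix L :: "'a list set" assume L: "finite L" "L \<subseteq> lists onb"
        show "(\<Sum>xs\<in>L. (cmod (Rep_fock (X k - G) xs))\<^sup>2) \<le> (e / 2)\<^sup>2"
        proof (rule LIMSEQ_le_const2)
          show "(\<lambda>l. \<Sum>xs\<in>L. (cmod (Rep_fock (X k) xs - Rep_fock (X l) xs))\<^sup>2)
              \<longlonglongrightarrow> (\<Sum>xs\<in>L. (cmod (Rep_fock (X k - G) xs))\<^sup>2)"
            unfolding minus_fock.rep_eq G
            by (intro tendsto_sum tendsto_power tendsto_norm tendsto_diff tendsto_const g)
          have "(\<Sum>xs\<in>L. (cmod (Rep_fock (X k) xs - Rep_fock (X l) xs))\<^sup>2) \<le> (e / 2)\<^sup>2"
            if l: "l \<ge> N" for l
          proof -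
            have "norm (X k - X l) \<le> e / 2" using N[OF k l] by (simp add: dist_norm)
            then show ?thesis
              using norm_fock_le_iff[of "e / 2" "X k - X l"] e L by (simp add: minus_fock.rep_eq)
          qed
          then show "\<exists>N. \<forall>l\<ge>N. (\<Sum>xs\<in>L. (cmod (Rep_fock (X k) xs - Rep_fock (X l) xs))\<^sup>2) \<le> (e / 2)\<^sup>2"
            by blast
        qed
      qed
      then show ?thesis using e by (simp add: dist_norm)
    qed
    then show "\<exists>N. \<forall>n\<ge>N. dist (X n) G < e" by blast
  qed
  then show "convergent X" by (rule convergentI)
qed

lemma exp_vec_fock_vectors:
  fixes \<eta> :: "'h::chilbert_space"
  shows "(\<lambda>xs. (\<Prod>\<zeta>\<leftarrow>xs. cinner \<eta> \<zeta>) / complex_of_real (sqrt (fact (length xs)))) \<in> fock_vectors"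
    (is "?e \<in> _")
proof (rule fock_vectorsI)
  fix n
  have "cmod (\<Prod>\<zeta>\<leftarrow>xs. cinner \<eta> \<zeta>) \<le> norm \<eta> ^ length xs * (\<Prod>x\<leftarrow>xs. norm x)" for xs
  proof (induction xs)
    case (Cons x xs)
    have "cmod (\<Prod>\<zeta>\<leftarrow>x # xs. cinner \<eta> \<zeta>) \<le> (norm \<eta> * norm x) * (norm \<eta> ^ length xs * (\<Prod>x\<leftarrow>xs. norm x))"
      using Cons by (simp add: norm_mult del: mult.assoc) (intro mult_mono cmod_cinner_le, auto)
    then show ?case by (simp add: mult_ac)
  qed simp
  then have "cmod (?e xs) \<le> (norm \<eta> ^ n / sqrt (fact n)) * (\<Prod>x\<leftarrow>xs. norm x)" if "length xs = n" for xs
    using that by (auto simp: norm_divide divide_right_mono)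
  then show "\<exists>C. \<forall>xs. length xs = n \<longrightarrow> cmod (?e xs) \<le> C * (\<Prod>x\<leftarrow>xs. norm x)" by blast
next
  fix xs ys :: "'h list" assume m: "mset xs = mset ys"
  have "(\<Prod>\<zeta>\<leftarrow>xs. cinner \<eta> \<zeta>) = (\<Prod>\<zeta>\<leftarrow>ys. cinner \<eta> \<zeta>)"
    by (metis m mset_map prod_mset_prod_list)
  then show "?e xs = ?e ys" using mset_eq_length[OF m] by simp
next
  have sq: "(cmod (?e xs))\<^sup>2 = (\<Prod>x\<leftarrow>xs. (cmod (cinner \<eta> x))\<^sup>2) / fact (length xs)" for xs
  proof -
    have "(cmod (\<Prod>\<zeta>\<leftarrow>xs. cinner \<eta> \<zeta>))\<^sup>2 = (\<Prod>x\<leftarrow>xs. (cmod (cinner \<eta> x))\<^sup>2)"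
      by (induction xs) (auto simp: norm_mult power_mult_distrib)
    then show ?thesis by (simp add: norm_divide power_divide)
  qed
  have lists_sum: "(\<Sum>xs\<in>{xs. set xs \<subseteq> F \<and> length xs = n}. \<Prod>x\<leftarrow>xs. g x) = (\<Sum>x\<in>F. g x) ^ n"
    if "finite F" for F :: "'h set" and g :: "'h \<Rightarrow> real" and n
  proof (induction n)
    case 0
    have "{xs. set xs \<subseteq> F \<and> length xs = 0} = {[]}" by auto
    then show ?case by simp
  next
    case (Suc n)
    have "{xs. set xs \<subseteq> F \<and> length xs = Suc n} = (\<lambda>(x, xs). x # xs) ` (F \<times> {xs. set xs \<subseteq> F \<and> length xs = n})"
      by (auto simp: length_Suc_conv image_iff)
    then have "(\<Sum>xs\<in>{xs. set xs \<subseteq> F \<and> length xs = Suc n}. \<Prod>x\<leftarrow>xs. g x)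
        = (\<Sum>(x, xs)\<in>F \<times> {xs. set xs \<subseteq> F \<and> length xs = n}. g x * (\<Prod>x\<leftarrow>xs. g x))"
      by (simp only:) (subst sum.reindex, auto simp: inj_on_def case_prod_unfold)
    also have "\<dots> = (\<Sum>x\<in>F. g x) * (\<Sum>xs\<in>{xs. set xs \<subseteq> F \<and> length xs = n}. \<Prod>x\<leftarrow>xs. g x)"
      by (simp add: sum.cartesian_product[symmetric] sum_product)
    finally show ?case by (simp add: Suc)
  qed
  have bound: "(\<Sum>xs\<in>L. (cmod (?e xs))\<^sup>2) \<le> exp ((norm \<eta>)\<^sup>2)" if L: "finite L" "L \<subseteq> lists onb" for L
  proof -
    define F where "F = (\<Union>xs\<in>L. set xs)"
    have F: "finite F" "F \<subseteq> onb" using L by (auto simp: F_def)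
    obtain N where N: "\<And>xs. xs \<in> L \<Longrightarrow> length xs \<le> N"
      using L(1) finite_nat_set_iff_bounded_le[of "length ` L"] by auto
    let ?A = "\<lambda>n. {xs. set xs \<subseteq> F \<and> length xs = n}"
    have finA: "finite (?A n)" for n by (rule finite_lists_length_eq[OF F(1)])
    have t: "(\<Sum>b\<in>F. (cmod (cinner \<eta> b))\<^sup>2) \<le> (norm \<eta>)\<^sup>2"
      by (rule bessel[OF F(1)]) (use is_onb_onb F(2) in \<open>unfold is_onb_def; blast\<close>)+
    have "(\<Sum>xs\<in>L. (cmod (?e xs))\<^sup>2) \<le> (\<Sum>xs\<in>(\<Union>n\<in>{..N}. ?A n). (cmod (?e xs))\<^sup>2)"
      by (rule sum_mono2) (use finA N in \<open>auto simp: F_def\<close>)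
    also have "\<dots> = (\<Sum>n\<le>N. \<Sum>xs\<in>?A n. (cmod (?e xs))\<^sup>2)"
      by (rule sum.UNION_disjoint) (use finA in auto)
    also have "\<dots> = (\<Sum>n\<le>N. \<Sum>xs\<in>?A n. (\<Prod>x\<leftarrow>xs. (cmod (cinner \<eta> x))\<^sup>2) / fact n)"
      by (intro sum.cong) (auto simp: sq)
    also have "\<dots> = (\<Sum>n\<le>N. (\<Sum>b\<in>F. (cmod (cinner \<eta> b))\<^sup>2) ^ n / fact n)"
      by (simp add: sum_divide_distrib[symmetric] lists_sum[OF F(1)])
    also have "\<dots> \<le> (\<Sum>n\<le>N. ((norm \<eta>)\<^sup>2) ^ n / fact n)"
      by (intro sum_mono divide_right_mono power_mono t) (auto intro: sum_nonneg)
    also have "\<dots> \<le> exp ((norm \<eta>)\<^sup>2)"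
    proof -
      have "(\<lambda>n. ((norm \<eta>)\<^sup>2) ^ n / fact n) sums exp ((norm \<eta>)\<^sup>2)"
        using exp_converges[of "(norm \<eta>)\<^sup>2"] by (simp add: divide_inverse mult.commute)
      then show ?thesis
        using sum_le_suminf[of "\<lambda>n. ((norm \<eta>)\<^sup>2) ^ n / fact n" "{..N}"]
        by (simp add: sums_iff)
    qed
    finally show ?thesis .
  qed
  show "(\<lambda>xs. (cmod (?e xs))\<^sup>2) summable_on lists onb"
  proof (rule nonneg_bdd_above_summable_on)
    show "bdd_above (sum (\<lambda>xs. (cmod (?e xs))\<^sup>2) ` {F. F \<subseteq> lists onb \<and> finite F})"
      by (rule bdd_aboveI[of _ "exp ((norm \<eta>)\<^sup>2)"]) (use bound in blast)
  qed simp
qed (simp_all add: cinner_add_right cinner_scaleC_right distrib_left distrib_right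
      add_divide_distrib mult_ac)

text \<open>The exponential vector \<open>e(\<eta>) = \<Oplus>\<^sub>n \<eta>\<^sup>\<otimes>\<^sup>n / \<surd>n!\<close>.\<close>

lift_definition exp_vec :: "'h::chilbert_space \<Rightarrow> 'h fock" is
  "\<lambda>\<eta> xs. (\<Prod>\<zeta>\<leftarrow>xs. cinner \<eta> \<zeta>) / complex_of_real (sqrt (fact (length xs)))"
  by (rule exp_vec_fock_vectors)

section \<open>Operators on a complex Hilbert space\<close>

text \<open>\<open>B(K)\<close> consists of the complex-linear elements of the type of bounded real-linear maps.\<close>

definition bounded_ops :: "('k::complex_inner \<Rightarrow>\<^sub>L 'k) set" where
  "bounded_ops = {A. \<forall>c x. blinfun_apply A (c *\<^sub>C x) = c *\<^sub>C blinfun_apply A x}"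

lemma bounded_linear_scaleC: "bounded_linear (\<lambda>x::'a::complex_inner. c *\<^sub>C x)"
proof (rule bounded_linear_intro[where K = "cmod c"])
  show "c *\<^sub>C (r *\<^sub>R x) = r *\<^sub>R (c *\<^sub>C x)" for r and x :: 'a
    by (simp add: scaleR_scaleC scaleC_scaleC mult.commute)
qed (simp_all add: scaleC_add_right mult.commute)

instantiation blinfun :: (real_normed_vector, complex_inner) complex_vector
begin

lift_definition scaleC_blinfun :: "complex \<Rightarrow> 'a \<Rightarrow>\<^sub>L 'b \<Rightarrow> 'a \<Rightarrow>\<^sub>L 'b" is "\<lambda>c A x. c *\<^sub>C A x"
  by (rule bounded_linear_compose[OF bounded_linear_scaleC])

instance
  by standard (transfer; simp add: fun_eq_iff scaleC_add_right scaleC_add_left scaleC_scaleC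
      scaleC_one scaleR_scaleC)+

end

definition cadjoint :: "('k::chilbert_space \<Rightarrow>\<^sub>L 'k) \<Rightarrow> ('k \<Rightarrow>\<^sub>L 'k)" where
  "cadjoint A = (THE B. B \<in> bounded_ops \<and> (\<forall>\<xi> \<eta>. cinner (A \<xi>) \<eta> = cinner \<xi> (B \<eta>)))"

text \<open>The \<open>\<sigma>\<close>-weak topology on \<open>B(K)\<close> is the initial topology for the functionals
  \<open>A \<mapsto> \<Sum>\<^sub>n \<langle>A \<xi>\<^sub>n|\<eta>\<^sub>n\<rangle>\<close> with square-summable sequences of vectors. Normal maps are those
  that are continuous for it.\<close>

definition sigma_weak_topology :: "('k::chilbert_space \<Rightarrow>\<^sub>L 'k) topology" where
  "sigma_weak_topology = topology_generated_by
     {{A \<in> bounded_ops. (\<Sum>n. cinner (blinfun_apply A (\<xi> n)) (\<eta> n)) \<in> U} | \<xi> \<eta> U.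
       summable (\<lambda>n. (norm (\<xi> n))\<^sup>2) \<and> summable (\<lambda>n. (norm (\<eta> n))\<^sup>2) \<and> open U}"

definition unital_normal_star_endomorphism ::
    "(('k::chilbert_space \<Rightarrow>\<^sub>L 'k) \<Rightarrow> ('k \<Rightarrow>\<^sub>L 'k)) \<Rightarrow> bool" where
  "unital_normal_star_endomorphism \<theta> \<longleftrightarrow>
     (\<forall>A\<in>bounded_ops. \<theta> A \<in> bounded_ops) \<and>
     (\<forall>A\<in>bounded_ops. \<forall>B\<in>bounded_ops. \<theta> (A + B) = \<theta> A + \<theta> B) \<and>
     (\<forall>c. \<forall>A\<in>bounded_ops. \<theta> (c *\<^sub>C A) = c *\<^sub>C \<theta> A) \<and>
     (\<forall>A\<in>bounded_ops. \<forall>B\<in>bounded_ops. \<theta> (A o\<^sub>L B) = \<theta> A o\<^sub>L \<theta> B) \<and>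
     (\<forall>A\<in>bounded_ops. \<theta> (cadjoint A) = cadjoint (\<theta> A)) \<and>
     \<theta> id_blinfun = id_blinfun \<and>
     continuous_map sigma_weak_topology sigma_weak_topology \<theta>"

section \<open>Isometric representations and \<open>E\<^sub>0\<close>-semigroups over a cone\<close>

definition closed_pointed_spanning_cone :: "'a::euclidean_space set \<Rightarrow> bool" where
  "closed_pointed_spanning_cone P \<longleftrightarrow>
     closed P \<and> convex_cone P \<and> {x - y | x y. x \<in> P \<and> y \<in> P} = UNIV \<and> P \<inter> uminus ` P = {0}"

definition isometric_representation ::
    "'a::euclidean_space set \<Rightarrow> ('a \<Rightarrow> 'h::chilbert_space \<Rightarrow>\<^sub>L 'h) \<Rightarrow> bool" where
  "isometric_representation P V \<longleftrightarrow>
     (\<forall>x\<in>P. V x \<in> bounded_ops) \<and>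
     (\<forall>x\<in>P. \<forall>\<xi>. norm (V x \<xi>) = norm \<xi>) \<and>
     (\<forall>x\<in>P. \<forall>y\<in>P. V x o\<^sub>L V y = V (x + y)) \<and>
     (\<forall>\<xi>. continuous_on P (\<lambda>x. V x \<xi>))"

definition E0_semigroup ::
    "'a::euclidean_space set \<Rightarrow> ('a \<Rightarrow> ('k::chilbert_space \<Rightarrow>\<^sub>L 'k) \<Rightarrow> ('k \<Rightarrow>\<^sub>L 'k)) \<Rightarrow> bool" where
  "E0_semigroup P \<alpha> \<longleftrightarrow>
     (\<forall>x\<in>P. unital_normal_star_endomorphism (\<alpha> x)) \<and>
     (\<forall>x\<in>P. \<forall>y\<in>P. \<forall>A\<in>bounded_ops. \<alpha> x (\<alpha> y A) = \<alpha> (x + y) A) \<and>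
     (\<forall>A\<in>bounded_ops. \<forall>\<xi> \<eta>. continuous_on P (\<lambda>x. cinner (blinfun_apply (\<alpha> x A) \<xi>) \<eta>))"

text \<open>A bounded operator on the Fock space is determined by its values on the exponential
  vectors, as these are total.\<close>

definition weyl :: "'h::chilbert_space \<Rightarrow> 'h fock \<Rightarrow>\<^sub>L 'h fock" where
  "weyl \<xi> = (THE W. W \<in> bounded_ops \<and>
     (\<forall>\<eta>. blinfun_apply W (exp_vec \<eta>) =
        exp (- complex_of_real ((norm \<xi>)\<^sup>2 / 2) - cinner \<eta> \<xi>) *\<^sub>C exp_vec (\<xi> + \<eta>)))"

text \<open>The CCR flow is unique as a family of maps on \<open>B(\<Gamma>(H))\<close> indexed by \<open>P\<close>; in HOL the values
  outside \<open>P\<close> and outside \<open>B(\<Gamma>(H))\<close> stay arbitrary, whence a predicate.\<close>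

definition is_CCR_flow ::
    "'a::euclidean_space set \<Rightarrow> ('a \<Rightarrow> 'h::chilbert_space \<Rightarrow>\<^sub>L 'h) \<Rightarrow>
     ('a \<Rightarrow> ('h fock \<Rightarrow>\<^sub>L 'h fock) \<Rightarrow> ('h fock \<Rightarrow>\<^sub>L 'h fock)) \<Rightarrow> bool" where
  "is_CCR_flow P V \<alpha> \<longleftrightarrow>
     E0_semigroup P \<alpha> \<and> (\<forall>x\<in>P. \<forall>\<xi>. \<alpha> x (weyl \<xi>) = weyl (V x \<xi>))"

section \<open>Product systems and decomposability\<close>

definition product_system ::
    "('a \<Rightarrow> ('k::chilbert_space \<Rightarrow>\<^sub>L 'k) \<Rightarrow> ('k \<Rightarrow>\<^sub>L 'k)) \<Rightarrow> 'a \<Rightarrow> ('k \<Rightarrow>\<^sub>L 'k) set" where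
  "product_system \<alpha> x = {T \<in> bounded_ops. \<forall>A\<in>bounded_ops. \<alpha> x A o\<^sub>L T = T o\<^sub>L A}"

definition ps_inner :: "('k::chilbert_space \<Rightarrow>\<^sub>L 'k) \<Rightarrow> ('k \<Rightarrow>\<^sub>L 'k) \<Rightarrow> complex" where
  "ps_inner S T = (THE c. c *\<^sub>C id_blinfun = cadjoint T o\<^sub>L S)"

definition ps_norm :: "('k::chilbert_space \<Rightarrow>\<^sub>L 'k) \<Rightarrow> real" where
  "ps_norm T = sqrt (Re (ps_inner T T))"

definition decomposable_vectors ::
    "'a::euclidean_space set \<Rightarrow> ('a \<Rightarrow> ('k::chilbert_space \<Rightarrow>\<^sub>L 'k) \<Rightarrow> ('k \<Rightarrow>\<^sub>L 'k)) \<Rightarrow> 'a \<Rightarrow>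
     ('k \<Rightarrow>\<^sub>L 'k) set" where
  "decomposable_vectors P \<alpha> x = {u \<in> product_system \<alpha> x. u \<noteq> 0 \<and>
     (\<forall>y\<in>P. x - y \<in> P \<longrightarrow>
        (\<exists>v\<in>product_system \<alpha> y. \<exists>w\<in>product_system \<alpha> (x - y). u = v o\<^sub>L w))}"

definition ps_total :: "('k::chilbert_space \<Rightarrow>\<^sub>L 'k) set \<Rightarrow> ('k \<Rightarrow>\<^sub>L 'k) set \<Rightarrow> bool" where
  "ps_total D E \<longleftrightarrow> D \<subseteq> E \<and> (\<forall>T\<in>E. \<forall>\<epsilon>>0. \<exists>S\<in>cspan D. ps_norm (T - S) < \<epsilon>)"

definition decomposable ::
    "'a::euclidean_space set \<Rightarrow> ('a \<Rightarrow> ('k::chilbert_space \<Rightarrow>\<^sub>L 'k) \<Rightarrow> ('k \<Rightarrow>\<^sub>L 'k)) \<Rightarrow> bool" where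
  "decomposable P \<alpha> \<longleftrightarrow>
     (\<forall>x\<in>P. \<forall>y\<in>P. \<forall>u\<in>decomposable_vectors P \<alpha> x. \<forall>v\<in>decomposable_vectors P \<alpha> y.
        u o\<^sub>L v \<in> decomposable_vectors P \<alpha> (x + y)) \<and>
     (\<forall>x\<in>P. ps_total (decomposable_vectors P \<alpha> x) (product_system \<alpha> x))"

end

theory Submission
  imports Defs
begin

text \<open>
  Write \<open>L\<^sub>x = Ker V\<^sub>x\<^sup>*\<close> and \<open>\<Omega> = e(0)\<close>. The product system of the CCR flow contains, for
  \<open>\<xi> \<in> L\<^sub>x\<close>, the exponential unit \<open>T\<^sub>\<xi> : e(\<eta>) \<mapsto> e(\<xi> + V\<^sub>x \<eta>)\<close>, and \<open>T \<mapsto> T \<Omega>\<close> embeds \<open>E(x)\<close>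
  isometrically in the Fock space. These units multiply as
  \<open>T\<^sub>\<xi> T\<^sub>\<eta> = T\<^bsub>\<xi> + V\<^sub>x \<eta>\<^esub>\<close>, and for \<open>y \<le> x\<close> one has \<open>L\<^sub>x = L\<^sub>y \<oplus> V\<^sub>y L\<^bsub>x - y\<^esub>\<close>; hence every
  nonzero multiple of an exponential unit is decomposable. The ranges of the \<open>T\<^sub>\<xi>\<close> together contain all
  exponential vectors, so an element of \<open>E(x)\<close> orthogonal to all of them vanishes, and they are total
  in \<open>E(x)\<close>. Conversely every decomposable vector is a multiple of some \<open>T\<^sub>\<xi>\<close>, and therefore the
  product of two decomposable vectors is decomposable. The last step needs the classification:
  a point \<open>z \<le> x + y\<close> is in general comparable neither to \<open>x\<close> nor to \<open>y\<close>, so that a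
  factorization of \<open>u v\<close> at \<open>z\<close> cannot be read off from factorizations of \<open>u\<close> and \<open>v\<close>.

  \<^bold>\<open>The exponential units belong to the product system\<close>
  (\<open>exponential_intertwiner_exists\<close>). The flow is prescribed on Weyl operators only, and normality has to
  control it on the other operators. Let \<open>\<theta> = \<alpha>\<^sub>x\<close> and \<open>\<xi> \<in> L\<^sub>x\<close>. For any \<open>T \<in> E(x)\<close>,
  covariance under Weyl operators gives \<open>\<langle>e(\<xi>)|T e(\<eta>)\<rangle> = \<langle>e(\<xi> - V\<^sub>x \<eta>)|T \<Omega>\<rangle>\<close>. Along complex
  lines in \<open>\<eta>\<close> the left side is antiholomorphic and the right side holomorphic, so both are constant;
  this says that \<open>T\<^sup>* e(\<xi>)\<close> is a multiple of \<open>\<Omega>\<close>. It follows that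
  \<open>e(\<xi>) - \<theta>(|\<Omega>\<rangle>\<langle>\<Omega>|) e(\<xi>)\<close> is orthogonal to the ranges of all intertwiners. These span
  a dense subspace, because \<open>\<theta>\<close> is normal and the finite rank projections increase to the identity.
  Hence \<open>e(\<xi>)\<close> lies in the range of \<open>\<theta>(|\<Omega>\<rangle>\<langle>\<Omega>|)\<close>, and
  \<open>a \<mapsto> \<theta>(|a\<rangle>\<langle>\<Omega>|) e(\<xi>)\<close> is the required intertwiner.

  \<^bold>\<open>Decomposable vectors are exponential\<close> (\<open>decomposable_vector_exponential\<close>). For \<open>u \<in> D(x)\<close> put
  \<open>f(\<zeta>) = \<langle>u \<Omega>|e(\<zeta>)\<rangle>\<close>. Factoring \<open>u\<close> at the points \<open>t x\<close> of the segment from \<open>0\<close> to \<open>x\<close>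
  shows that \<open>f\<close> factorizes along the increasing projections onto \<open>L\<^bsub>t x\<^esub>\<close>, which depend continuously
  on \<open>t\<close> by the strong continuity of \<open>V\<close>. If \<open>f(0)\<close> were zero, bisection would produce intervals
  shrinking to a point on which \<open>u\<close> has no vacuum component, and continuity would force
  \<open>f = 0\<close> (\<open>factorizing_nonzero_at_0\<close>). After normalising \<open>f(0) = 1\<close>, one cuts \<open>\<zeta>\<close> into \<open>n\<close> small
  orthogonal pieces \<open>q\<^sub>i\<close>. Then \<open>f(\<zeta>)\<close> is the product of the \<open>f(q\<^sub>i)\<close>, and
  \<open>f(q\<^sub>i) = 1 + a(q\<^sub>i) + \<rho>\<^sub>i\<close> with \<open>a\<close> the pairing of \<open>u \<Omega>\<close> with the one-particle vector.
  Since the contributions to \<open>\<rho>\<^sub>i\<close> of different \<open>i\<close> come from orthogonal vectors, \<open>\<Sum>\<^sub>i |\<rho>\<^sub>i|\<close> tends to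
  zero, and in the limit \<open>f(\<zeta>) = exp a(\<zeta>)\<close> (\<open>factorizing_fock_exponential\<close>). The Riesz representation
  of \<open>a\<close> gives \<open>\<xi>\<close>.
\<close>

section \<open>Orthogonality, adjoints and isometric extension\<close>

lemma cinner_minus_right: "cinner y (- x) = - cinner y (x::'a::complex_inner)"
  using cinner_diff_right[of y 0 x] by simp

lemma cinner_eq_zero_self: "cinner x x = 0 \<longleftrightarrow> x = (0::'a::complex_inner)"
  by (simp add: cinner_self del: of_real_power)

lemma eq_if_cinner_all: "(\<And>z. cinner x z = cinner y z) \<Longrightarrow> x = (y::'a::complex_inner)"
  using cinner_eq_zero_self[of "x - y"] by (simp add: cinner_diff_left)

lemma tendsto_cinner_right:
  assumes "(f \<longlongrightarrow> (x::'a::complex_inner)) F"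
  shows "((\<lambda>i. cinner y (f i)) \<longlongrightarrow> cinner y x) F"
  by (subst (1 2) cinner_commute) (intro tendsto_cnj tendsto_cinner_left assms)

lemma norm_diff_sq:
  "(norm (x - y))\<^sup>2 = (norm x)\<^sup>2 + (norm y)\<^sup>2 - 2 * Re (cinner x (y::'a::complex_inner))"
  by (simp add: power2_norm_eq_inner inner_diff inner_commute inner_eq_Re_cinner[symmetric])

lemma norm_diff_sq_orthogonal:
  assumes "cinner (x - y) y = (0::complex)"
  shows "(norm (x - y))\<^sup>2 = (norm x)\<^sup>2 - (norm (y::'a::complex_inner))\<^sup>2"
proof -
  have "Re (cinner x y) = (norm y)\<^sup>2"
    using assms by (simp add: cinner_diff_left cinner_self del: of_real_power)
  then show ?thesis by (simp add: norm_diff_sq)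
qed

text \<open>A sequence in \<open>M\<close> minimising the distance to \<open>x\<close> is Cauchy by the parallelogram law, since midpoints
  stay in \<open>M\<close>; minimality of the limit \<open>m\<close> under real and imaginary variations gives orthogonality.\<close>

lemma orthogonal_decomposition:
  fixes M :: "'a::chilbert_space set"
  assumes M: "complex_vector.subspace M" and cl: "closed M"
  obtains m where "m \<in> M" "\<And>y. y \<in> M \<Longrightarrow> cinner (x - m) y = 0"
proof -
  have add: "a + b \<in> M" if "a \<in> M" "b \<in> M" for a b using M that by (rule complex_vector.subspace_add)
  have scale: "c *\<^sub>C a \<in> M" if "a \<in> M" for a c using M that by (rule complex_vector.subspace_scale)
  have ne: "M \<noteq> {}" using complex_vector.subspace_0[OF M] by blast
  define d where "d = infdist x M"
  have d0: "d \<ge> 0" unfolding d_def by (rule infdist_nonneg)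
  have d_le: "d \<le> norm (x - y)" if "y \<in> M" for y
    using infdist_le[OF that, of x] by (simp add: d_def dist_norm)
  have "\<exists>y\<in>M. norm (x - y) < d + 1 / Suc n" for n
  proof -
    have "d < d + 1 / Suc n" by simp
    then show ?thesis
      unfolding d_def infdist_notempty[OF ne]
      by (subst (asm) cInf_less_iff) (use ne in \<open>auto simp: dist_norm intro!: bdd_belowI[of _ 0]\<close>)
  qed
  then obtain y where y: "\<And>n. y n \<in> M" "\<And>n. norm (x - y n) < d + 1 / Suc n" by metis
  have ysq: "(norm (x - y n))\<^sup>2 \<le> d\<^sup>2 + (2 * d + 1) / Suc n" for n
  proof -
    have "(norm (x - y n))\<^sup>2 \<le> (d + 1 / Suc n)\<^sup>2"
      using y(2)[of n] by (intro power_mono) auto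
    also have "\<dots> = d\<^sup>2 + 2 * d / Suc n + (1 / Suc n) * (1 / Suc n)"
      by (simp only: power2_eq_square distrib_left distrib_right) simp
    also have "\<dots> \<le> d\<^sup>2 + 2 * d / Suc n + (1 / Suc n) * 1"
      by (intro add_left_mono mult_left_mono) auto
    finally show ?thesis by (simp add: add_divide_distrib)
  qed
  have near: "(norm (y m - y n))\<^sup>2 \<le> 4 * (2 * d + 1) / Suc N" if "m \<ge> N" "n \<ge> N" for m n N
  proof -
    have half: "(1/2) *\<^sub>R (y m + y n) \<in> M"
      unfolding scaleR_scaleC by (intro scale add y)
    have "(norm (y m - y n))\<^sup>2 = 2 * (norm (x - y m))\<^sup>2 + 2 * (norm (x - y n))\<^sup>2
        - 4 * (norm (x - (1/2) *\<^sub>R (y m + y n)))\<^sup>2"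
      by (simp add: power2_norm_eq_inner inner_diff inner_add inner_commute algebra_simps)
    also have "\<dots> \<le> 2 * (d\<^sup>2 + (2 * d + 1) / Suc m) + 2 * (d\<^sup>2 + (2 * d + 1) / Suc n) - 4 * d\<^sup>2"
      by (intro diff_mono add_mono mult_left_mono ysq power_mono[OF d_le[OF half] d0]) simp_all
    also have "\<dots> = 2 * ((2 * d + 1) / Suc m) + 2 * ((2 * d + 1) / Suc n)" by simp
    also have "\<dots> \<le> 2 * ((2 * d + 1) / Suc N) + 2 * ((2 * d + 1) / Suc N)"
      using d0 that by (intro add_mono mult_left_mono divide_left_mono) auto
    finally show ?thesis by simp
  qed
  have "Cauchy y"
  proof (rule CauchyI)
    fix e :: real assume e: "e > 0"
    have "(\<lambda>N. 4 * (2 * d + 1) / Suc N) \<longlonglongrightarrow> 0"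
      by (intro real_tendsto_divide_at_top[OF tendsto_const]
          filterlim_compose[OF filterlim_real_sequentially filterlim_Suc])
    then have "\<forall>\<^sub>F N in sequentially. 4 * (2 * d + 1) / Suc N < e\<^sup>2"
      using e by (intro order_tendstoD(2)) auto
    then obtain N where N: "4 * (2 * d + 1) / Suc N < e\<^sup>2" by (auto simp: eventually_sequentially)
    have "norm (y m - y n) < e" if "m \<ge> N" "n \<ge> N" for m n
      by (rule power2_less_imp_less[OF le_less_trans[OF near[OF that] N]]) (use e in simp)
    then show "\<exists>M. \<forall>m\<ge>M. \<forall>n\<ge>M. norm (y m - y n) < e" by blast
  qed
  then obtain m where m: "y \<longlonglongrightarrow> m" using Cauchy_convergent convergent_def by blast
  have mM: "m \<in> M" using cl y(1) m closed_sequentially by blast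
  have "(\<lambda>n. norm (x - y n)) \<longlonglongrightarrow> norm (x - m)" by (intro tendsto_norm tendsto_diff tendsto_const m)
  moreover have "(\<lambda>n. d + 1 / Suc n) \<longlonglongrightarrow> d + 0"
    by (intro tendsto_add tendsto_const) (rule LIMSEQ_Suc[OF lim_1_over_n])
  ultimately have md: "norm (x - m) \<le> d"
    using y(2) by (intro LIMSEQ_le) (auto intro: less_imp_le)
  have re: "inner (x - m) z = 0" if z: "z \<in> M" for z
  proof (cases "z = 0")
    case False
    define t where "t = inner (x - m) z / (norm z)\<^sup>2"
    have "m + t *\<^sub>R z \<in> M" unfolding scaleR_scaleC by (intro add mM scale z)
    then have "(norm (x - m))\<^sup>2 \<le> (norm (x - (m + t *\<^sub>R z)))\<^sup>2"
      using md d_le by (intro power_mono) (auto intro: order_trans)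
    also have "x - (m + t *\<^sub>R z) = (x - m) - t *\<^sub>R z" by simp
    also have "(norm ((x - m) - t *\<^sub>R z))\<^sup>2 = (norm (x - m))\<^sup>2 + t\<^sup>2 * (norm z)\<^sup>2 - 2 * t * inner (x - m) z"
      unfolding power2_norm_eq_inner by (simp add: inner_diff inner_commute power2_eq_square algebra_simps)
    also have "t\<^sup>2 * (norm z)\<^sup>2 - 2 * t * inner (x - m) z = - (inner (x - m) z)\<^sup>2 / (norm z)\<^sup>2"
      using False by (simp add: t_def power2_eq_square field_simps)
    then have "(norm (x - m))\<^sup>2 + t\<^sup>2 * (norm z)\<^sup>2 - 2 * t * inner (x - m) z =
       (norm (x - m))\<^sup>2 - (inner (x - m) z)\<^sup>2 / (norm z)\<^sup>2" by simp
    finally have "(inner (x - m) z)\<^sup>2 / (norm z)\<^sup>2 \<le> 0" by simp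
    then show ?thesis using False by (simp add: divide_le_0_iff)
  qed simp
  have "cinner (x - m) z = 0" if z: "z \<in> M" for z
  proof -
    have "Re (cinner (x - m) z) = 0" using re[OF z] by (simp add: inner_eq_Re_cinner)
    moreover have "Re (cinner (x - m) (\<i> *\<^sub>C z)) = 0"
      using re[OF scale[OF z]] by (simp add: inner_eq_Re_cinner)
    then have "Im (cinner (x - m) z) = 0" by (simp add: cinner_scaleC_right)
    ultimately show ?thesis by (simp add: complex_eq_iff)
  qed
  then show ?thesis using that mM by blast
qed

lemma subspace_closure:
  assumes M: "complex_vector.subspace (M :: 'a::complex_inner set)"
  shows "complex_vector.subspace (closure M)"
proof (rule complex_vector.subspaceI)
  show "0 \<in> closure M" using complex_vector.subspace_0[OF M] closure_subset by blast
  fix x y assume "x \<in> closure M" "y \<in> closure M"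
  then obtain f g where "\<And>n. f n \<in> M" "f \<longlonglongrightarrow> x" "\<And>n. g n \<in> M" "g \<longlonglongrightarrow> y"
    unfolding closure_sequential by blast
  then show "x + y \<in> closure M" unfolding closure_sequential
    by (intro exI[of _ "\<lambda>n. f n + g n"]) (auto intro: tendsto_add complex_vector.subspace_add[OF M])
next
  fix c x assume "x \<in> closure M"
  then obtain f where "\<And>n. f n \<in> M" "f \<longlonglongrightarrow> x"
    unfolding closure_sequential by blast
  then show "c *\<^sub>C x \<in> closure M" unfolding closure_sequential
    by (intro exI[of _ "\<lambda>n. c *\<^sub>C f n"])
       (auto intro: bounded_linear.tendsto[OF bounded_linear_scaleC] complex_vector.subspace_scale[OF M])
qed

lemma orthogonal_closure_cspan:
  fixes x :: "'a::complex_inner"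
  assumes "\<And>b. b \<in> B \<Longrightarrow> cinner x b = 0" and "y \<in> closure (cspan B)"
  shows "cinner x y = 0"
proof -
  have span: "cinner x z = 0" if "z \<in> cspan B" for z
    using that by (induction rule: complex_vector.span_induct_alt)
      (auto simp: cinner_add_right cinner_scaleC_right assms(1))
  obtain f where f: "\<And>n. f n \<in> cspan B" "f \<longlonglongrightarrow> y"
    using assms(2) unfolding closure_sequential by blast
  have "(\<lambda>n. cinner x (f n)) \<longlonglongrightarrow> cinner x y" by (rule tendsto_cinner_right[OF f(2)])
  then show ?thesis by (simp add: span[OF f(1)] LIMSEQ_const_iff)
qed

lemma total_iff_orthogonal_trivial:
  fixes B :: "'a::chilbert_space set"
  shows "closure (cspan B) = UNIV \<longleftrightarrow> (\<forall>x. (\<forall>b\<in>B. cinner x b = 0) \<longrightarrow> x = 0)"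
proof
  assume "closure (cspan B) = UNIV"
  then show "\<forall>x. (\<forall>b\<in>B. cinner x b = 0) \<longrightarrow> x = 0"
    using orthogonal_closure_cspan[of B] cinner_eq_zero_self by blast
next
  assume *: "\<forall>x. (\<forall>b\<in>B. cinner x b = 0) \<longrightarrow> x = 0"
  have "x \<in> closure (cspan B)" for x
  proof -
    obtain m where m: "m \<in> closure (cspan B)" "\<And>y. y \<in> closure (cspan B) \<Longrightarrow> cinner (x - m) y = 0"
      by (rule orthogonal_decomposition[of "closure (cspan B)" x])
         (auto intro: subspace_closure complex_vector.subspace_span)
    have "x - m = 0"
      using * m(2) closure_subset complex_vector.span_base by blast
    then show ?thesis using m(1) by simp
  qed
  then show "closure (cspan B) = UNIV" by blast
qed

lemma eq_if_cinner_total: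
  fixes x y :: "'a::chilbert_space"
  assumes "closure (cspan B) = UNIV" "\<And>b. b \<in> B \<Longrightarrow> cinner x b = cinner y b"
  shows "x = y"
proof -
  have "x - y = 0"
    using assms(1)[unfolded total_iff_orthogonal_trivial, rule_format, of "x - y"] assms(2)
    by (simp add: cinner_diff_left)
  then show ?thesis by simp
qed

text \<open>The representing vector is a multiple of a vector orthogonal to the kernel of \<open>f\<close>.\<close>

lemma riesz_representation:
  fixes f :: "'a::chilbert_space \<Rightarrow> complex"
  assumes add: "\<And>x y. f (x + y) = f x + f y" and scale: "\<And>c x. f (c *\<^sub>C x) = c * f x"
    and bound: "\<And>x. cmod (f x) \<le> C * norm x"
  obtains z where "\<And>x. f x = cinner x z"
proof -
  define M where "M = {x. f x = 0}"
  have f0: "f 0 = 0" using add[of 0 0] by simp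
  have diff: "f (x - y) = f x - f y" for x y using add[of "x - y" y] by simp
  have sub: "complex_vector.subspace M"
    by (rule complex_vector.subspaceI) (auto simp: M_def f0 add scale)
  have cl: "closed M"
  proof (unfold closed_sequential_limits, intro allI impI, elim conjE)
    fix X l assume X: "\<forall>n. X n \<in> M" "X \<longlonglongrightarrow> l"
    have "(\<lambda>n. C * norm (l - X n)) \<longlonglongrightarrow> C * norm (l - l)"
      by (intro tendsto_intros X)
    then have "(\<lambda>n. C * norm (l - X n)) \<longlonglongrightarrow> 0" by simp
    then have "(\<lambda>n. f (l - X n)) \<longlonglongrightarrow> 0"
      by (rule Lim_null_comparison[rotated]) (simp add: bound)
    moreover have "f (l - X n) = f l" for n using X(1) by (auto simp: M_def diff)
    ultimately show "l \<in> M" by (simp add: M_def LIMSEQ_const_iff)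
  qed
  show ?thesis
  proof (cases "M = UNIV")
    case True
    then show ?thesis using that[of 0] by (auto simp: M_def)
  next
    case False
    then obtain x0 where x0: "f x0 \<noteq> 0" by (auto simp: M_def)
    obtain m where m: "m \<in> M" "\<And>y. y \<in> M \<Longrightarrow> cinner (x0 - m) y = 0"
      using orthogonal_decomposition[OF sub cl, of x0] by blast
    define u where "u = x0 - m"
    have fu: "f u \<noteq> 0" using m(1) x0 by (simp add: u_def diff M_def)
    have uu: "cinner u u \<noteq> 0" using fu f0 by (auto simp: cinner_eq_zero_self)
    have "f x = cinner x ((cnj (f u / cinner u u)) *\<^sub>C u)" for x
    proof -
      have "x - (f x / f u) *\<^sub>C u \<in> M" using fu by (simp add: M_def diff scale)
      then have "cinner u (x - (f x / f u) *\<^sub>C u) = 0" using m(2) unfolding u_def by blast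
      then have "cinner (x - (f x / f u) *\<^sub>C u) u = 0" by (subst cinner_commute) simp
      then have "cinner x u = f x / f u * cinner u u"
        by (simp add: cinner_diff_left cinner_scaleC_left)
      then show ?thesis using fu uu by (simp add: cinner_scaleC_right)
    qed
    then show ?thesis by (rule that)
  qed
qed

lemma bounded_opsD: "A \<in> bounded_ops \<Longrightarrow> blinfun_apply A (c *\<^sub>C x) = c *\<^sub>C blinfun_apply A x"
  by (simp add: bounded_ops_def)

lemma bounded_opsI:
  fixes f :: "'k::complex_inner \<Rightarrow> 'k"
  assumes "\<And>x y. f (x + y) = f x + f y" "\<And>c x. f (c *\<^sub>C x) = c *\<^sub>C f x"
    "\<And>x. norm (f x) \<le> norm x * C"
  shows "\<exists>A\<in>bounded_ops. blinfun_apply A = f"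
proof -
  have "bounded_linear f"
    by (rule bounded_linear_intro[where K = C]) (auto simp: assms scaleR_scaleC)
  then show ?thesis
    by (intro bexI[of _ "Blinfun f"]) (auto simp: bounded_ops_def bounded_linear_Blinfun_apply assms)
qed

lemma bounded_ops_compose: "A \<in> bounded_ops \<Longrightarrow> B \<in> bounded_ops \<Longrightarrow> A o\<^sub>L B \<in> bounded_ops"
  by (simp add: bounded_ops_def)

lemma bounded_ops_id: "id_blinfun \<in> bounded_ops"
  by (simp add: bounded_ops_def)

lemma bounded_ops_add: "A \<in> bounded_ops \<Longrightarrow> B \<in> bounded_ops \<Longrightarrow> A + B \<in> bounded_ops"
  by (simp add: bounded_ops_def blinfun.add_left scaleC_add_right)

lemma bounded_ops_scaleC: "A \<in> bounded_ops \<Longrightarrow> c *\<^sub>C A \<in> bounded_ops"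
  by (simp add: bounded_ops_def scaleC_blinfun.rep_eq scaleC_scaleC mult.commute)

lemma bounded_ops_zero: "0 \<in> bounded_ops"
  by (simp add: bounded_ops_def)

lemma cadjoint_exists:
  fixes A :: "'k::chilbert_space \<Rightarrow>\<^sub>L 'k"
  assumes A: "A \<in> bounded_ops"
  shows "\<exists>!B. B \<in> bounded_ops \<and> (\<forall>\<xi> \<eta>. cinner (A \<xi>) \<eta> = cinner \<xi> (B \<eta>))"
proof (rule ex_ex1I)
  have "\<exists>z. \<forall>\<xi>. cinner (A \<xi>) \<eta> = cinner \<xi> z" for \<eta>
  proof -
    have "cmod (cinner (A \<xi>) \<eta>) \<le> (norm A * norm \<eta>) * norm \<xi>" for \<xi>
      by (rule order_trans[OF cmod_cinner_le])
         (use mult_right_mono[OF norm_blinfun[of A \<xi>], of "norm \<eta>"] in \<open>simp add: mult_ac\<close>)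
    from riesz_representation[OF _ _ this] show ?thesis
      by (metis (no_types, lifting) A blinfun.add_right bounded_opsD cinner_add_left cinner_scaleC_left)
  qed
  then obtain g where g: "\<And>\<xi> \<eta>. cinner (A \<xi>) \<eta> = cinner \<xi> (g \<eta>)" by metis
  have total: "x = y" if "\<And>\<xi>. cinner \<xi> x = cinner \<xi> y" for x y :: 'k
    using that cinner_commute[of x] cinner_commute[of y] by (intro eq_if_cinner_all) simp
  have "\<exists>B\<in>bounded_ops. blinfun_apply B = g"
  proof (rule bounded_opsI)
    show "g (x + y) = g x + g y" for x y
      by (rule total) (simp add: g[symmetric] cinner_add_right)
    show "g (c *\<^sub>C x) = c *\<^sub>C g x" for c x
      by (rule total) (simp add: g[symmetric] cinner_scaleC_right)
    show "norm (g x) \<le> norm x * norm A" for x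
    proof (cases "g x = 0")
      case False
      have "complex_of_real ((norm (g x))\<^sup>2) = cinner (A (g x)) x"
        unfolding g by (simp add: cinner_self)
      then have "(norm (g x))\<^sup>2 \<le> norm (A (g x)) * norm x"
        using cmod_cinner_le[of "A (g x)" x] by (metis abs_norm_cancel norm_of_real norm_power power_abs)
      also have "\<dots> \<le> (norm A * norm (g x)) * norm x"
        by (intro mult_right_mono norm_blinfun) auto
      finally show ?thesis using False by (simp add: power2_eq_square mult_ac)
    qed simp
  qed
  then show "\<exists>B. B \<in> bounded_ops \<and> (\<forall>\<xi> \<eta>. cinner (A \<xi>) \<eta> = cinner \<xi> (B \<eta>))"
    using g by auto
  fix B C assume "B \<in> bounded_ops \<and> (\<forall>\<xi> \<eta>. cinner (A \<xi>) \<eta> = cinner \<xi> (blinfun_apply B \<eta>))"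
    "C \<in> bounded_ops \<and> (\<forall>\<xi> \<eta>. cinner (A \<xi>) \<eta> = cinner \<xi> (blinfun_apply C \<eta>))"
  then have "cinner \<xi> (B \<eta>) = cinner \<xi> (C \<eta>)" for \<xi> \<eta> by metis
  then show "B = C" by (rule blinfun_eqI[OF total])
qed

lemma
  fixes A :: "'k::chilbert_space \<Rightarrow>\<^sub>L 'k"
  assumes A: "A \<in> bounded_ops"
  shows cadjoint_bounded_ops: "cadjoint A \<in> bounded_ops"
    and cinner_cadjoint_right: "cinner \<xi> (cadjoint A \<eta>) = cinner (A \<xi>) \<eta>"
    and cinner_cadjoint_left: "cinner (cadjoint A \<xi>) \<eta> = cinner \<xi> (A \<eta>)"
proof -
  have "cadjoint A \<in> bounded_ops \<and> (\<forall>\<xi> \<eta>. cinner (A \<xi>) \<eta> = cinner \<xi> (cadjoint A \<eta>))"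
    unfolding cadjoint_def by (rule theI'[OF cadjoint_exists[OF A]])
  then have *: "cadjoint A \<in> bounded_ops" "cinner (A \<xi>) \<eta> = cinner \<xi> (cadjoint A \<eta>)" for \<xi> \<eta>
    by auto
  show "cadjoint A \<in> bounded_ops" "cinner \<xi> (cadjoint A \<eta>) = cinner (A \<xi>) \<eta>" by (simp_all add: *)
  show "cinner (cadjoint A \<xi>) \<eta> = cinner \<xi> (A \<eta>)"
    using *(2)[of \<eta> \<xi>] cinner_commute[of "cadjoint A \<xi>" \<eta>] cinner_commute[of \<xi> "A \<eta>"] by simp
qed

lemma cadjoint_eqI:
  fixes A :: "'k::chilbert_space \<Rightarrow>\<^sub>L 'k"
  assumes "A \<in> bounded_ops" "B \<in> bounded_ops" "\<And>\<xi> \<eta>. cinner (A \<xi>) \<eta> = cinner \<xi> (B \<eta>)"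
  shows "cadjoint A = B"
  using the1_equality[OF cadjoint_exists[OF assms(1)], of B] assms unfolding cadjoint_def by simp

text \<open>The pairs \<open>(\<Sum>\<^sub>i c\<^sub>i e\<^sub>i, \<Sum>\<^sub>i c\<^sub>i f\<^sub>i)\<close>. As a relation this avoids choosing coefficients for a vector of the
  span of the \<open>e\<^sub>i\<close>, which need not be linearly independent.\<close>

inductive matched_combination :: "('i \<Rightarrow> 'k::complex_inner) \<Rightarrow> ('i \<Rightarrow> 'k) \<Rightarrow> 'k \<Rightarrow> 'k \<Rightarrow> bool"
  for e f where
  zero: "matched_combination e f 0 0"
| step: "matched_combination e f x y \<Longrightarrow> matched_combination e f (c *\<^sub>C e i + x) (c *\<^sub>C f i + y)"

text \<open>Equal Gram matrices make the relation \<open>matched_combination\<close> preserve inner products. Its closure is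
  therefore the graph of an isometry, defined on the whole space because the \<open>e\<^sub>i\<close> are total.\<close>

lemma isometric_extension:
  fixes e f :: "'i \<Rightarrow> 'k::chilbert_space"
  assumes gram: "\<And>i j. cinner (f i) (f j) = cinner (e i) (e j)"
    and total: "closure (cspan (range e)) = UNIV"
  obtains W where "W \<in> bounded_ops" "\<And>i. blinfun_apply W (e i) = f i"
proof -
  let ?R = "matched_combination e f"
  have R_add: "?R (x + x') (y + y')" if "?R x y" "?R x' y'" for x y x' y'
    using that(1)
    by (induction rule: matched_combination.induct)
       (auto simp: that(2) add.assoc intro: matched_combination.step)
  have R_scale: "?R (c *\<^sub>C x) (c *\<^sub>C y)" if "?R x y" for x y c
    using that
    by (induction rule: matched_combination.induct)
       (auto simp: scaleC_add_right scaleC_scaleC intro: matched_combination.intros)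
  have R_e: "?R (e i) (f i)" for i
    using matched_combination.step[OF matched_combination.zero, where e = e and f = f and c = 1 and i = i]
    by (simp add: scaleC_one)
  have inner1: "cinner y (f j) = cinner x (e j)" if "?R x y" for x y j
    using that
    by (induction rule: matched_combination.induct) (auto simp: cinner_add_left cinner_scaleC_left gram)
  have inner2: "cinner y' y = cinner x' x" if "?R x y" "?R x' y'" for x y x' y'
    using that(1)
    by (induction rule: matched_combination.induct)
       (auto simp: cinner_add_right cinner_scaleC_right inner1[OF that(2)])
  have R_norm: "norm y = norm x" if "?R x y" for x y
    using inner2[OF that that] by (simp add: cinner_self del: of_real_power)
  have R_diff: "?R (x - x') (y - y')" if "?R x y" "?R x' y'" for x y x' y'
    using R_add[OF that(1) R_scale[OF that(2), of "-1"]] by simp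
  have R_ex: "\<exists>y. ?R x y" if "x \<in> cspan (range e)" for x
    using that
  proof (induction rule: complex_vector.span_induct_alt)
    case (step c x y)
    then obtain i y' where "x = e i" "?R y y'" by blast
    then show ?case using matched_combination.step[of e f y y' c i] by blast
  qed (use matched_combination.zero in blast)
  \<comment> \<open>the sequential closure of the relation\<close>
  define G where "G x y \<longleftrightarrow> (\<exists>X Y. (\<forall>n. ?R (X n) (Y n)) \<and> X \<longlonglongrightarrow> x \<and> Y \<longlonglongrightarrow> y)" for x y
  have R_G: "G x y" if "?R x y" for x y
    unfolding G_def by (rule exI[of _ "\<lambda>_. x"], rule exI[of _ "\<lambda>_. y"]) (use that in auto)
  have G_add: "G (x + x') (y + y')" if "G x y" "G x' y'" for x y x' y'
  proof -
    obtain X Y X' Y' where "\<And>n. ?R (X n) (Y n)" "X \<longlonglongrightarrow> x" "Y \<longlonglongrightarrow> y"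
      "\<And>n. ?R (X' n) (Y' n)" "X' \<longlonglongrightarrow> x'" "Y' \<longlonglongrightarrow> y'"
      using \<open>G x y\<close> \<open>G x' y'\<close> unfolding G_def by metis
    then show ?thesis unfolding G_def
      by (intro exI[of _ "\<lambda>n. X n + X' n"] exI[of _ "\<lambda>n. Y n + Y' n"]) (auto intro: R_add tendsto_add)
  qed
  have G_scale: "G (c *\<^sub>C x) (c *\<^sub>C y)" if "G x y" for x y c
  proof -
    obtain X Y where "\<And>n. ?R (X n) (Y n)" "X \<longlonglongrightarrow> x" "Y \<longlonglongrightarrow> y"
      using \<open>G x y\<close> unfolding G_def by metis
    then show ?thesis unfolding G_def
      by (intro exI[of _ "\<lambda>n. c *\<^sub>C X n"] exI[of _ "\<lambda>n. c *\<^sub>C Y n"])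
         (auto intro: R_scale bounded_linear.tendsto[OF bounded_linear_scaleC])
  qed
  have G_norm: "norm y = norm x" if "G x y" for x y
  proof -
    obtain X Y where XY: "\<And>n. ?R (X n) (Y n)" "X \<longlonglongrightarrow> x" "Y \<longlonglongrightarrow> y"
      using \<open>G x y\<close> unfolding G_def by metis
    have "(\<lambda>n. norm (Y n)) \<longlonglongrightarrow> norm x" using tendsto_norm[OF XY(2)] by (simp add: R_norm[OF XY(1)])
    then show ?thesis using tendsto_norm[OF XY(3)] LIMSEQ_unique by blast
  qed
  have G_unique: "y = y'" if "G x y" "G x y'" for x y y'
  proof -
    have "G (x + (- 1) *\<^sub>C x) (y + (- 1) *\<^sub>C y')" using that by (intro G_add G_scale)
    then show ?thesis using G_norm[of "x + (- 1) *\<^sub>C x" "y + (- 1) *\<^sub>C y'"] by simp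
  qed
  have G_ex: "\<exists>y. G x y" for x
  proof -
    have "x \<in> closure (cspan (range e))" using total by simp
    then obtain X where X: "\<And>n. X n \<in> cspan (range e)" "X \<longlonglongrightarrow> x"
      unfolding closure_sequential by blast
    obtain Y where Y: "\<And>n. ?R (X n) (Y n)" using R_ex[OF X(1)] by metis
    have "dist (Y m) (Y n) = dist (X m) (X n)" for m n
      using R_norm[OF R_diff[OF Y Y]] by (simp add: dist_norm)
    then have "Cauchy Y" using LIMSEQ_imp_Cauchy[OF X(2)] unfolding Cauchy_def by simp
    then obtain y where "Y \<longlonglongrightarrow> y" using Cauchy_convergent convergent_def by blast
    then show ?thesis using X Y unfolding G_def by blast
  qed
  then obtain g where g: "\<And>x. G x (g x)" by metis
  have "\<exists>W\<in>bounded_ops. blinfun_apply W = g"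
  proof (rule bounded_opsI)
    show "g (x + y) = g x + g y" for x y by (rule G_unique[OF g G_add[OF g g]])
    show "g (c *\<^sub>C x) = c *\<^sub>C g x" for c x by (rule G_unique[OF g G_scale[OF g]])
    show "norm (g x) \<le> norm x * 1" for x using G_norm[OF g, of x] by simp
  qed
  then show ?thesis using that G_unique[OF g R_G[OF R_e]] by auto
qed

text \<open>Cauchy--Schwarz for \<open>u\<close> against \<open>\<Sum>\<^sub>i \<theta>\<^sub>i x\<^sub>i\<close>, with unimodular \<open>\<theta>\<^sub>i\<close> that align the phases of the
  summands. By orthogonality the norm of this vector does not see the phases.\<close>

lemma sum_cmod_cinner_orthogonal_le:
  fixes x :: "'i \<Rightarrow> 'a::complex_inner"
  assumes fin: "finite I" and orth: "\<And>i j. i \<in> I \<Longrightarrow> j \<in> I \<Longrightarrow> i \<noteq> j \<Longrightarrow> cinner (x i) (x j) = 0"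
  shows "(\<Sum>i\<in>I. cmod (cinner u (x i))) \<le> norm u * sqrt (\<Sum>i\<in>I. (norm (x i))\<^sup>2)"
proof -
  define \<theta> where "\<theta> i = (if cinner u (x i) = 0 then 1 else sgn (cinner u (x i)))" for i
  have \<theta>: "cmod (\<theta> i) = 1" for i by (simp add: \<theta>_def norm_sgn)
  have \<theta>': "cnj (\<theta> i) * cinner u (x i) = complex_of_real (cmod (cinner u (x i)))" for i
    by (auto simp: \<theta>_def sgn_eq field_simps complex_norm_square[symmetric] power2_eq_square)
  let ?s = "\<Sum>i\<in>I. \<theta> i *\<^sub>C x i"
  have "cinner ?s ?s = (\<Sum>i\<in>I. \<Sum>j\<in>I. \<theta> i * (cnj (\<theta> j) * cinner (x i) (x j)))"
    by (simp only: cinner_sum_left) (simp add: cinner_sum_right cinner_scaleC_left cinner_scaleC_right sum_distrib_left mult.left_commute)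
  also have "\<dots> = (\<Sum>i\<in>I. \<Sum>j\<in>I. if i = j then complex_of_real ((norm (x i))\<^sup>2) else 0)"
  proof (intro sum.cong refl)
    fix i j assume "i \<in> I" "j \<in> I"
    have "\<theta> i * cnj (\<theta> i) = 1" using \<theta>[of i] by (simp add: complex_norm_square[symmetric])
    then show "\<theta> i * (cnj (\<theta> j) * cinner (x i) (x j)) = (if i = j then complex_of_real ((norm (x i))\<^sup>2) else 0)"
      using orth[OF \<open>i \<in> I\<close> \<open>j \<in> I\<close>] by (auto simp: cinner_self mult.assoc[symmetric])
  qed
  also have "\<dots> = complex_of_real (\<Sum>i\<in>I. (norm (x i))\<^sup>2)" using fin by simp
  finally have "(norm ?s)\<^sup>2 = (\<Sum>i\<in>I. (norm (x i))\<^sup>2)" unfolding cinner_self of_real_eq_iff .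
  then have ns: "norm ?s = sqrt (\<Sum>i\<in>I. (norm (x i))\<^sup>2)" using real_sqrt_unique[of "norm ?s"] by simp
  have "cinner u ?s = complex_of_real (\<Sum>i\<in>I. cmod (cinner u (x i)))"
    by (simp add: cinner_sum_right cinner_scaleC_right \<theta>')
  then have "(\<Sum>i\<in>I. cmod (cinner u (x i))) = cmod (cinner u ?s)"
    by (simp add: sum_nonneg del: of_real_sum)
  also have "\<dots> \<le> norm u * norm ?s" by (rule cmod_cinner_le)
  finally show ?thesis by (simp add: ns)
qed

section \<open>Exponential vectors\<close>

text \<open>The partial sum over \<open>F\<close> is the best approximation of \<open>x\<close> from the span of \<open>F\<close>, and finite linear
  combinations of the basis are dense.\<close>

lemma onb_expansion:
  fixes x :: "'a::complex_inner"
  assumes B: "is_onb B"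
  shows "((\<lambda>b. cinner x b *\<^sub>C b) has_sum x) B"
  unfolding has_sum_def
proof (rule tendstoI)
  fix e :: real assume e: "e > 0"
  have n: "norm b = 1" if "b \<in> B" for b using B that unfolding is_onb_def by blast
  have o: "cinner b c = 0" if "b \<in> B" "c \<in> B" "b \<noteq> c" for b c
    using B that unfolding is_onb_def by blast
  have "x \<in> closure (cspan B)" using B by (simp add: is_onb_def)
  then obtain y where y: "y \<in> cspan B" "dist y x < e"
    using e unfolding closure_approachable by blast
  obtain F0 r where F0: "finite F0" "F0 \<subseteq> B" and yF: "y = (\<Sum>b\<in>F0. r b *\<^sub>C b)"
    using y(1) unfolding complex_vector.span_explicit by blast
  have "dist (\<Sum>b\<in>F. cinner x b *\<^sub>C b) x < e" if F: "finite F" "F0 \<subseteq> F" "F \<subseteq> B" for F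
  proof -
    let ?p = "\<Sum>b\<in>F. cinner x b *\<^sub>C b"
    have c: "cinner (x - ?p) c = 0" if "c \<in> F" for c
      using cinner_orthonormal_sum[of F c "cinner x"] F that n o
      by (simp add: cinner_diff_left subset_iff)
    have "cinner (x - ?p) (?p - y) = 0"
      using F(2) by (auto simp: yF cinner_diff_right[of "x - ?p"] cinner_sum_right cinner_scaleC_right c subset_iff)
    then have "(norm (x - y))\<^sup>2 = (norm (x - ?p))\<^sup>2 + (norm (?p - y))\<^sup>2"
      using norm_diff_sq_orthogonal[of "x - y" "?p - y"] by (simp add: algebra_simps)
    then have "(norm (x - ?p))\<^sup>2 \<le> (norm (x - y))\<^sup>2" by simp
    then have "norm (x - ?p) \<le> norm (x - y)" by (rule power2_le_imp_le) simp
    then show ?thesis using y(2) by (simp add: dist_norm norm_minus_commute)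
  qed
  then show "\<forall>\<^sub>F F in finite_subsets_at_top B. dist (\<Sum>b\<in>F. cinner x b *\<^sub>C b) x < e"
    using F0 unfolding eventually_finite_subsets_at_top by blast
qed

lemma parseval:
  fixes x :: "'a::complex_inner"
  assumes B: "is_onb B"
  shows "((\<lambda>b. cinner x b * cnj (cinner y b)) has_sum cinner x y) B"
proof -
  have "cinner (\<Sum>b\<in>F. cinner x b *\<^sub>C b) y = (\<Sum>b\<in>F. cinner x b * cnj (cinner y b))" for F
    unfolding cinner_sum_left cinner_scaleC_left by (intro sum.cong refl) (metis cinner_commute)
  then show ?thesis
    using tendsto_cinner_left[OF onb_expansion[OF B, of x, unfolded has_sum_def], of y]
    by (simp add: has_sum_def)
qed

text \<open>The \<open>n\<close>-particle components contribute \<open>\<langle>\<zeta>|\<eta>\<rangle>\<^sup>n / n!\<close>: the sum over words of length \<open>n\<close> in the basis is the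
  \<open>n\<close>-th power of the Parseval sum.\<close>

lemma cinner_exp_vec: "cinner (exp_vec \<zeta>) (exp_vec \<eta>) = exp (cinner \<zeta> (\<eta>::'h::chilbert_space))"
proof -
  define g where "g x = cinner \<zeta> x * cnj (cinner \<eta> x)" for x
  define p where "p xs = (\<Prod>x\<leftarrow>xs. g x)" for xs
  define L where "L n = {xs \<in> lists (onb::'h set). length xs = n}" for n
  have rep: "Rep_fock (exp_vec \<zeta>) xs * cnj (Rep_fock (exp_vec \<eta>) xs) = p xs / fact (length xs)" for xs
  proof -
    have "(\<Prod>x\<leftarrow>xs. cinner \<zeta> x) * cnj (\<Prod>x\<leftarrow>xs. cinner \<eta> x) = p xs"
      by (induction xs) (simp_all add: p_def g_def mult_ac)
    moreover have "complex_of_real (sqrt (fact (length xs))) * complex_of_real (sqrt (fact (length xs)))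
        = fact (length xs)"
      by (metis of_real_fact of_real_mult real_sqrt_mult_self abs_of_nonneg fact_ge_zero)
    ultimately show ?thesis
      by (simp add: exp_vec.rep_eq times_divide_times_eq)
  qed
  have summ: "(\<lambda>xs. p xs / fact (length xs)) summable_on lists onb"
    using fock_summable[of "exp_vec \<zeta>" "exp_vec \<eta>"] unfolding rep .
  have summL: "p summable_on L n" for n
  proof -
    have "(\<lambda>xs. p xs / fact (length xs)) summable_on L n"
      by (rule summable_on_subset_banach[OF summ]) (auto simp: L_def)
    then have "(\<lambda>xs. fact n * (p xs / fact (length xs))) summable_on L n"
      by (rule summable_on_cmult_right)
    then show ?thesis by (rule summable_on_cong[THEN iffD1, rotated]) (auto simp: L_def)
  qed
  have level: "infsum p (L n) = (cinner \<zeta> \<eta>) ^ n" for n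
  proof (induction n)
    case 0
    have "L 0 = {[]}" by (auto simp: L_def)
    then show ?case by (simp add: p_def)
  next
    case (Suc n)
    have bij: "bij_betw (\<lambda>(b, xs). b # xs) (onb \<times> L n) (L (Suc n))"
      unfolding bij_betw_def by (auto simp: inj_on_def L_def length_Suc_conv image_iff)
    have "(\<lambda>z. p (case z of (b, xs) \<Rightarrow> b # xs)) summable_on onb \<times> L n"
      using summL[of "Suc n"] summable_on_reindex_bij_betw[OF bij, of p] by simp
    then have s: "(\<lambda>(b, xs). g b * p xs) summable_on onb \<times> L n"
      by (simp add: case_prod_unfold p_def)
    have "infsum p (L (Suc n)) = (\<Sum>\<^sub>\<infinity>z\<in>onb \<times> L n. p (case z of (b, xs) \<Rightarrow> b # xs))"
      by (rule infsum_reindex_bij_betw[OF bij, symmetric])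
    also have "\<dots> = (\<Sum>\<^sub>\<infinity>(b, xs)\<in>onb \<times> L n. g b * p xs)"
      by (simp add: case_prod_unfold p_def)
    also have "\<dots> = (\<Sum>\<^sub>\<infinity>b\<in>onb. \<Sum>\<^sub>\<infinity>xs\<in>L n. g b * p xs)"
      by (rule infsum_Sigma'_banach[OF s, symmetric])
    also have "\<dots> = (\<Sum>\<^sub>\<infinity>b\<in>onb. g b) * infsum p (L n)"
      by (simp add: infsum_cmult_right' infsum_cmult_left')
    also have "(\<Sum>\<^sub>\<infinity>b\<in>onb. g b) = cinner \<zeta> \<eta>"
      unfolding g_def by (rule infsumI[OF parseval[OF is_onb_onb]])
    finally show ?case by (simp add: Suc.IH)
  qed
  have bij: "bij_betw snd (Sigma UNIV L) (lists onb)"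
    unfolding bij_betw_def by (auto simp: inj_on_def L_def image_iff)
  have s: "(\<lambda>(n, xs). p xs / fact (length xs)) summable_on Sigma UNIV L"
    using summ summable_on_reindex_bij_betw[OF bij, of "\<lambda>xs. p xs / fact (length xs)"]
    by (simp add: case_prod_unfold)
  have inner: "(\<Sum>\<^sub>\<infinity>xs\<in>L n. p xs / fact (length xs)) = cinner \<zeta> \<eta> ^ n /\<^sub>R fact n" for n
  proof -
    have "(\<Sum>\<^sub>\<infinity>xs\<in>L n. p xs / fact (length xs)) = (\<Sum>\<^sub>\<infinity>xs\<in>L n. inverse (fact n) * p xs)"
      by (rule infsum_cong) (simp add: L_def divide_inverse mult.commute)
    also have "\<dots> = cinner \<zeta> \<eta> ^ n /\<^sub>R fact n"
      by (simp add: infsum_cmult_right' level scaleR_conv_of_real)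
    finally show ?thesis .
  qed
  have "(\<lambda>n. cinner \<zeta> \<eta> ^ n /\<^sub>R fact n) summable_on UNIV"
    using summable_on_Sigma_banach[OF s] by (simp add: inner)
  then have "((\<lambda>n. cinner \<zeta> \<eta> ^ n /\<^sub>R fact n) has_sum (\<Sum>\<^sub>\<infinity>n. cinner \<zeta> \<eta> ^ n /\<^sub>R fact n)) UNIV"
    by (rule has_sum_infsum)
  then have "(\<Sum>\<^sub>\<infinity>n. cinner \<zeta> \<eta> ^ n /\<^sub>R fact n) = exp (cinner \<zeta> \<eta>)"
    using has_sum_imp_sums exp_converges sums_unique2 by blast
  moreover have "cinner (exp_vec \<zeta>) (exp_vec \<eta>) = (\<Sum>\<^sub>\<infinity>xs\<in>lists onb. p xs / fact (length xs))"
    unfolding cinner_fock_def rep ..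
  moreover have "\<dots> = (\<Sum>\<^sub>\<infinity>(n, xs)\<in>Sigma UNIV L. p xs / fact (length xs))"
    using infsum_reindex_bij_betw[OF bij, of "\<lambda>xs. p xs / fact (length xs)"]
    by (simp add: case_prod_unfold)
  moreover have "\<dots> = (\<Sum>\<^sub>\<infinity>n. \<Sum>\<^sub>\<infinity>xs\<in>L n. p xs / fact (length xs))"
    by (rule infsum_Sigma'_banach[OF s, symmetric])
  ultimately show ?thesis by (simp add: inner)
qed

lemma power_series_zero:
  fixes a :: "nat \<Rightarrow> complex"
  assumes "\<And>w. (\<lambda>n. a n * w ^ n) sums 0"
  shows "a n = 0"
proof -
  have "conv_radius a \<ge> norm (1::complex)"
    by (rule conv_radius_geI) (use assms[of 1] in \<open>auto simp: sums_iff\<close>)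
  then have r: "fps_conv_radius (Abs_fps a) > 0"
    by (simp add: fps_conv_radius_def one_ereal_def less_le_trans[of 0 1])
  have "eval_fps (Abs_fps a) w = eval_fps 0 w" for w
    using assms[of w] by (simp add: eval_fps_def sums_iff)
  then have "Abs_fps a = 0"
    by (intro eval_fps_eqD r) (auto simp: always_eventually)
  then show ?thesis by (metis fps_nth_Abs_fps fps_zero_nth)
qed

text \<open>The diagonal values of a symmetric conjugate-multilinear functional at \<open>\<eta> + t \<zeta>\<close> are polynomial in the
  real parameter \<open>t\<close>; only the first two coefficients matter for polarization. The trailing arguments
  \<open>ys\<close> are carried along for the induction.\<close>

lemma fock_first_order_expansion:
  assumes f: "f \<in> fock_vectors"
  shows "\<exists>p. (\<forall>t::real. f (replicate m (\<eta> + complex_of_real t *\<^sub>C \<zeta>) @ ys) = poly p (complex_of_real t)) \<and>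
    coeff p 0 = f (replicate m \<eta> @ ys) \<and> coeff p 1 = of_nat m * f (replicate (m - 1) \<eta> @ \<zeta> # ys)"
proof (induction m arbitrary: ys)
  case 0
  show ?case by (rule exI[of _ "[:f ys:]"]) simp
next
  case (Suc m)
  obtain p q where
    p: "\<And>t::real. f (replicate m (\<eta> + complex_of_real t *\<^sub>C \<zeta>) @ \<eta> # ys) = poly p (complex_of_real t)"
      "coeff p 0 = f (replicate m \<eta> @ \<eta> # ys)" "coeff p 1 = of_nat m * f (replicate (m - 1) \<eta> @ \<zeta> # \<eta> # ys)"
    and q: "\<And>t::real. f (replicate m (\<eta> + complex_of_real t *\<^sub>C \<zeta>) @ \<zeta> # ys) = poly q (complex_of_real t)"
      "coeff q 0 = f (replicate m \<eta> @ \<zeta> # ys)"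
    using Suc.IH[of "\<eta> # ys"] Suc.IH[of "\<zeta> # ys"] by blast
  have "f (replicate (Suc m) (\<eta> + complex_of_real t *\<^sub>C \<zeta>) @ ys) = poly (p + pCons 0 q) (complex_of_real t)" for t :: real
  proof -
    let ?v = "\<eta> + complex_of_real t *\<^sub>C \<zeta>"
    have "f (replicate (Suc m) ?v @ ys) = f (replicate m ?v @ ?v # ys)"
      by (rule fock_vectorsD(4)[OF f]) simp
    also have "\<dots> = f (replicate m ?v @ \<eta> # ys) + complex_of_real t * f (replicate m ?v @ \<zeta> # ys)"
      by (simp add: fock_vectorsD(1,2)[OF f])
    finally show ?thesis by (simp add: p(1) q(1))
  qed
  moreover have "coeff (p + pCons 0 q) 0 = f (replicate (Suc m) \<eta> @ ys)"
    unfolding coeff_add p(2) by simp (rule fock_vectorsD(4)[OF f], simp)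
  moreover have "coeff (p + pCons 0 q) 1 = of_nat (Suc m) * f (replicate (Suc m - 1) \<eta> @ \<zeta> # ys)"
  proof -
    have "of_nat m * f (replicate (m - 1) \<eta> @ \<zeta> # \<eta> # ys) = of_nat m * f (replicate m \<eta> @ \<zeta> # ys)"
    proof (cases m)
      case (Suc k)
      then show ?thesis
        using fock_vectorsD(4)[OF f, of "replicate k \<eta> @ \<zeta> # \<eta> # ys" "replicate m \<eta> @ \<zeta> # ys"] by simp
    qed simp
    then show ?thesis by (simp add: p(3)[unfolded One_nat_def] q(2) distrib_right)
  qed
  ultimately show ?case by blast
qed

text \<open>A symmetric multilinear functional that vanishes on the diagonal vanishes: the linear coefficient in \<open>t\<close> of
  its value at \<open>\<eta> + t \<zeta>\<close> frees one argument, and induction frees the others.\<close>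

lemma fock_polarization:
  assumes f: "f \<in> fock_vectors" and S: "complex_vector.subspace S"
    and diag: "\<And>\<eta>. \<eta> \<in> S \<Longrightarrow> f (replicate m \<eta> @ ys) = 0"
    and xs: "length xs = m" "set xs \<subseteq> S"
  shows "f (xs @ ys) = 0"
  using diag xs
proof (induction m arbitrary: xs ys)
  case 0
  then show ?case using complex_vector.subspace_0[OF S] by auto
next
  case (Suc m)
  have step: "f (replicate m \<eta> @ \<zeta> # ys) = 0" if "\<eta> \<in> S" "\<zeta> \<in> S" for \<eta> \<zeta>
  proof -
    obtain p where p: "\<And>t::real. f (replicate (Suc m) (\<eta> + complex_of_real t *\<^sub>C \<zeta>) @ ys) = poly p (complex_of_real t)"
      "coeff p 1 = of_nat (Suc m) * f (replicate (Suc m - 1) \<eta> @ \<zeta> # ys)"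
      using fock_first_order_expansion[OF f, of "Suc m" \<eta> \<zeta> ys] by blast
    have "poly p (complex_of_real t) = 0" for t
      unfolding p(1)[symmetric]
      by (intro Suc.prems complex_vector.subspace_add[OF S] complex_vector.subspace_scale[OF S] that)
    then have "range complex_of_real \<subseteq> {z. poly p z = 0}" by auto
    moreover have "infinite (range complex_of_real)"
      by (simp add: finite_image_iff inj_of_real infinite_UNIV_char_0)
    ultimately have "p = 0" using poly_roots_finite finite_subset by blast
    then show ?thesis using p(2) by (simp del: of_nat_Suc)
  qed
  obtain zs \<zeta> where z: "xs = zs @ [\<zeta>]" "length zs = m"
    using Suc.prems(2) by (metis length_Suc_conv_rev)
  have "f (zs @ \<zeta> # ys) = 0"
    by (rule Suc.IH) (use Suc.prems(3) z step in auto)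
  then show ?case by (simp add: z(1))
qed

lemma fock_diagonal_expansion:
  assumes f: "f \<in> fock_vectors" and F: "finite F"
  shows "f (replicate n (\<Sum>b\<in>F. z b *\<^sub>C b) @ ys) =
    (\<Sum>xs\<in>{xs. set xs \<subseteq> F \<and> length xs = n}. cnj (\<Prod>x\<leftarrow>xs. z x) * f (xs @ ys))"
proof (induction n arbitrary: ys)
  case 0
  have "{xs. set xs \<subseteq> F \<and> length xs = 0} = {[]}" by auto
  then show ?case by simp
next
  case (Suc n)
  let ?v = "\<Sum>b\<in>F. z b *\<^sub>C b" and ?A = "\<lambda>n. {xs. set xs \<subseteq> F \<and> length xs = n}"
  have f0: "f (us @ 0 # vs) = 0" for us vs
    using fock_vectorsD(2)[OF f, of us 0 0 vs] by simp
  have lin: "f (us @ (\<Sum>b\<in>G. z b *\<^sub>C b) # vs) = (\<Sum>b\<in>G. cnj (z b) * f (us @ b # vs))" for us vs G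
    by (induction G rule: infinite_finite_induct) (auto simp: f0 fock_vectorsD(1,2)[OF f])
  have "f (replicate (Suc n) ?v @ ys) = (\<Sum>b\<in>F. cnj (z b) * f (replicate n ?v @ b # ys))"
    using fock_vectorsD(4)[OF f, of "replicate (Suc n) ?v @ ys" "replicate n ?v @ ?v # ys"] by (simp add: lin)
  also have "\<dots> = (\<Sum>b\<in>F. \<Sum>xs\<in>?A n. cnj (\<Prod>x\<leftarrow>b # xs. z x) * f (xs @ b # ys))"
    by (simp add: Suc.IH sum_distrib_left mult.assoc)
  also have "\<dots> = (\<Sum>(b, xs)\<in>F \<times> ?A n. cnj (\<Prod>x\<leftarrow>b # xs. z x) * f ((b # xs) @ ys))"
    unfolding sum.cartesian_product
    by (intro sum.cong refl) (auto intro!: fock_vectorsD(4)[OF f])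
  also have "\<dots> = (\<Sum>xs\<in>(\<lambda>(b, xs). b # xs) ` (F \<times> ?A n). cnj (\<Prod>x\<leftarrow>xs. z x) * f (xs @ ys))"
    by (subst sum.reindex) (auto simp: inj_on_def case_prod_unfold)
  also have "(\<lambda>(b, xs). b # xs) ` (F \<times> ?A n) = ?A (Suc n)"
    by (auto simp: length_Suc_conv image_iff)
  finally show ?case .
qed

text \<open>If \<open>u\<close> is orthogonal to all exponential vectors, then \<open>w \<mapsto> \<langle>u|e(cnj w \<eta>)\<rangle>\<close> vanishes identically. For \<open>\<eta>\<close> in
  the algebraic span of the basis this is a power series whose coefficients are multiples of the diagonal
  values of \<open>u\<close>, with only finite sums inside each coefficient. Polarization then kills \<open>u\<close> on all words in
  the basis, hence its norm.\<close>

lemma exp_vec_total: "closure (cspan (range (exp_vec :: 'h::chilbert_space \<Rightarrow> 'h fock))) = UNIV"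
  unfolding total_iff_orthogonal_trivial
proof (intro allI impI)
  fix u :: "'h fock"
  assume u: "\<forall>b\<in>range exp_vec. cinner u b = 0"
  let ?f = "Rep_fock u"
  have f: "?f \<in> fock_vectors" by (rule Rep_fock)
  have "?f (replicate n \<eta>) = 0" if \<eta>: "\<eta> \<in> cspan onb" for n \<eta>
  proof -
    obtain F z where F: "finite F" "F \<subseteq> onb" and \<eta>F: "\<eta> = (\<Sum>b\<in>F. z b *\<^sub>C b)"
      using \<eta> unfolding complex_vector.span_explicit by blast
    have n: "norm b = 1" if "b \<in> onb" for b :: 'h using is_onb_onb that unfolding is_onb_def by blast
    have o: "cinner b c = 0" if "b \<in> onb" "c \<in> onb" "b \<noteq> c" for b c :: 'h
      using is_onb_onb that unfolding is_onb_def by blast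
    have in_F: "cinner \<eta> x = z x" if "x \<in> F" for x
      unfolding \<eta>F by (intro cinner_orthonormal_sum n o F(1) that; use F(2) in blast)
    have out_F: "cinner \<eta> x = 0" if x: "x \<in> onb - F" for x
    proof -
      have "cinner b x = 0" if "b \<in> F" for b using F(2) that x by (intro o) auto
      then show ?thesis unfolding \<eta>F cinner_sum_left cinner_scaleC_left by simp
    qed
    let ?A = "\<lambda>n. {xs. set xs \<subseteq> F \<and> length xs = n}"
    have finA: "finite (?A n)" for n by (rule finite_lists_length_eq[OF F(1)])
    have t_eq: "?f xs * cnj (Rep_fock (exp_vec (cnj w *\<^sub>C \<eta>)) xs)
        = cnj (\<Prod>x\<leftarrow>xs. cinner \<eta> x) * ?f xs / complex_of_real (sqrt (fact (length xs))) * w ^ length xs" for xs w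
    proof -
      have "(\<Prod>x\<leftarrow>xs. cinner (cnj w *\<^sub>C \<eta>) x) = cnj w ^ length xs * (\<Prod>x\<leftarrow>xs. cinner \<eta> x)"
        by (induction xs) (simp_all add: cinner_scaleC_left mult_ac)
      then show ?thesis by (simp add: exp_vec.rep_eq mult_ac)
    qed
    \<comment> \<open>the Taylor coefficients, which are \<open>?f (replicate n \<eta>)\<close> up to the factor \<open>\<surd>n!\<close>\<close>
    define a where "a n = (\<Sum>xs\<in>?A n. cnj (\<Prod>x\<leftarrow>xs. z x) * ?f xs) / complex_of_real (sqrt (fact n))" for n
    have "(\<lambda>n. a n * w ^ n) sums 0" for w
    proof -
      let ?t = "\<lambda>xs. ?f xs * cnj (Rep_fock (exp_vec (cnj w *\<^sub>C \<eta>)) xs)"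
      have "(?t has_sum cinner u (exp_vec (cnj w *\<^sub>C \<eta>))) (lists onb)"
        unfolding cinner_fock_def by (rule has_sum_infsum[OF fock_summable])
      then have "(?t has_sum 0) (lists onb)" using u by simp
      moreover have "?t xs = 0" if xs: "xs \<in> lists onb - lists F" for xs
      proof -
        obtain x where "x \<in> set xs" "x \<in> onb - F" using xs by (auto simp: lists_eq_set)
        then have "(\<Prod>x\<leftarrow>xs. cinner \<eta> x) = 0"
          using out_F by (auto simp: prod_list_zero_iff image_iff intro!: bexI[of _ x])
        then show ?thesis unfolding t_eq by simp
      qed
      ultimately have "(?t has_sum 0) (lists F)"
        using F(2) by (subst has_sum_cong_neutral[where T = "lists onb" and g = ?t]) auto
      moreover have bij: "bij_betw snd (Sigma UNIV ?A) (lists F)"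
        unfolding bij_betw_def by (auto simp: inj_on_def image_iff lists_eq_set)
      ultimately have "((\<lambda>z. ?t (snd z)) has_sum 0) (Sigma UNIV ?A)"
        using has_sum_reindex_bij_betw[OF bij, of ?t 0] by simp
      moreover have "((\<lambda>xs. ?t xs) has_sum (\<Sum>xs\<in>?A n. ?t xs)) (?A n)" for n
        by (rule has_sum_finite[OF finA])
      ultimately have "((\<lambda>n. \<Sum>xs\<in>?A n. ?t xs) has_sum 0) UNIV"
        by (intro has_sum_SigmaD[where f = "\<lambda>z. ?t (snd z)" and A = UNIV and B = ?A]) auto
      moreover have "(\<Sum>xs\<in>?A n. ?t xs) = a n * w ^ n" for n
      proof -
        have "(\<Sum>xs\<in>?A n. ?t xs) =
            (\<Sum>xs\<in>?A n. cnj (\<Prod>x\<leftarrow>xs. z x) * ?f xs / complex_of_real (sqrt (fact n)) * w ^ n)"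
        proof (intro sum.cong refl)
          fix xs assume xs: "xs \<in> ?A n"
          have "map (cinner \<eta>) xs = map z xs" using xs in_F by auto
          then have "(\<Prod>x\<leftarrow>xs. cinner \<eta> x) = (\<Prod>x\<leftarrow>xs. z x)" by (rule arg_cong)
          then show "?t xs = cnj (\<Prod>x\<leftarrow>xs. z x) * ?f xs / complex_of_real (sqrt (fact n)) * w ^ n"
            using xs unfolding t_eq by simp
        qed
        then show ?thesis by (simp add: a_def sum_divide_distrib sum_distrib_right)
      qed
      ultimately have "((\<lambda>n. a n * w ^ n) has_sum 0) UNIV" by simp
      then show ?thesis by (rule has_sum_imp_sums)
    qed
    then have "a n = 0" by (rule power_series_zero)
    then show ?thesis
      using fock_diagonal_expansion[OF f F(1), of n z "[]"] by (simp add: a_def \<eta>F)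
  qed
  then have diag: "?f (replicate n \<eta> @ []) = 0" if "\<eta> \<in> cspan onb" for n \<eta> using that by simp
  have zero: "?f xs = 0" if "xs \<in> lists onb" for xs
  proof -
    have "set xs \<subseteq> cspan onb"
      using that complex_vector.span_superset by (auto simp: lists_eq_set)
    then have "?f (xs @ []) = 0"
      using fock_polarization[OF f complex_vector.subspace_span diag refl] by blast
    then show ?thesis by simp
  qed
  have "inner u u = 0"
    unfolding inner_fock_self using infsum_0[of "lists onb" "\<lambda>xs. (cmod (?f xs))\<^sup>2"] zero by simp
  then show "u = 0" by simp
qed

text \<open>The derivative at \<open>t = 0\<close> of \<open>t \<mapsto> e(t \<eta>)\<close>.\<close>

lift_definition one_particle :: "'h::chilbert_space \<Rightarrow> 'h fock" is
  "\<lambda>\<eta> xs. if length xs = 1 then cinner \<eta> (hd xs) else 0"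
proof (rule fock_vectorsI)
  fix \<eta> :: 'h
  let ?f = "\<lambda>xs. if length xs = 1 then cinner \<eta> (hd xs) else 0"
  show "?f (xs @ (x + y) # ys) = ?f (xs @ x # ys) + ?f (xs @ y # ys)" for xs x y ys
    by (simp add: cinner_add_right)
  show "?f (xs @ (c *\<^sub>C x) # ys) = cnj c * ?f (xs @ x # ys)" for xs c x ys
    by (simp add: cinner_scaleC_right)
  show "?f xs = ?f ys" if m: "mset xs = mset ys" for xs ys
  proof (cases "length xs = 1")
    case True
    then obtain x where "xs = [x]" by (auto simp: length_Suc_conv)
    then show ?thesis using m by (auto simp: mset_eq_length)
  qed (use mset_eq_length[OF m] in simp)
  show "\<exists>C. \<forall>xs. length xs = n \<longrightarrow> cmod (?f xs) \<le> C * (\<Prod>x\<leftarrow>xs. norm x)" for n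
  proof (cases "n = 1")
    case True
    then show ?thesis
      by (intro exI[of _ "norm \<eta>"]) (auto simp: length_Suc_conv cmod_cinner_le)
  qed (auto intro!: exI[of _ 0])
  show "(\<lambda>xs. (cmod (?f xs))\<^sup>2) summable_on lists onb"
  proof (rule summable_on_comparison_test)
    show "(\<lambda>xs. (cmod (Rep_fock (exp_vec \<eta>) xs))\<^sup>2) summable_on lists onb"
      by (rule fock_vectorsD(5)[OF Rep_fock])
    show "(cmod (?f xs))\<^sup>2 \<le> (cmod (Rep_fock (exp_vec \<eta>) xs))\<^sup>2" for xs
      by (cases xs) (auto simp: exp_vec.rep_eq)
  qed auto
qed

lemma one_particle_add: "one_particle (x + y) = one_particle x + one_particle y"
  by transfer (auto simp: fun_eq_iff cinner_add_left)

lemma one_particle_scaleC: "one_particle (c *\<^sub>C x) = c *\<^sub>C one_particle x"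
  by transfer (auto simp: fun_eq_iff cinner_scaleC_left)

lemma cinner_one_particle_if_singleton:
  assumes "\<And>b. Rep_fock u [b] = cinner \<eta> b"
  shows "cinner (one_particle \<zeta>) u = cinner \<zeta> \<eta>"
proof -
  have "cinner (one_particle \<zeta>) u
      = (\<Sum>\<^sub>\<infinity>xs\<in>lists onb. Rep_fock (one_particle \<zeta>) xs * cnj (Rep_fock u xs))"
    by (rule cinner_fock_def)
  also have "\<dots> = (\<Sum>\<^sub>\<infinity>xs\<in>(\<lambda>b. [b]) ` onb. Rep_fock (one_particle \<zeta>) xs * cnj (Rep_fock u xs))"
    by (rule infsum_cong_neutral)
       (auto simp: one_particle.rep_eq length_Suc_conv image_iff)
  also have "\<dots> = (\<Sum>\<^sub>\<infinity>b\<in>onb. cinner \<zeta> b * cnj (cinner \<eta> b))"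
    by (subst infsum_reindex) (auto simp: inj_on_def o_def one_particle.rep_eq assms)
  also have "\<dots> = cinner \<zeta> \<eta>" by (rule infsumI[OF parseval[OF is_onb_onb]])
  finally show ?thesis .
qed

lemma cinner_one_particle_exp_vec: "cinner (one_particle \<zeta>) (exp_vec \<eta>) = cinner \<zeta> \<eta>"
  by (rule cinner_one_particle_if_singleton) (simp add: exp_vec.rep_eq)

lemma cinner_one_particle: "cinner (one_particle \<zeta>) (one_particle \<eta>) = cinner \<zeta> \<eta>"
  by (rule cinner_one_particle_if_singleton) (simp add: one_particle.rep_eq)

lemma norm_one_particle: "norm (one_particle \<eta>) = norm \<eta>"
  using cinner_one_particle[of \<eta> \<eta>] by (simp add: cinner_self del: of_real_power)

text \<open>The part of \<open>e(\<eta>)\<close> with at least two particles.\<close>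

definition exp_remainder :: "'h::chilbert_space \<Rightarrow> 'h fock" where
  "exp_remainder \<eta> = exp_vec \<eta> - exp_vec 0 - one_particle \<eta>"

lemma cinner_exp_remainder:
  "cinner (exp_remainder \<zeta>) (exp_remainder \<eta>) = exp (cinner \<zeta> \<eta>) - 1 - cinner \<zeta> \<eta>"
proof -
  have "cinner (exp_vec \<zeta>) (one_particle \<eta>) = cinner \<zeta> \<eta>" for \<zeta> \<eta> :: 'a
    by (subst (1 2) cinner_commute) (simp add: cinner_one_particle_exp_vec)
  then show ?thesis
    by (simp add: exp_remainder_def cinner_diff_left cinner_diff_right cinner_exp_vec
        cinner_one_particle_exp_vec cinner_one_particle)
qed

lemma norm_exp_vec_sq: "(norm (exp_vec \<eta>))\<^sup>2 = exp ((norm \<eta>)\<^sup>2)"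
proof -
  have "complex_of_real ((norm (exp_vec \<eta>))\<^sup>2) = complex_of_real (exp ((norm \<eta>)\<^sup>2))"
    unfolding cinner_self[symmetric] cinner_exp_vec by (simp only: cinner_self exp_of_real)
  then show ?thesis by (simp only: of_real_eq_iff)
qed

text \<open>The remainder is of second order, and for orthogonal arguments the remainders are orthogonal by the
  formula for their inner products. Together these two facts make the second order terms negligible along
  fine partitions.\<close>

lemma norm_exp_remainder_le:
  assumes "norm \<eta> \<le> 1"
  shows "norm (exp_remainder \<eta>) \<le> (norm \<eta>)\<^sup>2"
proof (rule power2_le_imp_le)
  have "complex_of_real ((norm (exp_remainder \<eta>))\<^sup>2) = complex_of_real (exp ((norm \<eta>)\<^sup>2) - 1 - (norm \<eta>)\<^sup>2)"
    unfolding cinner_self[symmetric] cinner_exp_remainder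
    by (simp only: cinner_self exp_of_real of_real_diff of_real_1)
  then have "(norm (exp_remainder \<eta>))\<^sup>2 = exp ((norm \<eta>)\<^sup>2) - 1 - (norm \<eta>)\<^sup>2"
    by (simp only: of_real_eq_iff)
  also have "\<dots> \<le> ((norm \<eta>)\<^sup>2)\<^sup>2"
    using exp_bound[of "(norm \<eta>)\<^sup>2"] assms by (simp add: power_le_one)
  finally show "(norm (exp_remainder \<eta>))\<^sup>2 \<le> ((norm \<eta>)\<^sup>2)\<^sup>2" .
qed simp

lemma tendsto_exp_vec:
  fixes f :: "'i \<Rightarrow> 'h::chilbert_space"
  assumes f: "(f \<longlongrightarrow> x) F"
  shows "((\<lambda>i. exp_vec (f i)) \<longlongrightarrow> exp_vec x) F"
proof -
  have "((\<lambda>i. (norm (exp_vec (f i)))\<^sup>2 + (norm (exp_vec x))\<^sup>2 - 2 * Re (cinner (exp_vec (f i)) (exp_vec x)))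
    \<longlongrightarrow> (norm (exp_vec x))\<^sup>2 + (norm (exp_vec x))\<^sup>2 - 2 * Re (cinner (exp_vec x) (exp_vec x))) F"
    unfolding norm_exp_vec_sq cinner_exp_vec
    by (intro tendsto_intros tendsto_cinner_left f)
  then have "((\<lambda>i. (norm (exp_vec (f i) - exp_vec x))\<^sup>2) \<longlongrightarrow> 0) F"
    unfolding norm_diff_sq[symmetric] by simp
  then have "((\<lambda>i. norm (exp_vec (f i) - exp_vec x)) \<longlongrightarrow> 0) F"
    using tendsto_real_sqrt[of "\<lambda>i. (norm (exp_vec (f i) - exp_vec x))\<^sup>2" 0 F] by simp
  then show ?thesis by (simp add: tendsto_norm_zero_iff LIM_zero_iff)
qed

lemma exp_vec_nonzero: "exp_vec \<eta> \<noteq> 0"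
  using norm_exp_vec_sq[of \<eta>] by auto

section \<open>Weyl operators\<close>

text \<open>Equality on a total set suffices by complex linearity and continuity; going through the adjoints replaces a
  limit argument by testing on the total set.\<close>

lemma bounded_ops_eqI:
  fixes A B :: "'k::chilbert_space \<Rightarrow>\<^sub>L 'k"
  assumes A: "A \<in> bounded_ops" and B: "B \<in> bounded_ops"
    and total: "closure (cspan S) = UNIV" and eq: "\<And>s. s \<in> S \<Longrightarrow> A s = B s"
  shows "A = B"
proof (rule blinfun_eqI)
  fix x
  have "cinner (A x) y = cinner (B x) y" for y
  proof -
    have "cadjoint A y = cadjoint B y"
    proof (rule eq_if_cinner_total[OF total])
      fix s assume "s \<in> S"
      then show "cinner (cadjoint A y) s = cinner (cadjoint B y) s"
        by (simp add: cinner_cadjoint_left A B eq)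
    qed
    then show ?thesis using cinner_cadjoint_right[OF A, of x y] cinner_cadjoint_right[OF B, of x y] by simp
  qed
  then show "A x = B x" by (rule eq_if_cinner_all)
qed

definition weyl_scalar :: "'h::chilbert_space \<Rightarrow> 'h \<Rightarrow> complex" where
  "weyl_scalar \<xi> \<eta> = exp (- complex_of_real ((norm \<xi>)\<^sup>2 / 2) - cinner \<eta> \<xi>)"

text \<open>The prescribed images of the exponential vectors have the Gram matrix of the exponential vectors, so that
  an isometry with these values exists. Totality makes it unique, and the definite description of the
  Weyl operator denotes it.\<close>

lemma
  fixes \<xi> :: "'h::chilbert_space"
  shows weyl_bounded_ops: "weyl \<xi> \<in> bounded_ops"
    and weyl_exp_vec: "weyl \<xi> (exp_vec \<eta>) = weyl_scalar \<xi> \<eta> *\<^sub>C exp_vec (\<xi> + \<eta>)"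
proof -
  let ?f = "\<lambda>\<eta>. weyl_scalar \<xi> \<eta> *\<^sub>C exp_vec (\<xi> + \<eta>)"
  have gram: "cinner (?f \<eta>) (?f \<eta>') = cinner (exp_vec \<eta>) (exp_vec \<eta>')" for \<eta> \<eta>'
  proof -
    have c: "cnj (cinner \<eta>' \<xi>) = cinner \<xi> \<eta>'" by (rule cinner_commute[symmetric])
    have n: "cinner \<xi> \<xi> = complex_of_real ((norm \<xi>)\<^sup>2 / 2) + complex_of_real ((norm \<xi>)\<^sup>2 / 2)"
      unfolding cinner_self of_real_add[symmetric] by simp
    show ?thesis
      by (simp add: weyl_scalar_def cinner_scaleC_left cinner_scaleC_right cinner_exp_vec exp_cnj
          exp_add[symmetric] c cinner_add_left cinner_add_right n)
  qed
  obtain W where W: "W \<in> bounded_ops" "\<And>\<eta>. blinfun_apply W (exp_vec \<eta>) = ?f \<eta>"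
    using isometric_extension[where e = exp_vec and f = ?f, OF gram exp_vec_total] by blast
  have "\<exists>!W. W \<in> bounded_ops \<and> (\<forall>\<eta>. blinfun_apply W (exp_vec \<eta>) =
        exp (- complex_of_real ((norm \<xi>)\<^sup>2 / 2) - cinner \<eta> \<xi>) *\<^sub>C exp_vec (\<xi> + \<eta>))"
  proof (rule ex1I[of _ W])
    show "W \<in> bounded_ops \<and> (\<forall>\<eta>. blinfun_apply W (exp_vec \<eta>) =
        exp (- complex_of_real ((norm \<xi>)\<^sup>2 / 2) - cinner \<eta> \<xi>) *\<^sub>C exp_vec (\<xi> + \<eta>))"
      using W by (simp add: weyl_scalar_def)
    show "W' = W" if "W' \<in> bounded_ops \<and> (\<forall>\<eta>. blinfun_apply W' (exp_vec \<eta>) =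
        exp (- complex_of_real ((norm \<xi>)\<^sup>2 / 2) - cinner \<eta> \<xi>) *\<^sub>C exp_vec (\<xi> + \<eta>))" for W'
      by (rule bounded_ops_eqI[OF _ W(1) exp_vec_total]) (use that W(2) in \<open>auto simp: weyl_scalar_def\<close>)
  qed
  from theI'[OF this] show "weyl \<xi> \<in> bounded_ops" "weyl \<xi> (exp_vec \<eta>) = ?f \<eta>"
    unfolding weyl_def[symmetric] weyl_scalar_def by blast+
qed

lemma cinner_weyl_right: "cinner a (weyl \<xi> b) = cinner (weyl (- \<xi>) a) b"
proof -
  have "cinner (weyl \<xi> (exp_vec \<eta>)) (exp_vec \<eta>') = cinner (exp_vec \<eta>) (weyl (- \<xi>) (exp_vec \<eta>'))" for \<eta> \<eta>' :: 'a
    by (simp add: weyl_exp_vec cinner_scaleC_left cinner_scaleC_right cinner_exp_vec weyl_scalar_def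
        exp_cnj exp_add[symmetric] cinner_add_left cinner_diff_right cinner_minus_right
        cinner_commute[of \<xi> \<eta>']) (simp add: algebra_simps)
  then have "cinner (cadjoint (weyl \<xi>) (exp_vec \<eta>')) (exp_vec \<eta>) = cinner (weyl (- \<xi>) (exp_vec \<eta>')) (exp_vec \<eta>)"
    for \<eta> \<eta>'
    by (simp add: cinner_cadjoint_left weyl_bounded_ops) (metis cinner_commute)
  then have "cadjoint (weyl \<xi>) (exp_vec \<eta>') = weyl (- \<xi>) (exp_vec \<eta>')" for \<eta>'
    by (intro eq_if_cinner_total[OF exp_vec_total]) auto
  then have "cadjoint (weyl \<xi>) = weyl (- \<xi>)"
    by (intro bounded_ops_eqI[OF _ _ exp_vec_total] cadjoint_bounded_ops weyl_bounded_ops) auto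
  then show ?thesis by (metis cinner_cadjoint_left weyl_bounded_ops)
qed

text \<open>At \<open>\<xi> = 0\<close>, \<open>z = 0\<close> the derivative is read off from the expansion
  \<open>e(h \<zeta>) = \<Omega> + h \<zeta> + O(|h|\<^sup>2)\<close>. A Weyl operator moves any other base point to \<open>0\<close>, at the cost of a
  holomorphic scalar factor.\<close>

lemma exp_vec_line_differentiable:
  fixes \<xi> \<zeta> :: "'h::chilbert_space"
  shows "\<exists>D. ((\<lambda>z. cinner (exp_vec (\<xi> + z *\<^sub>C \<zeta>)) w) has_field_derivative D) (at z)"
proof -
  define \<xi>' where "\<xi>' = \<xi> + z *\<^sub>C \<zeta>"
  define w' where "w' = weyl (- \<xi>') w"
  define D where "D = cinner (one_particle \<zeta>) w'"
  have at0: "((\<lambda>h. cinner (exp_vec (h *\<^sub>C \<zeta>)) w') has_field_derivative D) (at 0)"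
    unfolding has_field_derivative_iff
  proof (rule Lim_transform)
    show "((\<lambda>h. D) \<longlongrightarrow> D) (at 0)" by simp
    have "((\<lambda>h. norm (h *\<^sub>C \<zeta>)) \<longlongrightarrow> norm (0 *\<^sub>C \<zeta>)) (at 0)"
      unfolding norm_scaleC by (intro tendsto_intros)
    then have small: "\<forall>\<^sub>F h in at 0. norm (h *\<^sub>C \<zeta>) < 1"
      by (rule order_tendstoD) simp
    show "((\<lambda>h. (cinner (exp_vec (h *\<^sub>C \<zeta>)) w' - cinner (exp_vec (0 *\<^sub>C \<zeta>)) w') / (h - 0) - D) \<longlongrightarrow> 0) (at 0)"
    proof (rule Lim_null_comparison)
      have "((\<lambda>h. cmod h * ((norm \<zeta>)\<^sup>2 * norm w')) \<longlongrightarrow> cmod 0 * ((norm \<zeta>)\<^sup>2 * norm w')) (at 0)"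
        by (intro tendsto_intros)
      then show "((\<lambda>h. cmod h * ((norm \<zeta>)\<^sup>2 * norm w')) \<longlongrightarrow> 0) (at 0)" by simp
      show "\<forall>\<^sub>F h in at 0. cmod ((cinner (exp_vec (h *\<^sub>C \<zeta>)) w' - cinner (exp_vec (0 *\<^sub>C \<zeta>)) w') / (h - 0) - D)
        \<le> cmod h * ((norm \<zeta>)\<^sup>2 * norm w')"
        using small eventually_neq_at_within[of 0 0 UNIV]
      proof eventually_elim
        case (elim h)
        have "exp_vec (h *\<^sub>C \<zeta>) = exp_vec 0 + h *\<^sub>C one_particle \<zeta> + exp_remainder (h *\<^sub>C \<zeta>)"
          by (simp add: exp_remainder_def one_particle_scaleC)
        then have "(cinner (exp_vec (h *\<^sub>C \<zeta>)) w' - cinner (exp_vec (0 *\<^sub>C \<zeta>)) w') / (h - 0) - D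
          = cinner (exp_remainder (h *\<^sub>C \<zeta>)) w' / h"
          using elim by (simp add: D_def cinner_add_left cinner_scaleC_left field_simps)
        moreover have "cmod (cinner (exp_remainder (h *\<^sub>C \<zeta>)) w') \<le> (norm (h *\<^sub>C \<zeta>))\<^sup>2 * norm w'"
          using norm_exp_remainder_le[of "h *\<^sub>C \<zeta>"] elim
          by (intro order_trans[OF cmod_cinner_le] mult_right_mono) auto
        ultimately show ?case
          using elim by (simp add: norm_divide divide_le_eq power_mult_distrib power2_eq_square mult_ac)
      qed
    qed
  qed
  \<comment> \<open>\<open>W(\<xi>') e(h \<zeta>)\<close> equals \<open>e(\<xi>' + h \<zeta>)\<close> divided by this scalar\<close>
  define c where "c h = exp (complex_of_real ((norm \<xi>')\<^sup>2 / 2) + h * cinner \<zeta> \<xi>')" for h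
  have dc: "(c has_field_derivative (c 0 * cinner \<zeta> \<xi>')) (at 0)"
    unfolding c_def by (auto intro!: derivative_eq_intros)
  have eq: "cinner (exp_vec (\<xi> + (z + h) *\<^sub>C \<zeta>)) w = c h * cinner (exp_vec (h *\<^sub>C \<zeta>)) w'" for h
  proof -
    have "cinner (exp_vec (h *\<^sub>C \<zeta>)) w' = cinner (weyl \<xi>' (exp_vec (h *\<^sub>C \<zeta>))) w"
      unfolding w'_def by (simp add: cinner_weyl_right)
    also have "\<dots> = weyl_scalar \<xi>' (h *\<^sub>C \<zeta>) * cinner (exp_vec (\<xi>' + h *\<^sub>C \<zeta>)) w"
      by (simp add: weyl_exp_vec cinner_scaleC_left)
    finally have "c h * cinner (exp_vec (h *\<^sub>C \<zeta>)) w' = (c h * weyl_scalar \<xi>' (h *\<^sub>C \<zeta>)) * cinner (exp_vec (\<xi>' + h *\<^sub>C \<zeta>)) w"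
      by simp
    also have "c h * weyl_scalar \<xi>' (h *\<^sub>C \<zeta>) = 1"
      unfolding c_def weyl_scalar_def exp_add[symmetric] by (simp add: cinner_scaleC_left)
    finally show ?thesis by (simp add: \<xi>'_def scaleC_add_left add.assoc)
  qed
  have "((\<lambda>h. cinner (exp_vec (\<xi> + (z + h) *\<^sub>C \<zeta>)) w) has_field_derivative
      (c 0 * cinner \<zeta> \<xi>' * cinner (exp_vec (0 *\<^sub>C \<zeta>)) w' + D * c 0)) (at 0)"
    unfolding eq by (rule DERIV_mult[OF dc at0])
  then have "((\<lambda>z. cinner (exp_vec (\<xi> + z *\<^sub>C \<zeta>)) w) has_field_derivative
      (c 0 * cinner \<zeta> \<xi>' * cinner (exp_vec (0 *\<^sub>C \<zeta>)) w' + D * c 0)) (at (0 + z))"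
    unfolding DERIV_shift by (simp only: add.commute)
  then show ?thesis by auto
qed

text \<open>The real derivative is both complex linear and conjugate linear, hence zero.\<close>

lemma holomorphic_antiholomorphic_constant:
  fixes f :: "complex \<Rightarrow> complex"
  assumes f: "\<And>z. \<exists>D. (f has_field_derivative D) (at z)"
    and g: "\<And>z. \<exists>D. ((\<lambda>z. cnj (f z)) has_field_derivative D) (at z)"
  shows "f z = f 0"
proof -
  have "(f has_field_derivative 0) (at z)" for z
  proof -
    obtain D E where D: "(f has_field_derivative D) (at z)"
      and E: "((\<lambda>z. cnj (f z)) has_field_derivative E) (at z)" using f g by metis
    have "(f has_derivative (\<lambda>h. D * h)) (at z)" using D by (simp add: has_field_derivative_def)
    then have "((\<lambda>z. cnj (f z)) has_derivative (\<lambda>h. cnj (D * h))) (at z)"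
      by (rule bounded_linear.has_derivative[OF bounded_linear_cnj])
    moreover have "((\<lambda>z. cnj (f z)) has_derivative (\<lambda>h. E * h)) (at z)"
      using E by (simp add: has_field_derivative_def)
    ultimately have "(\<lambda>h. cnj (D * h)) = (\<lambda>h. E * h)" by (rule has_derivative_unique)
    from fun_cong[OF this, of 1] fun_cong[OF this, of \<i>] have "E = 0" by (simp add: complex_eq_iff)
    with fun_cong[OF \<open>(\<lambda>h. cnj (D * h)) = (\<lambda>h. E * h)\<close>, of 1] have "D = 0" by simp
    then show ?thesis using D by simp
  qed
  then have "f constant_on UNIV"
    by (intro has_field_derivative_0_imp_constant_on) auto
  then show ?thesis by (auto simp: constant_on_def)
qed

section \<open>Intertwiners of a normal endomorphism\<close>

text \<open>The rank one operator \<open>|a\<rangle>\<langle>b|\<close>.\<close>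

lift_definition ketbra :: "'k::complex_inner \<Rightarrow> 'k \<Rightarrow> 'k \<Rightarrow>\<^sub>L 'k" is "\<lambda>a b \<xi>. cinner \<xi> b *\<^sub>C a"
proof (rule bounded_linear_intro)
  fix a b x :: 'k
  show "norm (cinner x b *\<^sub>C a) \<le> norm x * (norm b * norm a)"
    using mult_right_mono[OF cmod_cinner_le[of x b], of "norm a"] by (simp add: mult_ac)
qed (simp_all add: cinner_add_left scaleC_add_left scaleR_scaleC cinner_scaleC_left scaleC_scaleC)

declare ketbra.rep_eq [simp]

lemma ketbra_bounded_ops: "ketbra a b \<in> bounded_ops"
  by (simp add: bounded_ops_def cinner_scaleC_left scaleC_scaleC)

lemma compose_ketbra: "A \<in> bounded_ops \<Longrightarrow> A o\<^sub>L ketbra a b = ketbra (A a) b"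
  by (rule blinfun_eqI) (simp add: bounded_opsD)

lemma ketbra_compose_ketbra: "ketbra a b o\<^sub>L ketbra c d = cinner c b *\<^sub>C ketbra a d"
  by (rule blinfun_eqI) (simp add: scaleC_blinfun.rep_eq cinner_scaleC_left scaleC_scaleC mult.commute)

lemma cadjoint_ketbra: "cadjoint (ketbra a b) = ketbra b (a::'k::chilbert_space)"
proof (rule cadjoint_eqI[OF ketbra_bounded_ops ketbra_bounded_ops])
  show "cinner (ketbra a b \<xi>) \<eta> = cinner \<xi> (ketbra b a \<eta>)" for \<xi> \<eta>
    using cinner_commute[of a \<eta>] by (simp add: cinner_scaleC_left cinner_scaleC_right mult.commute)
qed

lemma subspace_bounded_ops: "complex_vector.subspace (bounded_ops :: ('k::complex_inner \<Rightarrow>\<^sub>L 'k) set)"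
  by (rule complex_vector.subspaceI) (auto intro: bounded_ops_zero bounded_ops_add bounded_ops_scaleC)

lemma sum_ketbra_bounded_ops: "(\<Sum>b\<in>F. ketbra b b) \<in> bounded_ops"
  by (rule complex_vector.subspace_sum[OF subspace_bounded_ops]) (rule ketbra_bounded_ops)

lemma suminf_head: "(\<Sum>n. if n = 0 then (c::complex) else 0) = c"
  using suminf_finite[of "{0::nat}" "\<lambda>n. if n = 0 then c else 0"] by simp

text \<open>On each subbasic functional \<open>A \<mapsto> \<Sum>\<^sub>n \<langle>A \<xi>\<^sub>n|\<eta>\<^sub>n\<rangle>\<close> the convergence is termwise, and the terms are
  dominated by the summable \<open>\<parallel>\<xi>\<^sub>n\<parallel>\<^sup>2 + \<parallel>\<eta>\<^sub>n\<parallel>\<^sup>2\<close>, so Tannery's theorem applies.\<close>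

lemma finite_rank_projections_sigma_weak:
  "limitin sigma_weak_topology (\<lambda>F. \<Sum>b\<in>F. ketbra b b) (id_blinfun :: 'k::chilbert_space \<Rightarrow>\<^sub>L 'k)
     (finite_subsets_at_top onb)"
proof -
  let ?p = "\<lambda>F::'k set. \<Sum>b\<in>F. ketbra b b" and ?L = "finite_subsets_at_top (onb :: 'k set)"
  let ?B = "{{A \<in> bounded_ops. (\<Sum>n. cinner (blinfun_apply A (\<xi> n)) (\<eta> n)) \<in> U} | (\<xi> :: nat \<Rightarrow> 'k) \<eta> U.
       summable (\<lambda>n. (norm (\<xi> n))\<^sup>2) \<and> summable (\<lambda>n. (norm (\<eta> n))\<^sup>2) \<and> open U}"
  have p_apply: "?p F x = (\<Sum>b\<in>F. cinner x b *\<^sub>C b)" for F x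
    by (simp add: blinfun.sum_left)
  have p_tendsto: "((\<lambda>F. ?p F x) \<longlongrightarrow> x) ?L" for x
    using onb_expansion[OF is_onb_onb, of x] unfolding p_apply has_sum_def .
  have p_norm: "norm (?p F x) \<le> norm x" if F: "finite F" "F \<subseteq> onb" for F x
  proof -
    have n: "norm b = 1" if "b \<in> F" for b using is_onb_onb that F(2) unfolding is_onb_def by blast
    have o: "cinner b c = 0" if "b \<in> F" "c \<in> F" "b \<noteq> c" for b c
      using is_onb_onb that F(2) unfolding is_onb_def by blast
    have "(norm (?p F x))\<^sup>2 = (\<Sum>b\<in>F. (cmod (cinner x b))\<^sup>2)"
      unfolding p_apply by (rule norm_orthonormal_sum[OF F(1) n o])
    also have "\<dots> \<le> (norm x)\<^sup>2" by (rule bessel[OF F(1) n o])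
    finally show ?thesis by (rule power2_le_imp_le) simp
  qed
  have fin: "\<forall>\<^sub>F F in ?L. finite F \<and> F \<subseteq> onb"
    unfolding eventually_finite_subsets_at_top by (intro exI[of _ "{}"]) auto
  have ev: "\<forall>\<^sub>F F in ?L. ?p F \<in> X" if X: "X \<in> ?B" "id_blinfun \<in> X" for X
  proof -
    obtain \<xi> \<eta> :: "nat \<Rightarrow> 'k" and U where XU: "X = {A \<in> bounded_ops. (\<Sum>n. cinner (blinfun_apply A (\<xi> n)) (\<eta> n)) \<in> U}"
      and sm: "summable (\<lambda>n. (norm (\<xi> n))\<^sup>2)" "summable (\<lambda>n. (norm (\<eta> n))\<^sup>2)" and U: "open U"
      using X(1) by blast
    let ?M = "\<lambda>n. (norm (\<xi> n))\<^sup>2 + (norm (\<eta> n))\<^sup>2"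
    have "\<forall>\<^sub>F (n, F) in sequentially \<times>\<^sub>F ?L. norm (cinner (?p F (\<xi> n)) (\<eta> n)) \<le> ?M n"
      unfolding eventually_prod_filter
    proof (intro exI conjI allI impI)
      show "\<forall>\<^sub>F n in sequentially. True" by simp
      show "\<forall>\<^sub>F F in ?L. finite F \<and> F \<subseteq> onb" by (rule fin)
      fix n F assume F: "finite F \<and> F \<subseteq> (onb :: 'k set)"
      have "cmod (cinner (?p F (\<xi> n)) (\<eta> n)) \<le> norm (\<xi> n) * norm (\<eta> n)"
        using F by (intro order_trans[OF cmod_cinner_le] mult_right_mono p_norm) auto
      also have "\<dots> \<le> ?M n"
        using zero_le_power2[of "norm (\<xi> n) - norm (\<eta> n)"] zero_le_power2[of "norm (\<xi> n)"]
          zero_le_power2[of "norm (\<eta> n)"] unfolding power2_diff by linarith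
      finally show "case (n, F) of (n, F) \<Rightarrow> norm (cinner (?p F (\<xi> n)) (\<eta> n)) \<le> ?M n" by simp
    qed
    then have "((\<lambda>F. \<Sum>n. cinner (?p F (\<xi> n)) (\<eta> n)) \<longlongrightarrow> (\<Sum>n. cinner (\<xi> n) (\<eta> n))) ?L"
      using tannerys_theorem[of "\<lambda>n F. cinner (?p F (\<xi> n)) (\<eta> n)" "\<lambda>n. cinner (\<xi> n) (\<eta> n)" ?L ?M]
        tendsto_cinner_left[OF p_tendsto] summable_add[OF sm] by simp
    moreover have "(\<Sum>n. cinner (\<xi> n) (\<eta> n)) \<in> U" using X(2) by (simp add: XU)
    ultimately have "\<forall>\<^sub>F F in ?L. (\<Sum>n. cinner (?p F (\<xi> n)) (\<eta> n)) \<in> U"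
      using U topological_tendstoD by blast
    then show ?thesis by (rule eventually_mono) (simp add: XU sum_ketbra_bounded_ops)
  qed
  have "\<forall>\<^sub>F F in ?L. ?p F \<in> X" if "generate_topology_on ?B X" "id_blinfun \<in> X" for X
    using that
  proof (induction rule: generate_topology_on.induct)
    case (Int a b)
    then show ?case by (simp add: eventually_conj_iff)
  next
    case (UN K)
    then obtain k where k: "k \<in> K" "id_blinfun \<in> k" by blast
    then have "\<forall>\<^sub>F F in ?L. ?p F \<in> k" using UN by blast
    then show ?case by (rule eventually_mono) (use k in blast)
  next
    case (Basis s)
    then show ?case by (rule ev)
  qed simp
  moreover have "id_blinfun \<in> topspace (sigma_weak_topology :: ('k \<Rightarrow>\<^sub>L 'k) topology)"
  proof -
    have "bounded_ops \<in> ?B"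
      by (intro CollectI exI[of _ "\<lambda>_. 0"] exI[of _ UNIV]) auto
    then show ?thesis using bounded_ops_id unfolding sigma_weak_topology_def topology_generated_by_topspace by blast
  qed
  ultimately show ?thesis
    unfolding limitin_def sigma_weak_topology_def openin_topology_generated_by_iff by blast
qed

text \<open>The fibre of a product system, as a function of a single endomorphism.\<close>

definition intertwiners :: "(('k::chilbert_space \<Rightarrow>\<^sub>L 'k) \<Rightarrow> ('k \<Rightarrow>\<^sub>L 'k)) \<Rightarrow> ('k \<Rightarrow>\<^sub>L 'k) set" where
  "intertwiners \<theta> = {T \<in> bounded_ops. \<forall>A\<in>bounded_ops. \<theta> A o\<^sub>L T = T o\<^sub>L A}"

lemma product_system_eq_intertwiners: "product_system \<alpha> x = intertwiners (\<alpha> x)"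
  by (simp add: product_system_def intertwiners_def)

lemma intertwinersD:
  assumes "T \<in> intertwiners \<theta>"
  shows "T \<in> bounded_ops" "A \<in> bounded_ops \<Longrightarrow> \<theta> A (T x) = T (A x)"
proof -
  show "T \<in> bounded_ops" using assms by (simp add: intertwiners_def)
  assume "A \<in> bounded_ops"
  then have "\<theta> A o\<^sub>L T = T o\<^sub>L A" using assms by (simp add: intertwiners_def)
  from arg_cong[OF this, of "\<lambda>B. blinfun_apply B x"] show "\<theta> A (T x) = T (A x)" by simp
qed

lemma intertwiners_iff:
  "T \<in> intertwiners \<theta> \<longleftrightarrow> T \<in> bounded_ops \<and> (\<forall>A\<in>bounded_ops. \<forall>x. \<theta> A (T x) = T (A x))"
  using intertwinersD[of T \<theta>] by (auto simp: intertwiners_def intro!: blinfun_eqI)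

lemma subspace_intertwiners:
  assumes "\<And>A. A \<in> bounded_ops \<Longrightarrow> \<theta> A \<in> bounded_ops"
  shows "complex_vector.subspace (intertwiners \<theta>)"
  by (rule complex_vector.subspaceI)
     (simp_all add: intertwiners_iff bounded_ops_zero bounded_ops_add bounded_ops_scaleC blinfun.add_left
        blinfun.add_right scaleC_blinfun.rep_eq bounded_opsD assms)

locale normal_endomorphism =
  fixes \<theta> :: "('k::chilbert_space \<Rightarrow>\<^sub>L 'k) \<Rightarrow> ('k \<Rightarrow>\<^sub>L 'k)"
  assumes endo: "unital_normal_star_endomorphism \<theta>"
begin

lemma
  shows endo_bounded_ops: "A \<in> bounded_ops \<Longrightarrow> \<theta> A \<in> bounded_ops"
    and endo_add: "A \<in> bounded_ops \<Longrightarrow> B \<in> bounded_ops \<Longrightarrow> \<theta> (A + B) = \<theta> A + \<theta> B"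
    and endo_scaleC: "A \<in> bounded_ops \<Longrightarrow> \<theta> (c *\<^sub>C A) = c *\<^sub>C \<theta> A"
    and endo_compose: "A \<in> bounded_ops \<Longrightarrow> B \<in> bounded_ops \<Longrightarrow> \<theta> (A o\<^sub>L B) = \<theta> A o\<^sub>L \<theta> B"
    and endo_cadjoint: "A \<in> bounded_ops \<Longrightarrow> \<theta> (cadjoint A) = cadjoint (\<theta> A)"
    and endo_id: "\<theta> id_blinfun = id_blinfun"
    and endo_continuous: "continuous_map sigma_weak_topology sigma_weak_topology \<theta>"
  using endo unfolding unital_normal_star_endomorphism_def by blast+

lemma endo_sum_ketbra: "\<theta> (\<Sum>b\<in>F. ketbra b b) = (\<Sum>b\<in>F. \<theta> (ketbra b b))"
proof -
  have "\<theta> 0 = 0" using endo_add[OF bounded_ops_zero bounded_ops_zero] by simp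
  then show ?thesis
    by (induction F rule: infinite_finite_induct)
       (auto simp: endo_add ketbra_bounded_ops sum_ketbra_bounded_ops)
qed

lemma cinner_endo_ketbra: "cinner (\<theta> (ketbra a b) x) y = cinner x (\<theta> (ketbra b a) y)"
  using cinner_cadjoint_right[of "\<theta> (ketbra a b)" x y]
  by (simp add: endo_bounded_ops ketbra_bounded_ops endo_cadjoint[symmetric] cadjoint_ketbra)

lemma endo_ketbra_ketbra: "\<theta> (ketbra a b) (\<theta> (ketbra c d) x) = cinner c b *\<^sub>C \<theta> (ketbra a d) x"
proof -
  have "\<theta> (ketbra a b) (\<theta> (ketbra c d) x) = (\<theta> (ketbra a b) o\<^sub>L \<theta> (ketbra c d)) x" by simp
  also have "\<theta> (ketbra a b) o\<^sub>L \<theta> (ketbra c d) = cinner c b *\<^sub>C \<theta> (ketbra a d)"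
    by (simp only: endo_compose[symmetric] ketbra_bounded_ops ketbra_compose_ketbra endo_scaleC)
  finally show ?thesis by (simp add: scaleC_blinfun.rep_eq)
qed

text \<open>Normality enters here: it carries the convergence of the finite rank projections through \<open>\<theta>\<close>.\<close>

lemma endo_finite_rank_tendsto:
  "((\<lambda>F. cinner (\<theta> (\<Sum>b\<in>F. ketbra b b) x) y) \<longlongrightarrow> cinner x y) (finite_subsets_at_top onb)"
proof (rule topological_tendstoI)
  fix U assume U: "open U" "cinner x y \<in> U"
  define \<xi> \<eta> where "\<xi> n = (if n = 0 then x else 0)" and "\<eta> n = (if n = 0 then y else 0)" for n :: nat
  let ?X = "{A \<in> bounded_ops. (\<Sum>n. cinner (blinfun_apply A (\<xi> n)) (\<eta> n)) \<in> U}"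
  have ser: "(\<Sum>n. cinner (blinfun_apply A (\<xi> n)) (\<eta> n)) = cinner (A x) y" for A
  proof -
    have "(\<lambda>n. cinner (blinfun_apply A (\<xi> n)) (\<eta> n)) = (\<lambda>n. if n = 0 then cinner (A x) y else 0)"
      by (auto simp: \<xi>_def \<eta>_def)
    then show ?thesis by (simp only: suminf_head)
  qed
  have "summable (\<lambda>n. (norm (\<xi> n))\<^sup>2)" "summable (\<lambda>n. (norm (\<eta> n))\<^sup>2)"
    by (rule summable_finite[of "{0}"]; simp add: \<xi>_def \<eta>_def)+
  then have "openin sigma_weak_topology ?X"
    unfolding sigma_weak_topology_def using U(1) by (intro topology_generated_by_Basis) blast
  moreover have "id_blinfun \<in> ?X" using U(2) by (simp add: ser bounded_ops_id)
  moreover have "limitin sigma_weak_topology (\<theta> \<circ> (\<lambda>F. \<Sum>b\<in>F. ketbra b b)) (\<theta> id_blinfun)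
      (finite_subsets_at_top onb)"
    by (rule continuous_map_limit[OF endo_continuous finite_rank_projections_sigma_weak])
  ultimately have "\<forall>\<^sub>F F in finite_subsets_at_top onb. \<theta> (\<Sum>b\<in>F. ketbra b b) \<in> ?X"
    unfolding limitin_def endo_id o_def by blast
  then show "\<forall>\<^sub>F F in finite_subsets_at_top onb. cinner (\<theta> (\<Sum>b\<in>F. ketbra b b) x) y \<in> U"
    by (rule eventually_mono) (simp add: ser)
qed

text \<open>An intertwiner is determined by its value at one unit vector \<open>h\<close>, since \<open>|a\<rangle>\<langle>h|\<close> moves \<open>h\<close> to \<open>a\<close>.\<close>

lemma intertwiner_apply:
  assumes "T \<in> intertwiners \<theta>" "norm h = 1"
  shows "T a = \<theta> (ketbra a h) (T h)"
  using intertwinersD[OF assms(1)] ketbra_bounded_ops[of a h] assms(2)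
  by (simp add: cinner_self scaleC_one)

text \<open>This is the scalar identity \<open>T\<^sup>* S = \<langle>S|T\<rangle> 1\<close> of the product system, in weak form: the inner product
  of the fibre is computed at any one unit vector \<open>h\<close>.\<close>

lemma cinner_intertwiners:
  assumes S: "S \<in> intertwiners \<theta>" and T: "T \<in> intertwiners \<theta>" and h: "norm h = 1"
  shows "cinner (S a) (T b) = cinner (S h) (T h) * cinner a b"
proof -
  have "cinner (S a) (T b) = cinner (\<theta> (ketbra a h) (S h)) (\<theta> (ketbra b h) (T h))"
    by (simp only: intertwiner_apply[OF S h, of a] intertwiner_apply[OF T h, of b])
  also have "\<dots> = cinner (\<theta> (ketbra h b) (\<theta> (ketbra a h) (S h))) (T h)"
    by (simp only: cinner_endo_ketbra[of h b])
  also have "\<dots> = cinner a b * cinner (\<theta> (ketbra h h) (S h)) (T h)"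
    by (simp only: endo_ketbra_ketbra cinner_scaleC_left)
  finally show ?thesis by (simp add: intertwiner_apply[OF S h, of h, symmetric])
qed

text \<open>Conversely every vector \<open>v\<close> yields an intertwiner; its value at \<open>h\<close> is \<open>\<theta>(|h\<rangle>\<langle>h|) v\<close>.
  Boundedness comes from \<open>|a\<rangle>\<langle>h|\<^sup>* |a\<rangle>\<langle>h| = \<parallel>a\<parallel>\<^sup>2 |h\<rangle>\<langle>h|\<close>.\<close>

lemma intertwiner_from_vector:
  assumes h: "norm h = 1"
  obtains T where "T \<in> intertwiners \<theta>" "\<And>a. blinfun_apply T a = \<theta> (ketbra a h) v"
proof -
  define K where "K = sqrt (norm (\<theta> (ketbra h h) v) * norm v)"
  have "\<exists>T\<in>bounded_ops. blinfun_apply T = (\<lambda>a. \<theta> (ketbra a h) v)"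
  proof (rule bounded_opsI)
    show "\<theta> (ketbra (x + y) h) v = \<theta> (ketbra x h) v + \<theta> (ketbra y h) v" for x y
    proof -
      have "ketbra (x + y) h = ketbra x h + ketbra y h"
        by (rule blinfun_eqI) (simp add: blinfun.add_left scaleC_add_right)
      then show ?thesis by (simp add: endo_add ketbra_bounded_ops blinfun.add_left)
    qed
    show "\<theta> (ketbra (c *\<^sub>C x) h) v = c *\<^sub>C \<theta> (ketbra x h) v" for c x
    proof -
      have "ketbra (c *\<^sub>C x) h = c *\<^sub>C ketbra x h"
        by (rule blinfun_eqI) (simp add: scaleC_blinfun.rep_eq scaleC_scaleC mult.commute)
      then show ?thesis by (simp add: endo_scaleC ketbra_bounded_ops scaleC_blinfun.rep_eq)
    qed
    show "norm (\<theta> (ketbra x h) v) \<le> norm x * K" for x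
    proof (rule power2_le_imp_le)
      have "complex_of_real ((norm (\<theta> (ketbra x h) v))\<^sup>2) = cinner (\<theta> (ketbra h x) (\<theta> (ketbra x h) v)) v"
        by (simp only: cinner_self[symmetric] cinner_endo_ketbra[of h x])
      also have "\<dots> = complex_of_real ((norm x)\<^sup>2) * cinner (\<theta> (ketbra h h) v) v"
        by (simp only: endo_ketbra_ketbra cinner_scaleC_left cinner_self)
      finally have "(norm (\<theta> (ketbra x h) v))\<^sup>2 = cmod (complex_of_real ((norm x)\<^sup>2) * cinner (\<theta> (ketbra h h) v) v)"
        by (metis abs_power2 norm_of_real)
      also have "\<dots> \<le> (norm x)\<^sup>2 * (norm (\<theta> (ketbra h h) v) * norm v)"
        unfolding norm_mult norm_of_real by (intro mult_mono cmod_cinner_le) auto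
      finally show "(norm (\<theta> (ketbra x h) v))\<^sup>2 \<le> (norm x * K)\<^sup>2"
        by (simp add: K_def power_mult_distrib)
    qed (simp add: K_def)
  qed
  then obtain T where T: "T \<in> bounded_ops" "\<And>a. blinfun_apply T a = \<theta> (ketbra a h) v" by metis
  have "\<theta> A o\<^sub>L T = T o\<^sub>L A" if A: "A \<in> bounded_ops" for A
  proof (rule blinfun_eqI)
    fix a
    have "\<theta> A (\<theta> (ketbra a h) v) = (\<theta> A o\<^sub>L \<theta> (ketbra a h)) v" by simp
    also have "\<dots> = \<theta> (ketbra (A a) h) v"
      by (simp only: endo_compose[symmetric] A ketbra_bounded_ops compose_ketbra)
    finally show "(\<theta> A o\<^sub>L T) a = (T o\<^sub>L A) a" by (simp add: T(2))
  qed
  then have "T \<in> intertwiners \<theta>" using T(1) by (simp add: intertwiners_def)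
  then show ?thesis using that T(2) by blast
qed

text \<open>For a basis vector \<open>b\<close>, the vector \<open>\<theta>(|b\<rangle>\<langle>b|) r = \<theta>(|b\<rangle>\<langle>h|) \<theta>(|h\<rangle>\<langle>b|) r\<close> lies in the range of an
  intertwiner. Summing over finite sets of basis vectors and passing to the limit recovers \<open>r\<close>.\<close>

lemma intertwiner_ranges_total:
  assumes h: "norm (h::'k) = 1" and r: "\<And>T a. T \<in> intertwiners \<theta> \<Longrightarrow> cinner r (T a) = 0"
  shows "r = 0"
proof -
  have "cinner (\<theta> (ketbra b b) r) r = 0" for b
  proof -
    obtain T where T: "T \<in> intertwiners \<theta>" "\<And>a. blinfun_apply T a = \<theta> (ketbra a h) (\<theta> (ketbra h b) r)"
      using intertwiner_from_vector[OF h] by blast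
    have "T b = \<theta> (ketbra b b) r"
      using h by (simp add: T(2) endo_ketbra_ketbra cinner_self scaleC_one)
    then show ?thesis using r[OF T(1), of b] cinner_commute[of "T b" r] by simp
  qed
  then have "cinner (\<theta> (\<Sum>b\<in>F. ketbra b b) r) r = 0" for F
    by (simp add: endo_sum_ketbra blinfun.sum_left cinner_sum_left)
  then have "cinner r r = 0"
    using endo_finite_rank_tendsto[of r r] by (simp add: tendsto_const_iff)
  then show ?thesis by (simp add: cinner_eq_zero_self)
qed

end

section \<open>Exponential intertwiners\<close>

lemma norm_vacuum: "norm (exp_vec (0::'h::chilbert_space)) = 1"
  using norm_exp_vec_sq[of "0::'h"] by (simp add: power2_eq_1_iff) (metis norm_ge_zero not_one_le_zero neg_0_le_iff_le)

lemma weyl_vacuum: "weyl \<eta> (exp_vec 0) = complex_of_real (exp (- (norm \<eta>)\<^sup>2 / 2)) *\<^sub>C exp_vec \<eta>"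
  by (simp add: weyl_exp_vec weyl_scalar_def exp_of_real[symmetric])

locale weyl_endomorphism = normal_endomorphism \<theta>
  for \<theta> :: "('h::chilbert_space fock \<Rightarrow>\<^sub>L 'h fock) \<Rightarrow> ('h fock \<Rightarrow>\<^sub>L 'h fock)" +
  fixes U :: "'h \<Rightarrow>\<^sub>L 'h"
  assumes U_bounded_ops: "U \<in> bounded_ops"
    and norm_U: "norm (U \<xi>) = norm \<xi>"
    and endo_weyl: "\<theta> (weyl \<xi>) = weyl (U \<xi>)"
begin

abbreviation defect :: "'h set" where
  "defect \<equiv> {\<xi>. cadjoint U \<xi> = 0}"

lemma cinner_defect: "\<xi> \<in> defect \<Longrightarrow> cinner \<xi> (U \<eta>) = 0"
  using cinner_cadjoint_left[OF U_bounded_ops, of \<xi> \<eta>] by simp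

text \<open>The intertwining relation for Weyl operators, applied to \<open>\<Omega>\<close>.\<close>

lemma intertwiner_exp_vec:
  assumes T: "T \<in> intertwiners \<theta>"
  shows "complex_of_real (exp (- (norm \<eta>)\<^sup>2 / 2)) *\<^sub>C T (exp_vec \<eta>) = weyl (U \<eta>) (T (exp_vec 0))"
proof -
  have "weyl (U \<eta>) (T (exp_vec 0)) = T (weyl \<eta> (exp_vec 0))"
    using intertwinersD(2)[OF T weyl_bounded_ops] by (simp add: endo_weyl)
  then show ?thesis by (simp add: weyl_vacuum bounded_opsD[OF intertwinersD(1)[OF T]])
qed

lemma weyl_defect:
  assumes "\<xi> \<in> defect"
  shows "weyl (U \<eta>) (exp_vec \<xi>) = complex_of_real (exp (- (norm \<eta>)\<^sup>2 / 2)) *\<^sub>C exp_vec (\<xi> + U \<eta>)"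
  using cinner_defect[OF assms, of \<eta>]
  by (simp add: weyl_exp_vec weyl_scalar_def norm_U exp_of_real[symmetric] add.commute)

text \<open>In other words, \<open>T\<^sup>* e(\<xi>)\<close> is a multiple of the vacuum. Weyl covariance turns \<open>\<langle>e(\<xi>)|T e(\<eta>)\<rangle>\<close>, which is
  antiholomorphic along complex lines in \<open>\<eta>\<close>, into \<open>\<langle>e(\<xi> - U \<eta>)|T \<Omega>\<rangle>\<close>, which is holomorphic. Both are
  therefore constant.\<close>

lemma cinner_exp_vec_intertwiner:
  assumes \<xi>: "\<xi> \<in> defect" and T: "T \<in> intertwiners \<theta>"
  shows "cinner (exp_vec \<xi>) (T a) = cinner (exp_vec \<xi>) (T (exp_vec 0)) * cinner (exp_vec 0) a"
proof -
  have Tb: "T \<in> bounded_ops" by (rule intertwinersD(1)[OF T])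
  have shift: "cinner (exp_vec \<xi>) (T (exp_vec \<eta>)) = cinner (exp_vec (\<xi> - U \<eta>)) (T (exp_vec 0))" for \<eta>
  proof -
    let ?s = "complex_of_real (exp (- (norm \<eta>)\<^sup>2 / 2))"
    have "?s * cinner (exp_vec \<xi>) (T (exp_vec \<eta>)) = cinner (exp_vec \<xi>) (?s *\<^sub>C T (exp_vec \<eta>))"
      by (simp add: cinner_scaleC_right)
    also have "\<dots> = cinner (weyl (U (- \<eta>)) (exp_vec \<xi>)) (T (exp_vec 0))"
      unfolding intertwiner_exp_vec[OF T] by (simp add: cinner_weyl_right blinfun.minus_right)
    also have "\<dots> = ?s * cinner (exp_vec (\<xi> - U \<eta>)) (T (exp_vec 0))"
      unfolding weyl_defect[OF \<xi>] by (simp add: cinner_scaleC_left blinfun.minus_right)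
    finally show ?thesis by simp
  qed
  have const: "cinner (exp_vec \<xi>) (T (exp_vec \<eta>)) = cinner (exp_vec \<xi>) (T (exp_vec 0))" for \<eta>
  proof -
    \<comment> \<open>the restriction to the complex line through \<open>\<eta>\<close>\<close>
    define f where "f z = cinner (exp_vec (\<xi> + z *\<^sub>C (- U \<eta>))) (T (exp_vec 0))" for z
    have f_eq: "f z = cinner (exp_vec \<xi>) (T (exp_vec (0 + z *\<^sub>C \<eta>)))" for z
      unfolding f_def using shift[of "z *\<^sub>C \<eta>"] by (simp add: bounded_opsD[OF U_bounded_ops])
    have "cnj (f z) = cinner (exp_vec (0 + z *\<^sub>C \<eta>)) (cadjoint T (exp_vec \<xi>))" for z
      unfolding f_eq cinner_cadjoint_right[OF Tb] by (rule cinner_commute[symmetric])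
    then have "\<exists>D. ((\<lambda>z. cnj (f z)) has_field_derivative D) (at z)" for z
      using exp_vec_line_differentiable[of 0 \<eta>] by simp
    moreover have "\<exists>D. (f has_field_derivative D) (at z)" for z
      unfolding f_def by (rule exp_vec_line_differentiable)
    ultimately have "f 1 = f 0" by (intro holomorphic_antiholomorphic_constant)
    then show ?thesis unfolding f_eq by (simp add: scaleC_one)
  qed
  have "cadjoint T (exp_vec \<xi>) = cinner (exp_vec \<xi>) (T (exp_vec 0)) *\<^sub>C exp_vec 0"
  proof (rule eq_if_cinner_total[OF exp_vec_total])
    fix b assume "b \<in> range (exp_vec :: 'h \<Rightarrow> _)"
    then obtain \<eta> where "b = exp_vec \<eta>" by blast
    then show "cinner (cadjoint T (exp_vec \<xi>)) b = cinner (cinner (exp_vec \<xi>) (T (exp_vec 0)) *\<^sub>C exp_vec 0) b"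
      by (simp add: cinner_cadjoint_left[OF Tb] const[of \<eta>] cinner_scaleC_left cinner_exp_vec)
  qed
  then show ?thesis
    using cinner_cadjoint_left[OF Tb, of "exp_vec \<xi>" a] by (simp add: cinner_scaleC_left)
qed

text \<open>The candidate is the intertwiner that the vector \<open>e(\<xi>)\<close> induces. Its value at the vacuum is
  \<open>\<theta>(|\<Omega>\<rangle>\<langle>\<Omega>|) e(\<xi>)\<close>, and the difference from \<open>e(\<xi>)\<close> is orthogonal to the ranges of all intertwiners.
  The values at the other exponential vectors follow by Weyl covariance.\<close>

lemma exponential_intertwiner_exists:
  assumes \<xi>: "\<xi> \<in> defect"
  shows "\<exists>T\<in>intertwiners \<theta>. \<forall>\<eta>. T (exp_vec \<eta>) = exp_vec (\<xi> + U \<eta>)"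
proof -
  let ?h = "exp_vec (0::'h)"
  obtain T where T: "T \<in> intertwiners \<theta>" "\<And>a. blinfun_apply T a = \<theta> (ketbra a ?h) (exp_vec \<xi>)"
    using intertwiner_from_vector[OF norm_vacuum] by blast
  have "exp_vec \<xi> - T ?h = 0"
  proof (rule intertwiner_ranges_total[OF norm_vacuum])
    fix S a assume S: "S \<in> intertwiners \<theta>"
    have "cinner (T ?h) (S ?h) = cinner (exp_vec \<xi>) (\<theta> (ketbra ?h ?h) (S ?h))"
      unfolding T(2) by (rule cinner_endo_ketbra)
    also have "\<theta> (ketbra ?h ?h) (S ?h) = S ?h"
      by (rule intertwiner_apply[OF S norm_vacuum, symmetric])
    finally have "cinner (T ?h) (S a) = cinner (exp_vec \<xi>) (S ?h) * cinner ?h a"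
      by (simp add: cinner_intertwiners[OF T(1) S norm_vacuum, of ?h a])
    then show "cinner (exp_vec \<xi> - T ?h) (S a) = 0"
      by (simp add: cinner_diff_left cinner_exp_vec_intertwiner[OF \<xi> S, of a])
  qed
  then have Th: "T ?h = exp_vec \<xi>" by simp
  have "T (exp_vec \<eta>) = exp_vec (\<xi> + U \<eta>)" for \<eta>
    using intertwiner_exp_vec[OF T(1), of \<eta>] unfolding Th weyl_defect[OF \<xi>]
    by (simp add: complex_vector.scale_left_imp_eq)
  then show ?thesis using T(1) by blast
qed

end

section \<open>Factorizing functions on a continuous chain of projections\<close>

text \<open>A factor \<open>1 + a + \<rho>\<close> differs from \<open>exp a\<close> by a first order error in \<open>\<rho>\<close> and a second order error in \<open>a\<close>.\<close>

lemma cmod_one_plus_mult_exp_minus_le: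
  assumes "cmod a \<le> N"
  shows "cmod ((1 + a + \<rho>) * exp (- a) - 1) \<le> exp N * cmod \<rho> + exp (2 * N) * (cmod a)\<^sup>2"
proof -
  have re: "\<bar>Re a\<bar> \<le> N" using abs_Re_le_cmod[of a] assms by linarith
  have ea: "cmod (exp (- a)) \<le> exp N" using re by simp
  have "cmod (exp a - (\<Sum>k\<le>1. a ^ k / fact k)) \<le> exp \<bar>Re a\<bar> * (cmod a ^ Suc 1) / fact 1"
    by (rule Taylor_exp)
  then have "cmod (exp a - (1 + a)) \<le> exp \<bar>Re a\<bar> * (cmod a)\<^sup>2"
    by (simp add: power2_eq_square)
  also have "\<dots> \<le> exp N * (cmod a)\<^sup>2" using re by (intro mult_right_mono) auto
  finally have t: "cmod (1 + a - exp a) \<le> exp N * (cmod a)\<^sup>2" by (simp add: norm_minus_commute)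
  have "(1 + a + \<rho>) * exp (- a) - 1 = \<rho> * exp (- a) + (1 + a - exp a) * exp (- a)"
    by (simp add: algebra_simps exp_add[symmetric])
  then have "cmod ((1 + a + \<rho>) * exp (- a) - 1) \<le> cmod \<rho> * cmod (exp (- a)) + cmod (1 + a - exp a) * cmod (exp (- a))"
    using norm_triangle_ineq[of "\<rho> * exp (- a)" "(1 + a - exp a) * exp (- a)"] by (simp only: norm_mult)
  also have "\<dots> \<le> cmod \<rho> * exp N + (exp N * (cmod a)\<^sup>2) * exp N"
    by (intro add_mono mult_mono ea t order_refl) (simp_all del: norm_exp_eq_Re)
  also have "\<dots> = exp N * cmod \<rho> + exp (2 * N) * (cmod a)\<^sup>2"
    unfolding exp_double by (simp add: power2_eq_square mult_ac)
  finally show ?thesis .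
qed

text \<open>A decreasing chain of projections, continuous in the parameter and running from the identity to an
  operator that vanishes on \<open>L\<close>. The intended instance is \<open>r t = V\<^bsub>t x\<^esub> V\<^bsub>t x\<^esub>\<^sup>*\<close> on \<open>L = Ker V\<^sub>x\<^sup>*\<close>; then
  \<open>\<zeta> - r t \<zeta>\<close> is the part of \<open>\<zeta>\<close> that lives before time \<open>t\<close>.\<close>

locale projection_chain =
  fixes r :: "real \<Rightarrow> 'h::chilbert_space \<Rightarrow> 'h" and L :: "'h set"
  assumes subspace_L: "complex_vector.subspace L"
    and r_mem: "\<zeta> \<in> L \<Longrightarrow> t \<in> {0..1} \<Longrightarrow> r t \<zeta> \<in> L"
    and r_add: "t \<in> {0..1} \<Longrightarrow> r t (\<zeta> + \<eta>) = r t \<zeta> + r t \<eta>"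
    and r_r: "s \<in> {0..1} \<Longrightarrow> t \<in> {0..1} \<Longrightarrow> r s (r t \<zeta>) = r (max s t) \<zeta>"
    and r_selfadjoint: "t \<in> {0..1} \<Longrightarrow> cinner (r t \<zeta>) \<eta> = cinner \<zeta> (r t \<eta>)"
    and r_0: "r 0 \<zeta> = \<zeta>"
    and r_1: "\<zeta> \<in> L \<Longrightarrow> r 1 \<zeta> = 0"
    and r_continuous: "e > 0 \<Longrightarrow> \<exists>d>0. \<forall>s\<in>{0..1}. \<forall>t\<in>{0..1}. \<bar>s - t\<bar> < d \<longrightarrow> norm (r s \<zeta> - r t \<zeta>) < e"
begin

lemma r_diff: "t \<in> {0..1} \<Longrightarrow> r t (\<zeta> - \<eta>) = r t \<zeta> - r t \<eta>"
  using r_add[of t "\<zeta> - \<eta>" \<eta>] by simp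

lemma r_zero: "t \<in> {0..1} \<Longrightarrow> r t 0 = 0"
  using r_diff[of t 0 0] by simp

lemma L_add: "\<zeta> \<in> L \<Longrightarrow> \<eta> \<in> L \<Longrightarrow> \<zeta> + \<eta> \<in> L"
  using subspace_L by (rule complex_vector.subspace_add)

lemma L_diff: "\<zeta> \<in> L \<Longrightarrow> \<eta> \<in> L \<Longrightarrow> \<zeta> - \<eta> \<in> L"
  using subspace_L by (rule complex_vector.subspace_diff)

lemma L_zero: "0 \<in> L"
  using subspace_L by (rule complex_vector.subspace_0)

lemma cinner_r: "s \<in> {0..1} \<Longrightarrow> t \<in> {0..1} \<Longrightarrow> cinner (r s \<zeta>) (r t \<zeta>) = cinner \<zeta> (r (max s t) \<zeta>)"
  by (simp add: r_selfadjoint r_r)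

lemma cinner_increment_self:
  assumes "0 \<le> s" "s \<le> t" "t \<le> 1"
  shows "cinner (r s \<zeta> - r t \<zeta>) (r s \<zeta> - r t \<zeta>) = cinner \<zeta> (r s \<zeta>) - cinner \<zeta> (r t \<zeta>)"
  using assms by (simp add: cinner_diff_left cinner_diff_right cinner_r)

lemma cinner_increment_orthogonal:
  assumes "0 \<le> s" "s \<le> s'" "s' \<le> t" "t \<le> t'" "t' \<le> 1"
  shows "cinner (r s \<zeta> - r s' \<zeta>) (r t \<zeta> - r t' \<zeta>) = 0"
  using assms by (simp add: cinner_diff_left cinner_diff_right cinner_r)

lemma fine_partition:
  assumes "e > 0"
  obtains n :: nat where "n > 0" "\<And>i. i < n \<Longrightarrow> norm (r (i / n) \<zeta> - r (Suc i / n) \<zeta>) < e"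
proof -
  obtain d where d: "d > 0" "\<And>s t. s \<in> {0..1} \<Longrightarrow> t \<in> {0..1} \<Longrightarrow> \<bar>s - t\<bar> < d \<Longrightarrow> norm (r s \<zeta> - r t \<zeta>) < e"
    using r_continuous[OF assms] by meson
  obtain n :: nat where n: "n > 0" "1 / real n < d"
    using d(1) by (metis reals_Archimedean zero_less_Suc inverse_eq_divide)
  have "norm (r (i / n) \<zeta> - r (Suc i / n) \<zeta>) < e" if "i < n" for i
  proof (rule d(2))
    have "real i / n - real (Suc i) / n = - (1 / n)" by (simp add: diff_divide_distrib[symmetric])
    then show "\<bar>real i / n - real (Suc i) / n\<bar> < d" using n by simp
  qed (use that n(1) in \<open>auto simp: field_simps\<close>)
  then show ?thesis using that n(1) by blast
qed

text \<open>The unnormalised form, with separate factors \<open>A\<close> and \<open>B\<close>, carries information also when \<open>f 0 = 0\<close>, where the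
  identity \<open>f \<zeta> * f 0 = f (\<zeta> - r t \<zeta>) * f (r t \<zeta>)\<close> is of little use.\<close>

definition factorizing :: "('h \<Rightarrow> complex) \<Rightarrow> bool" where
  "factorizing f \<longleftrightarrow> (\<forall>t\<in>{0..1}. \<exists>A B. \<forall>\<zeta>\<in>L. f \<zeta> = A (\<zeta> - r t \<zeta>) * B (r t \<zeta>))"

text \<open>Call an interval good if \<open>f\<close> is nonzero at some vector of \<open>L\<close> without component in that interval. Two adjacent good
  intervals merge into a good one, by combining the left factor of one witness with the right factor of the
  other. Short intervals around a point are good, since removing the component in a short interval hardly
  changes \<open>\<zeta>0\<close>. By bisection \<open>[0, 1]\<close> is good, and the only vector of \<open>L\<close> without component in \<open>[0, 1]\<close> is \<open>0\<close>.\<close>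

lemma factorizing_nonzero_at_0:
  assumes f: "factorizing f" and cont: "\<And>\<zeta>. isCont f \<zeta>"
    and nz: "\<zeta>0 \<in> L" "f \<zeta>0 \<noteq> 0"
  shows "f 0 \<noteq> 0"
proof -
  define Q where "Q s t \<longleftrightarrow> (0 \<le> s \<and> t \<le> 1 \<longrightarrow> (\<exists>\<zeta>\<in>L. f (\<zeta> - r s \<zeta> + r t \<zeta>) \<noteq> 0))" for s t
  have "(0::real) \<le> 1" by simp
  then have "Q 0 1"
  proof (induction rule: Bolzano)
    case (trans a b c)
    show ?case unfolding Q_def
    proof
      assume ac: "0 \<le> a \<and> c \<le> 1"
      then have I: "a \<in> {0..1}" "b \<in> {0..1}" "c \<in> {0..1}" using trans by auto
      have ab: "max a b = b" "max b a = b" "max b c = c" "max c b = c" "max a c = c" "max c a = c"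
        using trans by auto
      obtain \<zeta> \<zeta>' where \<zeta>: "\<zeta> \<in> L" "f (\<zeta> - r a \<zeta> + r b \<zeta>) \<noteq> 0" and \<zeta>': "\<zeta>' \<in> L" "f (\<zeta>' - r b \<zeta>' + r c \<zeta>') \<noteq> 0"
        using trans ac unfolding Q_def by fastforce
      obtain A B where AB: "\<And>\<zeta>. \<zeta> \<in> L \<Longrightarrow> f \<zeta> = A (\<zeta> - r b \<zeta>) * B (r b \<zeta>)"
        using f I(2) unfolding factorizing_def by blast
      have "f (\<zeta> - r a \<zeta> + r b \<zeta>) = A (\<zeta> - r a \<zeta>) * B (r b \<zeta>)"
        using AB[OF L_add[OF L_diff[OF \<zeta>(1) r_mem[OF \<zeta>(1) I(1)]] r_mem[OF \<zeta>(1) I(2)]]] I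
        by (simp add: r_add r_diff r_r ab)
      then have A: "A (\<zeta> - r a \<zeta>) \<noteq> 0" using \<zeta>(2) by auto
      have "f (\<zeta>' - r b \<zeta>' + r c \<zeta>') = A (\<zeta>' - r b \<zeta>') * B (r c \<zeta>')"
        using AB[OF L_add[OF L_diff[OF \<zeta>'(1) r_mem[OF \<zeta>'(1) I(2)]] r_mem[OF \<zeta>'(1) I(3)]]] I
        by (simp add: r_add r_diff r_r ab)
      then have B: "B (r c \<zeta>') \<noteq> 0" using \<zeta>'(2) by auto
      define \<zeta>'' where "\<zeta>'' = \<zeta> - r a \<zeta> + r c \<zeta>'"
      have "\<zeta>'' \<in> L"
        unfolding \<zeta>''_def by (intro L_add L_diff \<zeta>(1) \<zeta>'(1) r_mem I)
      moreover have "r a \<zeta>'' = r c \<zeta>'" "r b \<zeta>'' = r c \<zeta>'" "r c \<zeta>'' = r c \<zeta>'"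
        using I by (simp_all add: \<zeta>''_def r_add r_diff r_r ab)
      ultimately have "f (\<zeta>'' - r a \<zeta>'' + r c \<zeta>'') = A (\<zeta> - r a \<zeta>) * B (r c \<zeta>')"
        using AB[of \<zeta>''] by (simp add: \<zeta>''_def)
      then have "f (\<zeta>'' - r a \<zeta>'' + r c \<zeta>'') \<noteq> 0" using A B by simp
      then show "\<exists>\<zeta>\<in>L. f (\<zeta> - r a \<zeta> + r c \<zeta>) \<noteq> 0" using \<open>\<zeta>'' \<in> L\<close> by blast
    qed
  next
    case (local x)
    have "\<forall>\<^sub>F \<zeta> in nhds \<zeta>0. f \<zeta> \<noteq> 0"
      using cont[of \<zeta>0] nz(2) by (intro tendsto_imp_eventually_ne) (simp_all add: isCont_def continuous_at_imp_continuous_at_within tendsto_at_iff_tendsto_nhds)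
    then obtain e where e: "e > 0" "\<And>\<zeta>. dist \<zeta> \<zeta>0 < e \<Longrightarrow> f \<zeta> \<noteq> 0"
      unfolding eventually_nhds_metric by blast
    obtain d where d: "d > 0" "\<And>s t. s \<in> {0..1} \<Longrightarrow> t \<in> {0..1} \<Longrightarrow> \<bar>s - t\<bar> < d \<Longrightarrow> norm (r s \<zeta>0 - r t \<zeta>0) < e"
      using r_continuous[OF e(1)] by meson
    have "Q a b" if ab: "a \<le> x" "x \<le> b" "b - a < d" for a b
      unfolding Q_def
    proof
      assume "0 \<le> a \<and> b \<le> 1"
      then have "norm (r a \<zeta>0 - r b \<zeta>0) < e" using ab by (intro d(2)) auto
      then have "f (\<zeta>0 - r a \<zeta>0 + r b \<zeta>0) \<noteq> 0"
        by (intro e(2)) (simp add: dist_norm norm_minus_commute)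
      then show "\<exists>\<zeta>\<in>L. f (\<zeta> - r a \<zeta> + r b \<zeta>) \<noteq> 0" using nz(1) by blast
    qed
    then show ?case using d(1) by blast
  qed
  then show ?thesis unfolding Q_def by (auto simp: r_0 r_1)
qed

lemma factorizing_prod:
  assumes f: "factorizing f" and \<zeta>: "\<zeta> \<in> L" and n: "n > (0::nat)" and k: "k \<le> n" and f0: "f 0 = 1"
  shows "(\<Prod>i<k. f (r (i / n) \<zeta> - r (Suc i / n) \<zeta>)) = f (\<zeta> - r (k / n) \<zeta>)"
  using k
proof (induction k)
  case 0
  then show ?case by (simp add: r_0 f0)
next
  case (Suc k)
  define s t where "s = real k / n" and "t = real (Suc k) / n"
  have I: "s \<in> {0..1}" "t \<in> {0..1}" using Suc.prems n by (auto simp: s_def t_def field_simps)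
  have st: "max s t = t" using n by (simp add: s_def t_def field_simps)
  obtain A B where AB: "\<And>\<zeta>. \<zeta> \<in> L \<Longrightarrow> f \<zeta> = A (\<zeta> - r s \<zeta>) * B (r s \<zeta>)"
    using f I(1) unfolding factorizing_def by blast
  have "f (\<zeta> - r t \<zeta>) = A (\<zeta> - r s \<zeta>) * B (r s \<zeta> - r t \<zeta>)"
    using AB[OF L_diff[OF \<zeta> r_mem[OF \<zeta> I(2)]]] I by (simp add: r_diff r_r st)
  moreover have "f (\<zeta> - r s \<zeta>) = A (\<zeta> - r s \<zeta>) * B 0"
    using AB[OF L_diff[OF \<zeta> r_mem[OF \<zeta> I(1)]]] I by (simp add: r_diff r_r)
  moreover have "f (r s \<zeta> - r t \<zeta>) = A 0 * B (r s \<zeta> - r t \<zeta>)"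
    using AB[OF L_diff[OF r_mem[OF \<zeta> I(1)] r_mem[OF \<zeta> I(2)]]] I by (simp add: r_diff r_r st)
  moreover have "A 0 * B 0 = 1" using AB[OF L_zero] f0 I by (simp add: r_zero)
  ultimately have "f (\<zeta> - r t \<zeta>) = f (\<zeta> - r s \<zeta>) * f (r s \<zeta> - r t \<zeta>)"
    by (simp add: mult_ac)
  then show ?case using Suc by (simp add: s_def t_def)
qed

text \<open>The ratio of \<open>f \<zeta>\<close> and \<open>exp (a \<zeta>)\<close> is the product of the ratios for the pieces \<open>q i\<close> of \<open>\<zeta>\<close> in a partition of
  \<open>[0, 1]\<close>. If all pieces have norm at most \<open>e\<close>, the deviations of these ratios from \<open>1\<close> sum to \<open>O(e)\<close>:
  the one-particle vectors and the remainders of different pieces are orthogonal, and so the sums of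
  \<open>cmod (a (q i))\<close> and \<open>cmod (\<rho> (q i))\<close> are controlled by square sums.\<close>

lemma factorizing_fock_exponential:
  fixes u :: "'h fock"
  assumes f: "factorizing (\<lambda>\<zeta>. cinner u (exp_vec \<zeta>))" and u0: "cinner u (exp_vec 0) = 1" and \<zeta>: "\<zeta> \<in> L"
  shows "cinner u (exp_vec \<zeta>) = exp (cinner u (one_particle \<zeta>))"
proof -
  define f a \<rho> where "f \<eta> = cinner u (exp_vec \<eta>)" and "a \<eta> = cinner u (one_particle \<eta>)"
    and "\<rho> \<eta> = cinner u (exp_remainder \<eta>)" for \<eta>
  have f_eq: "f \<eta> = 1 + a \<eta> + \<rho> \<eta>" for \<eta>
    by (simp add: f_def a_def \<rho>_def exp_remainder_def cinner_diff_right u0)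
  define N where "N = norm u"
  define K where "K = exp N * (N * norm \<zeta>) + exp (2 * N) * (N * (N * norm \<zeta>))"
  have N0: "N \<ge> 0" by (simp add: N_def)
  have bound: "cmod (f \<zeta> * exp (- a \<zeta>) - 1) \<le> exp (K * e) - 1" if e: "0 < e" "e \<le> 1" for e
  proof -
    obtain n :: nat where n: "n > 0" and small: "\<And>i. i < n \<Longrightarrow> norm (r (i / n) \<zeta> - r (Suc i / n) \<zeta>) < e"
      using fine_partition[OF e(1)] by blast
    define q where "q i = r (real i / n) \<zeta> - r (real (Suc i) / n) \<zeta>" for i
    have q_small: "norm (q i) \<le> e" if "i < n" for i using small[OF that] by (simp add: q_def)
    have q_sum: "(\<Sum>i<n. q i) = \<zeta>"
      unfolding q_def using sum_lessThan_telescope'[of "\<lambda>i. r (real i / n) \<zeta>" n] n \<zeta> by (simp add: r_0 r_1)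
    have q_orth': "cinner (q i) (q j) = 0" if "i < j" "j < n" for i j
      unfolding q_def using that n by (intro cinner_increment_orthogonal divide_right_mono) auto
    have q_orth: "cinner (q i) (q j) = 0" if "i < n" "j < n" "i \<noteq> j" for i j
      using q_orth'[of i j] q_orth'[of j i] that cinner_commute[of "q i" "q j"] by (cases "i < j") auto
    have "complex_of_real (\<Sum>i<n. (norm (q i))\<^sup>2) = (\<Sum>i<n. cinner \<zeta> (r (i / n) \<zeta>) - cinner \<zeta> (r (Suc i / n) \<zeta>))"
      unfolding of_real_sum cinner_self[symmetric] q_def using n
      by (intro sum.cong refl cinner_increment_self) (auto simp: field_simps)
    also have "\<dots> = complex_of_real ((norm \<zeta>)\<^sup>2)"
      using sum_lessThan_telescope'[of "\<lambda>i. cinner \<zeta> (r (real i / n) \<zeta>)" n] n \<zeta>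
      by (simp add: r_0 r_1 cinner_self)
    finally have q_norm: "(\<Sum>i<n. (norm (q i))\<^sup>2) = (norm \<zeta>)\<^sup>2" by (simp only: of_real_eq_iff)
    have a_small: "cmod (a (q i)) \<le> N * e" if "i < n" for i
    proof -
      have "cmod (a (q i)) \<le> N * norm (q i)"
        unfolding a_def N_def using cmod_cinner_le[of u "one_particle (q i)"] by (simp add: norm_one_particle)
      also have "\<dots> \<le> N * e" by (rule mult_left_mono[OF q_small[OF that] N0])
      finally show ?thesis .
    qed
    have a_sum: "(\<Sum>i<n. cmod (a (q i))) \<le> N * norm \<zeta>"
    proof -
      have "sqrt (\<Sum>i<n. (norm (one_particle (q i)))\<^sup>2) = norm \<zeta>" by (simp add: norm_one_particle q_norm)
      then show ?thesis
        unfolding a_def N_def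
        using sum_cmod_cinner_orthogonal_le[of "{..<n}" "\<lambda>i. one_particle (q i)" u]
        by (simp add: cinner_one_particle q_orth)
    qed
    have \<rho>_sum: "(\<Sum>i<n. cmod (\<rho> (q i))) \<le> N * (e * norm \<zeta>)"
    proof -
      have "(\<Sum>i<n. (norm (exp_remainder (q i)))\<^sup>2) \<le> (\<Sum>i<n. e\<^sup>2 * (norm (q i))\<^sup>2)"
      proof (rule sum_mono)
        fix i assume "i \<in> {..<n}"
        then have i: "norm (q i) \<le> e" by (simp add: q_small)
        then have "norm (exp_remainder (q i)) \<le> (norm (q i))\<^sup>2"
          using e(2) by (intro norm_exp_remainder_le) linarith
        also have "\<dots> \<le> e * norm (q i)"
          unfolding power2_eq_square using i by (intro mult_right_mono) auto
        finally have "(norm (exp_remainder (q i)))\<^sup>2 \<le> (e * norm (q i))\<^sup>2" by (rule power_mono) simp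
        then show "(norm (exp_remainder (q i)))\<^sup>2 \<le> e\<^sup>2 * (norm (q i))\<^sup>2" by (simp add: power_mult_distrib)
      qed
      also have "\<dots> = (e * norm \<zeta>)\<^sup>2"
        by (simp add: sum_distrib_left[symmetric] q_norm power_mult_distrib)
      finally have "sqrt (\<Sum>i<n. (norm (exp_remainder (q i)))\<^sup>2) \<le> e * norm \<zeta>"
        using e(1) by (intro real_le_lsqrt) auto
      then have "N * sqrt (\<Sum>i<n. (norm (exp_remainder (q i)))\<^sup>2) \<le> N * (e * norm \<zeta>)"
        by (rule mult_left_mono[OF _ N0])
      moreover have "(\<Sum>i<n. cmod (\<rho> (q i))) \<le> N * sqrt (\<Sum>i<n. (norm (exp_remainder (q i)))\<^sup>2)"
        unfolding \<rho>_def N_def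
        by (rule sum_cmod_cinner_orthogonal_le) (auto simp: cinner_exp_remainder q_orth)
      ultimately show ?thesis by linarith
    qed
    define \<delta> where "\<delta> i = f (q i) * exp (- a (q i)) - 1" for i
    have "(\<Sum>i<n. cmod (\<delta> i)) \<le> (\<Sum>i<n. exp N * cmod (\<rho> (q i)) + exp (2 * N) * (N * e * cmod (a (q i))))"
    proof (rule sum_mono)
      fix i assume i: "i \<in> {..<n}"
      have "cmod (a (q i)) \<le> N"
        using a_small[of i] i mult_left_mono[OF e(2) N0] by simp
      then have "cmod (\<delta> i) \<le> exp N * cmod (\<rho> (q i)) + exp (2 * N) * (cmod (a (q i)))\<^sup>2"
        unfolding \<delta>_def f_eq by (rule cmod_one_plus_mult_exp_minus_le)
      moreover have "(cmod (a (q i)))\<^sup>2 \<le> N * e * cmod (a (q i))"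
        unfolding power2_eq_square using a_small[of i] i by (intro mult_right_mono) auto
      then have "exp (2 * N) * (cmod (a (q i)))\<^sup>2 \<le> exp (2 * N) * (N * e * cmod (a (q i)))" by simp
      ultimately show "cmod (\<delta> i) \<le> exp N * cmod (\<rho> (q i)) + exp (2 * N) * (N * e * cmod (a (q i)))"
        by linarith
    qed
    also have "\<dots> = exp N * (\<Sum>i<n. cmod (\<rho> (q i))) + exp (2 * N) * (N * e * (\<Sum>i<n. cmod (a (q i))))"
      by (simp add: sum.distrib sum_distrib_left)
    also have "\<dots> \<le> exp N * (N * (e * norm \<zeta>)) + exp (2 * N) * (N * e * (N * norm \<zeta>))"
      using N0 e(1) by (intro add_mono mult_left_mono a_sum \<rho>_sum) auto
    also have "\<dots> = K * e" by (simp add: K_def algebra_simps)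
    finally have \<delta>_sum: "(\<Sum>i<n. cmod (\<delta> i)) \<le> K * e" .
    have "(\<Prod>i<n. f (q i)) = f \<zeta>"
      using factorizing_prod[OF f \<zeta> n order_refl u0] n \<zeta> by (simp add: f_def q_def r_1)
    moreover have "a (\<Sum>i\<in>I. q i) = (\<Sum>i\<in>I. a (q i))" for I
    proof -
      have "one_particle 0 = (0 :: 'h fock)" using one_particle_scaleC[of 0 "0::'h"] by simp
      then show ?thesis
        by (induction I rule: infinite_finite_induct) (simp_all add: a_def one_particle_add cinner_add_right)
    qed
    then have "(\<Prod>i<n. exp (- a (q i))) = exp (- a \<zeta>)"
      by (simp add: exp_sum[symmetric] sum_negf q_sum[symmetric])
    ultimately have "f \<zeta> * exp (- a \<zeta>) = (\<Prod>i<n. 1 + \<delta> i)"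
      by (simp add: \<delta>_def prod.distrib)
    then have "cmod (f \<zeta> * exp (- a \<zeta>) - 1) \<le> (\<Prod>i<n. 1 + cmod (\<delta> i)) - 1"
      by (simp add: norm_prod_minus1_le_prod_minus1)
    also have "(\<Prod>i<n. 1 + cmod (\<delta> i)) \<le> exp (\<Sum>i<n. cmod (\<delta> i))"
      by (rule prod_le_exp_sum) simp
    also have "\<dots> \<le> exp (K * e)" using \<delta>_sum by simp
    finally show ?thesis by simp
  qed
  have "((\<lambda>e. exp (K * e) - 1) \<longlongrightarrow> exp (K * 0) - 1) (at_right 0)"
    by (intro tendsto_intros)
  then have lim: "((\<lambda>e. exp (K * e) - 1) \<longlongrightarrow> 0) (at_right 0)" by simp
  have "\<forall>\<^sub>F e in at_right (0::real). 0 < e \<and> e \<le> 1"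
    using eventually_at_right_real[of 0 1] by (rule eventually_mono) auto
  then have "\<forall>\<^sub>F e in at_right 0. cmod (f \<zeta> * exp (- a \<zeta>) - 1) \<le> exp (K * e) - 1"
    by (rule eventually_mono) (use bound in blast)
  then have "cmod (f \<zeta> * exp (- a \<zeta>) - 1) \<le> 0"
    by (rule tendsto_lowerbound[OF lim]) simp
  then have "f \<zeta> * exp (- a \<zeta>) = 1" by simp
  then show ?thesis by (simp add: f_def a_def exp_minus field_simps)
qed

end

section \<open>Isometric representations\<close>

lemma isometry_cinner:
  fixes U :: "'h::chilbert_space \<Rightarrow>\<^sub>L 'h"
  assumes U: "U \<in> bounded_ops" and iso: "\<And>\<xi>. norm (U \<xi>) = norm \<xi>"
  shows "cinner (U \<xi>) (U \<eta>) = cinner \<xi> \<eta>"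
proof -
  have re: "Re (cinner (U \<xi>) (U \<eta>)) = Re (cinner \<xi> \<eta>)" for \<xi> \<eta>
    using norm_diff_sq[of "U \<xi>" "U \<eta>"] norm_diff_sq[of \<xi> \<eta>] iso[of "\<xi> - \<eta>"]
    by (simp add: iso blinfun.diff_right)
  have "Im (cinner (U \<xi>) (U \<eta>)) = Im (cinner \<xi> \<eta>)"
    using re[of \<xi> "\<i> *\<^sub>C \<eta>"] by (simp add: bounded_opsD[OF U] cinner_scaleC_right)
  with re show ?thesis by (simp add: complex_eq_iff)
qed

locale cone_representation =
  fixes P :: "'a::euclidean_space set" and V :: "'a \<Rightarrow> 'h::chilbert_space \<Rightarrow>\<^sub>L 'h"
  assumes cone: "closed_pointed_spanning_cone P" and rep: "isometric_representation P V"
begin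

lemma zero_in_P: "0 \<in> P"
  using cone unfolding closed_pointed_spanning_cone_def by auto

lemma P_add: "x \<in> P \<Longrightarrow> y \<in> P \<Longrightarrow> x + y \<in> P"
  using cone convex_cone_add unfolding closed_pointed_spanning_cone_def by blast

lemma P_scaleR: "x \<in> P \<Longrightarrow> 0 \<le> t \<Longrightarrow> t *\<^sub>R x \<in> P"
  using cone convex_cone_scaleR unfolding closed_pointed_spanning_cone_def by blast

lemma
  assumes "x \<in> P"
  shows V_bounded_ops: "V x \<in> bounded_ops" and norm_V: "norm (V x \<xi>) = norm \<xi>"
    and V_V: "y \<in> P \<Longrightarrow> V x (V y \<xi>) = V (x + y) \<xi>"
proof -
  show "V x \<in> bounded_ops" "norm (V x \<xi>) = norm \<xi>"
    using rep assms unfolding isometric_representation_def by blast+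
  assume "y \<in> P"
  then have "V x o\<^sub>L V y = V (x + y)" using rep assms unfolding isometric_representation_def by blast
  from arg_cong[OF this, of "\<lambda>A. blinfun_apply A \<xi>"] show "V x (V y \<xi>) = V (x + y) \<xi>" by simp
qed

lemma V_continuous: "continuous_on P (\<lambda>x. V x \<xi>)"
  using rep unfolding isometric_representation_def by blast

lemma cinner_V: "x \<in> P \<Longrightarrow> cinner (V x \<xi>) (V x \<eta>) = cinner \<xi> \<eta>"
  by (intro isometry_cinner V_bounded_ops norm_V)

abbreviation Vadj :: "'a \<Rightarrow> 'h \<Rightarrow> 'h" where
  "Vadj x \<equiv> blinfun_apply (cadjoint (V x))"

lemma cinner_Vadj_left: "x \<in> P \<Longrightarrow> cinner (Vadj x \<xi>) \<eta> = cinner \<xi> (V x \<eta>)"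
  by (rule cinner_cadjoint_left[OF V_bounded_ops])

lemma cinner_Vadj_right: "x \<in> P \<Longrightarrow> cinner \<xi> (Vadj x \<eta>) = cinner (V x \<xi>) \<eta>"
  by (rule cinner_cadjoint_right[OF V_bounded_ops])

lemma Vadj_V: "x \<in> P \<Longrightarrow> Vadj x (V x \<xi>) = \<xi>"
  by (rule eq_if_cinner_all) (simp add: cinner_Vadj_left cinner_V)

lemma Vadj_Vadj: "x \<in> P \<Longrightarrow> y \<in> P \<Longrightarrow> Vadj y (Vadj x \<xi>) = Vadj (x + y) \<xi>"
  by (rule eq_if_cinner_all) (simp add: cinner_Vadj_left V_V P_add)

lemma V_0: "V 0 \<xi> = \<xi>"
  using V_V[OF zero_in_P zero_in_P, of \<xi>] Vadj_V[OF zero_in_P, of "V 0 \<xi>"] Vadj_V[OF zero_in_P, of \<xi>]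
  by simp

lemma Vadj_0: "Vadj 0 \<xi> = \<xi>"
  using Vadj_V[OF zero_in_P, of \<xi>] by (simp add: V_0)

definition defect :: "'a \<Rightarrow> 'h set" where
  "defect x = {\<xi>. Vadj x \<xi> = 0}"

definition range_proj :: "'a \<Rightarrow> 'h \<Rightarrow> 'h" where
  "range_proj x \<xi> = V x (Vadj x \<xi>)"

lemma subspace_defect: "complex_vector.subspace (defect x)" if "x \<in> P"
  by (rule complex_vector.subspaceI)
     (auto simp: defect_def blinfun.add_right bounded_opsD[OF cadjoint_bounded_ops[OF V_bounded_ops[OF that]]])

lemma cinner_range_proj: "x \<in> P \<Longrightarrow> cinner (range_proj x \<xi>) \<eta> = cinner (Vadj x \<xi>) (Vadj x \<eta>)"
  by (simp add: range_proj_def cinner_Vadj_right)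

lemma range_proj_selfadjoint: "x \<in> P \<Longrightarrow> cinner (range_proj x \<xi>) \<eta> = cinner \<xi> (range_proj x \<eta>)"
  by (simp add: range_proj_def cinner_Vadj_left[symmetric] cinner_Vadj_right)

lemma range_proj_diff: "range_proj x (\<xi> - \<eta>) = range_proj x \<xi> - range_proj x \<eta>"
  by (simp add: range_proj_def blinfun.diff_right)

lemma diff_range_proj_defect: "x \<in> P \<Longrightarrow> \<xi> - range_proj x \<xi> \<in> defect x"
  by (simp add: defect_def range_proj_def blinfun.diff_right Vadj_V)

lemma Vadj_defect:
  assumes "x \<in> P" "y \<in> P" "x - y \<in> P" "\<xi> \<in> defect x"
  shows "Vadj y \<xi> \<in> defect (x - y)"
  using assms Vadj_Vadj[of y "x - y" \<xi>] by (simp add: defect_def)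

lemma range_proj_range_proj:
  assumes "x \<in> P" "z \<in> P"
  shows "range_proj x (range_proj (x + z) \<xi>) = range_proj (x + z) \<xi>"
    and "range_proj (x + z) (range_proj x \<xi>) = range_proj (x + z) \<xi>"
proof -
  show "range_proj x (range_proj (x + z) \<xi>) = range_proj (x + z) \<xi>"
    using assms by (simp add: range_proj_def V_V[symmetric] Vadj_V)
  show "range_proj (x + z) (range_proj x \<xi>) = range_proj (x + z) \<xi>"
    using assms by (simp add: range_proj_def Vadj_Vadj[symmetric] Vadj_V)
qed

lemma norm_range_proj_le: "x \<in> P \<Longrightarrow> norm (range_proj x \<xi>) \<le> norm \<xi>"
proof -
  assume x: "x \<in> P"
  have "cinner (\<xi> - range_proj x \<xi>) (range_proj x \<xi>) = 0"
    using range_proj_range_proj(1)[OF x zero_in_P, of \<xi>]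
    by (simp add: range_proj_selfadjoint[OF x, symmetric] range_proj_diff)
  then have "(norm (range_proj x \<xi>))\<^sup>2 \<le> (norm \<xi>)\<^sup>2"
    using norm_diff_sq_orthogonal[of \<xi> "range_proj x \<xi>"] zero_le_power2[of "norm (\<xi> - range_proj x \<xi>)"] by linarith
  then show ?thesis by (rule power2_le_imp_le) simp
qed

text \<open>Since the range projections decrease, the left side is \<open>\<parallel>p\<parallel>\<^sup>2 - \<parallel>q\<parallel>\<^sup>2\<close> with \<open>p\<close> and \<open>q\<close> the projections of \<open>\<xi>\<close> at
  \<open>x\<close> and \<open>x + z\<close>. The commutation relation \<open>V\<^sub>z V\<^sub>x V\<^sub>x\<^sup>* = V\<^bsub>x + z\<^esub> V\<^bsub>x + z\<^esub>\<^sup>* V\<^sub>z\<close> bounds \<open>\<parallel>p\<parallel>\<close> by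
  \<open>\<parallel>q\<parallel> + \<parallel>V\<^sub>z \<xi> - \<xi>\<parallel>\<close>. The bound does not depend on \<open>x\<close> and yields left and right continuity at once.\<close>

lemma norm_range_proj_increment:
  assumes x: "x \<in> P" and z: "z \<in> P"
  shows "(norm (range_proj x \<xi> - range_proj (x + z) \<xi>))\<^sup>2 \<le> 2 * norm \<xi> * norm (V z \<xi> - \<xi>)"
proof -
  let ?p = "range_proj x \<xi>" and ?q = "range_proj (x + z) \<xi>"
  have xz: "x + z \<in> P" using x z by (rule P_add)
  have "cinner (?p - ?q) ?q = 0"
    using range_proj_range_proj[OF x z, of \<xi>] range_proj_range_proj(1)[OF xz zero_in_P, of \<xi>]
    by (simp add: range_proj_selfadjoint[OF xz, symmetric] range_proj_diff)
  then have "(norm (?p - ?q))\<^sup>2 = (norm ?p)\<^sup>2 - (norm ?q)\<^sup>2" by (rule norm_diff_sq_orthogonal)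
  also have "\<dots> = (norm ?p - norm ?q) * (norm ?p + norm ?q)" by (simp add: power2_eq_square algebra_simps)
  also have "\<dots> \<le> norm (V z \<xi> - \<xi>) * (norm \<xi> + norm \<xi>)"
  proof (rule mult_mono')
    have comm: "V z ?p = range_proj (x + z) (V z \<xi>)"
    proof -
      have "V z ?p = V (z + x) (Vadj x \<xi>)" using x z by (simp add: range_proj_def V_V)
      also have "Vadj x \<xi> = Vadj (z + x) (V z \<xi>)" using x z by (simp add: Vadj_Vadj[symmetric] Vadj_V)
      finally show ?thesis by (simp add: range_proj_def add.commute)
    qed
    have "norm ?p = norm (range_proj (x + z) (V z \<xi>))" using norm_V[OF z, of ?p] by (simp add: comm)
    also have "range_proj (x + z) (V z \<xi>) = ?q + range_proj (x + z) (V z \<xi> - \<xi>)"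
      by (simp add: range_proj_def blinfun.diff_right)
    also have "norm \<dots> \<le> norm ?q + norm (V z \<xi> - \<xi>)"
      by (intro norm_triangle_le add_left_mono norm_range_proj_le xz)
    finally show "norm ?p - norm ?q \<le> norm (V z \<xi> - \<xi>)" by simp
    show "norm ?p + norm ?q \<le> norm \<xi> + norm \<xi>"
      by (intro add_mono norm_range_proj_le x xz)
    have "norm ?q \<le> norm ?p"
      using norm_range_proj_le[OF xz, of ?p] by (simp add: range_proj_range_proj[OF x z])
    then show "0 \<le> norm ?p - norm ?q" by simp
  qed simp
  finally show ?thesis by (simp add: mult_ac)
qed

lemma projection_chain_ray:
  assumes x: "x \<in> P"
  shows "projection_chain (\<lambda>t. range_proj (t *\<^sub>R x)) (defect x)"
proof
  have tx: "t *\<^sub>R x \<in> P" if "t \<in> {0..1}" for t using that x by (auto intro: P_scaleR)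
  have step: "(t - s) *\<^sub>R x \<in> P" "s *\<^sub>R x + (t - s) *\<^sub>R x = t *\<^sub>R x" if "s \<le> t" for s t
    using P_scaleR[OF x, of "t - s"] that by (simp_all add: scaleR_left_diff_distrib)
  have chain: "range_proj (s *\<^sub>R x) (range_proj (t *\<^sub>R x) \<xi>) = range_proj (t *\<^sub>R x) \<xi>"
    "range_proj (t *\<^sub>R x) (range_proj (s *\<^sub>R x) \<xi>) = range_proj (t *\<^sub>R x) \<xi>"
    if "s \<in> {0..1}" "s \<le> t" for s t \<xi>
    using range_proj_range_proj[OF tx[OF that(1)] step(1)[OF that(2)], of \<xi>] step(2)[OF that(2)] by simp_all
  have at1: "range_proj (1 *\<^sub>R x) \<zeta> = 0" if "\<zeta> \<in> defect x" for \<zeta>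
    using that by (simp add: range_proj_def defect_def)
  show "complex_vector.subspace (defect x)" by (rule subspace_defect[OF x])
  show "range_proj (t *\<^sub>R x) \<zeta> \<in> defect x" if "\<zeta> \<in> defect x" "t \<in> {0..1}" for \<zeta> t
  proof -
    have "V x (Vadj x (range_proj (t *\<^sub>R x) \<zeta>)) = 0"
      using chain(2)[of t 1 \<zeta>] at1[OF that(1)] that(2) by (simp add: range_proj_def)
    then have "norm (Vadj x (range_proj (t *\<^sub>R x) \<zeta>)) = 0"
      using norm_V[OF x, of "Vadj x (range_proj (t *\<^sub>R x) \<zeta>)"] by simp
    then show ?thesis by (simp add: defect_def)
  qed
  show "range_proj (t *\<^sub>R x) (\<zeta> + \<eta>) = range_proj (t *\<^sub>R x) \<zeta> + range_proj (t *\<^sub>R x) \<eta>" for t \<zeta> \<eta>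
    by (simp add: range_proj_def blinfun.add_right)
  show "range_proj (s *\<^sub>R x) (range_proj (t *\<^sub>R x) \<zeta>) = range_proj (max s t *\<^sub>R x) \<zeta>"
    if "s \<in> {0..1}" "t \<in> {0..1}" for s t \<zeta>
    using chain[of s t \<zeta>] chain[of t s \<zeta>] that by (cases "s \<le> t") (auto simp: max_def)
  show "cinner (range_proj (t *\<^sub>R x) \<zeta>) \<eta> = cinner \<zeta> (range_proj (t *\<^sub>R x) \<eta>)"
    if "t \<in> {0..1}" for t \<zeta> \<eta> by (rule range_proj_selfadjoint[OF tx[OF that]])
  show "range_proj (0 *\<^sub>R x) \<zeta> = \<zeta>" for \<zeta> by (simp add: range_proj_def V_0 Vadj_0)
  show "range_proj (1 *\<^sub>R x) \<zeta> = 0" if "\<zeta> \<in> defect x" for \<zeta> by (rule at1[OF that])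
  show "\<exists>d>0. \<forall>s\<in>{0..1}. \<forall>t\<in>{0..1}. \<bar>s - t\<bar> < d \<longrightarrow> norm (range_proj (s *\<^sub>R x) \<zeta> - range_proj (t *\<^sub>R x) \<zeta>) < e"
    if e: "e > 0" for e :: real and \<zeta>
  proof -
    have "continuous_on {0..} (\<lambda>h. V (h *\<^sub>R x) \<zeta>)"
      by (rule continuous_on_compose2[OF V_continuous]) (auto intro!: continuous_intros P_scaleR x)
    then have "((\<lambda>h. V (h *\<^sub>R x) \<zeta>) \<longlongrightarrow> V (0 *\<^sub>R x) \<zeta>) (at 0 within {0..})"
      unfolding continuous_on_def by (rule bspec) simp
    then have "((\<lambda>h. 2 * norm \<zeta> * norm (V (h *\<^sub>R x) \<zeta> - \<zeta>)) \<longlongrightarrow> 2 * norm \<zeta> * norm (V (0 *\<^sub>R x) \<zeta> - \<zeta>)) (at 0 within {0..})"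
      by (intro tendsto_mult tendsto_norm tendsto_diff tendsto_const)
    then have "((\<lambda>h. 2 * norm \<zeta> * norm (V (h *\<^sub>R x) \<zeta> - \<zeta>)) \<longlongrightarrow> 0) (at 0 within {0..})" by (simp add: V_0)
    then have "\<forall>\<^sub>F h in at 0 within {0..}. 2 * norm \<zeta> * norm (V (h *\<^sub>R x) \<zeta> - \<zeta>) < e\<^sup>2"
      by (rule order_tendstoD) (use e in simp)
    then obtain d where d: "d > 0" "\<And>h. h \<ge> 0 \<Longrightarrow> h \<noteq> 0 \<Longrightarrow> h < d \<Longrightarrow> 2 * norm \<zeta> * norm (V (h *\<^sub>R x) \<zeta> - \<zeta>) < e\<^sup>2"
      unfolding eventually_at by auto
    have ordered: "norm (range_proj (s *\<^sub>R x) \<zeta> - range_proj (t *\<^sub>R x) \<zeta>) < e"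
      if "s \<in> {0..1}" "t \<in> {0..1}" "s \<le> t" "t - s < d" for s t
    proof (cases "s = t")
      case False
      have "(norm (range_proj (s *\<^sub>R x) \<zeta> - range_proj (t *\<^sub>R x) \<zeta>))\<^sup>2 \<le> 2 * norm \<zeta> * norm (V ((t - s) *\<^sub>R x) \<zeta> - \<zeta>)"
        using norm_range_proj_increment[OF tx[OF that(1)] step(1)[OF that(3)], of \<zeta>] step(2)[OF that(3)] by simp
      also have "\<dots> < e\<^sup>2" using that False by (intro d(2)) auto
      finally show ?thesis by (rule power2_less_imp_less) (use e in simp)
    qed (use e in simp)
    have "norm (range_proj (s *\<^sub>R x) \<zeta> - range_proj (t *\<^sub>R x) \<zeta>) < e"
      if "s \<in> {0..1}" "t \<in> {0..1}" "\<bar>s - t\<bar> < d" for s t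
      using ordered[of s t] ordered[of t s] that norm_minus_commute[of "range_proj (s *\<^sub>R x) \<zeta>" "range_proj (t *\<^sub>R x) \<zeta>"]
      by (cases "s \<le> t") (auto simp: abs_if split: if_splits)
    then show ?thesis using d(1) by blast
  qed
qed

end

section \<open>The product system of a CCR flow\<close>

locale ccr_flow = cone_representation P V
  for P :: "'a::euclidean_space set" and V :: "'a \<Rightarrow> 'h::chilbert_space \<Rightarrow>\<^sub>L 'h" +
  fixes \<alpha> :: "'a \<Rightarrow> ('h fock \<Rightarrow>\<^sub>L 'h fock) \<Rightarrow> ('h fock \<Rightarrow>\<^sub>L 'h fock)"
  assumes flow: "is_CCR_flow P V \<alpha>"
begin

lemma weyl_endomorphism_flow: "x \<in> P \<Longrightarrow> weyl_endomorphism (\<alpha> x) (V x)"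
  using flow unfolding is_CCR_flow_def E0_semigroup_def
  by unfold_locales (auto intro: V_bounded_ops norm_V)

lemma normal_endomorphism_flow: "x \<in> P \<Longrightarrow> normal_endomorphism (\<alpha> x)"
  using weyl_endomorphism_flow unfolding weyl_endomorphism_def by blast

abbreviation E :: "'a \<Rightarrow> ('h fock \<Rightarrow>\<^sub>L 'h fock) set" where
  "E x \<equiv> product_system \<alpha> x"

abbreviation vac :: "'h fock" where
  "vac \<equiv> exp_vec 0"

lemma E_bounded_ops: "T \<in> E x \<Longrightarrow> T \<in> bounded_ops"
  by (simp add: product_system_def)

lemma subspace_E: "x \<in> P \<Longrightarrow> complex_vector.subspace (E x)"
  unfolding product_system_eq_intertwiners
  by (intro subspace_intertwiners normal_endomorphism.endo_bounded_ops[OF normal_endomorphism_flow])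

lemma cinner_E: "x \<in> P \<Longrightarrow> S \<in> E x \<Longrightarrow> T \<in> E x \<Longrightarrow> cinner (S a) (T b) = cinner (S vac) (T vac) * cinner a b"
  unfolding product_system_eq_intertwiners
  by (rule normal_endomorphism.cinner_intertwiners[OF normal_endomorphism_flow _ _ norm_vacuum])

text \<open>The operator \<open>T\<^sub>\<xi>\<close> of the introduction. Its values on the exponential vectors determine it.\<close>

definition exp_unit :: "'a \<Rightarrow> 'h \<Rightarrow> 'h fock \<Rightarrow>\<^sub>L 'h fock" where
  "exp_unit x \<xi> = (SOME T. T \<in> E x \<and> (\<forall>\<eta>. blinfun_apply T (exp_vec \<eta>) = exp_vec (\<xi> + V x \<eta>)))"

lemma
  assumes "x \<in> P" "\<xi> \<in> defect x"
  shows exp_unit_in_E: "exp_unit x \<xi> \<in> E x"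
    and exp_unit_exp_vec: "exp_unit x \<xi> (exp_vec \<eta>) = exp_vec (\<xi> + V x \<eta>)"
proof -
  have "\<exists>T. T \<in> E x \<and> (\<forall>\<eta>. blinfun_apply T (exp_vec \<eta>) = exp_vec (\<xi> + V x \<eta>))"
    using weyl_endomorphism.exponential_intertwiner_exists[OF weyl_endomorphism_flow[OF assms(1)], of \<xi>] assms(2)
    unfolding product_system_eq_intertwiners by (auto simp: defect_def)
  from someI_ex[OF this] show "exp_unit x \<xi> \<in> E x" "exp_unit x \<xi> (exp_vec \<eta>) = exp_vec (\<xi> + V x \<eta>)"
    unfolding exp_unit_def by blast+
qed

lemma exp_unit_vacuum: "x \<in> P \<Longrightarrow> \<xi> \<in> defect x \<Longrightarrow> exp_unit x \<xi> vac = exp_vec \<xi>"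
  using exp_unit_exp_vec[of x \<xi> 0] by simp

text \<open>Every \<open>\<kappa>\<close> is \<open>\<zeta> + V\<^sub>x \<eta>\<close> with \<open>\<zeta> \<in> Ker V\<^sub>x\<^sup>*\<close>, so that every exponential vector lies in the range of an
  exponential unit. As inner products in the fibre are scalars, orthogonality at the vacuum makes the range
  of \<open>R\<close> orthogonal to all these ranges.\<close>

lemma E_zero_if_orthogonal:
  assumes x: "x \<in> P" and R: "R \<in> E x" and orth: "\<And>\<zeta>. \<zeta> \<in> defect x \<Longrightarrow> cinner (R vac) (exp_vec \<zeta>) = 0"
  shows "R = 0"
proof (rule blinfun_eqI)
  fix a
  have "R a = 0"
  proof (rule eq_if_cinner_total[OF exp_vec_total])
    fix b assume "b \<in> range (exp_vec :: 'h \<Rightarrow> _)"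
    then obtain \<kappa> where b: "b = exp_vec \<kappa>" by blast
    define \<zeta> where "\<zeta> = \<kappa> - range_proj x \<kappa>"
    have \<zeta>: "\<zeta> \<in> defect x" unfolding \<zeta>_def by (rule diff_range_proj_defect[OF x])
    have "b = exp_unit x \<zeta> (exp_vec (Vadj x \<kappa>))"
      unfolding exp_unit_exp_vec[OF x \<zeta>] b by (simp add: \<zeta>_def range_proj_def)
    then have "cinner (R a) b = cinner (R vac) (exp_unit x \<zeta> vac) * cinner a (exp_vec (Vadj x \<kappa>))"
      by (simp only:) (rule cinner_E[OF x R exp_unit_in_E[OF x \<zeta>]])
    then show "cinner (R a) b = cinner 0 b" by (simp add: exp_unit_vacuum[OF x \<zeta>] orth[OF \<zeta>])
  qed
  then show "R a = blinfun_apply 0 a" by simp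
qed

lemma E_eqI:
  assumes x: "x \<in> P" and "S \<in> E x" "T \<in> E x"
    and "\<And>\<zeta>. \<zeta> \<in> defect x \<Longrightarrow> cinner (S vac) (exp_vec \<zeta>) = cinner (T vac) (exp_vec \<zeta>)"
  shows "S = T"
proof -
  have "S - T = 0"
    using assms by (intro E_zero_if_orthogonal[OF x] complex_vector.subspace_diff[OF subspace_E])
      (simp_all add: blinfun.diff_left cinner_diff_left)
  then show ?thesis by simp
qed

lemma defect_add:
  assumes "x \<in> P" "y \<in> P" "\<xi> \<in> defect x" "\<eta> \<in> defect y"
  shows "\<xi> + V x \<eta> \<in> defect (x + y)"
proof -
  have "Vadj (x + y) (\<xi> + V x \<eta>) = Vadj y (Vadj x \<xi> + Vadj x (V x \<eta>))"
    using assms by (simp add: Vadj_Vadj[symmetric] blinfun.add_right)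
  then show ?thesis using assms by (simp add: defect_def Vadj_V)
qed

lemma exp_unit_compose:
  assumes x: "x \<in> P" and y: "y \<in> P" and \<xi>: "\<xi> \<in> defect x" and \<eta>: "\<eta> \<in> defect y"
  shows "exp_unit x \<xi> o\<^sub>L exp_unit y \<eta> = exp_unit (x + y) (\<xi> + V x \<eta>)"
proof (rule bounded_ops_eqI[OF _ _ exp_vec_total])
  note xy = P_add[OF x y] defect_add[OF assms]
  show "exp_unit x \<xi> o\<^sub>L exp_unit y \<eta> \<in> bounded_ops"
    by (intro bounded_ops_compose E_bounded_ops[OF exp_unit_in_E] assms)
  show "exp_unit (x + y) (\<xi> + V x \<eta>) \<in> bounded_ops"
    by (rule E_bounded_ops[OF exp_unit_in_E[OF xy]])
  fix s assume "s \<in> range (exp_vec :: 'h \<Rightarrow> _)"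
  then obtain \<kappa> where "s = exp_vec \<kappa>" by blast
  then show "(exp_unit x \<xi> o\<^sub>L exp_unit y \<eta>) s = exp_unit (x + y) (\<xi> + V x \<eta>) s"
    by (simp add: exp_unit_exp_vec assms xy blinfun.add_right V_V add.assoc)
qed

text \<open>The orthogonal decomposition \<open>Ker V\<^sub>x\<^sup>* = Ker V\<^sub>y\<^sup>* \<oplus> V\<^sub>y Ker V\<^bsub>x - y\<^esub>\<^sup>*\<close> for \<open>y \<le> x\<close>, and the corresponding
  factorization of exponential units.\<close>

lemma defect_decomposition:
  assumes "x \<in> P" "y \<in> P" "x - y \<in> P" "\<zeta> \<in> defect x"
  obtains \<zeta>1 \<zeta>2 where "\<zeta>1 = \<zeta> - range_proj y \<zeta>" "\<zeta>2 = Vadj y \<zeta>" "\<zeta>1 \<in> defect y" "\<zeta>2 \<in> defect (x - y)"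
    "exp_unit x \<zeta> = exp_unit y \<zeta>1 o\<^sub>L exp_unit (x - y) \<zeta>2"
proof -
  let ?z1 = "\<zeta> - range_proj y \<zeta>" and ?z2 = "Vadj y \<zeta>"
  have 1: "?z1 \<in> defect y" by (rule diff_range_proj_defect[OF assms(2)])
  have 2: "?z2 \<in> defect (x - y)" by (rule Vadj_defect[OF assms])
  have "exp_unit y ?z1 o\<^sub>L exp_unit (x - y) ?z2 = exp_unit x \<zeta>"
    using exp_unit_compose[OF assms(2,3) 1 2] by (simp add: range_proj_def)
  then show ?thesis using that 1 2 by metis
qed

lemma exp_unit_decomposable:
  assumes x: "x \<in> P" and \<xi>: "\<xi> \<in> defect x" and c: "c \<noteq> 0"
  shows "c *\<^sub>C exp_unit x \<xi> \<in> decomposable_vectors P \<alpha> x"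
proof -
  have in_E: "c *\<^sub>C exp_unit x \<xi> \<in> E x"
    by (intro complex_vector.subspace_scale[OF subspace_E[OF x]] exp_unit_in_E x \<xi>)
  have "(c *\<^sub>C exp_unit x \<xi>) vac \<noteq> 0"
    using c by (simp add: scaleC_blinfun.rep_eq exp_unit_vacuum[OF x \<xi>] exp_vec_nonzero)
  then have nz: "c *\<^sub>C exp_unit x \<xi> \<noteq> 0" by auto
  have "\<exists>v\<in>E y. \<exists>w\<in>E (x - y). c *\<^sub>C exp_unit x \<xi> = v o\<^sub>L w" if y: "y \<in> P" "x - y \<in> P" for y
  proof -
    obtain \<xi>1 \<xi>2 where d: "\<xi>1 \<in> defect y" "\<xi>2 \<in> defect (x - y)"
      "exp_unit x \<xi> = exp_unit y \<xi>1 o\<^sub>L exp_unit (x - y) \<xi>2"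
      using defect_decomposition[OF x y \<xi>] by metis
    have "c *\<^sub>C exp_unit x \<xi> = (c *\<^sub>C exp_unit y \<xi>1) o\<^sub>L exp_unit (x - y) \<xi>2"
      by (rule blinfun_eqI) (simp add: d(3) scaleC_blinfun.rep_eq)
    moreover have "c *\<^sub>C exp_unit y \<xi>1 \<in> E y"
      by (intro complex_vector.subspace_scale[OF subspace_E[OF y(1)]] exp_unit_in_E y d)
    ultimately show ?thesis using exp_unit_in_E[OF y(2) d(2)] by blast
  qed
  then show ?thesis using in_E nz by (simp add: decomposable_vectors_def)
qed

text \<open>The factorizations of \<open>u\<close> at the points \<open>t x\<close> with \<open>0 \<le> t \<le> 1\<close> suffice. They make
  \<open>\<zeta> \<mapsto> \<langle>u \<Omega>|e(\<zeta>)\<rangle>\<close> factorizing along the chain of range projections, hence exponential on \<open>Ker V\<^sub>x\<^sup>*\<close>.\<close>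

lemma decomposable_vector_exponential:
  assumes x: "x \<in> P" and u: "u \<in> decomposable_vectors P \<alpha> x"
  obtains c \<xi> where "c \<noteq> 0" "\<xi> \<in> defect x" "u = c *\<^sub>C exp_unit x \<xi>"
proof -
  interpret projection_chain "\<lambda>t. range_proj (t *\<^sub>R x)" "defect x" by (rule projection_chain_ray[OF x])
  have uE: "u \<in> E x" and u0: "u \<noteq> 0"
    and split: "\<And>y. y \<in> P \<Longrightarrow> x - y \<in> P \<Longrightarrow> \<exists>v\<in>E y. \<exists>w\<in>E (x - y). u = v o\<^sub>L w"
    using u unfolding decomposable_vectors_def by blast+
  define f where "f \<zeta> = cinner (u vac) (exp_vec \<zeta>)" for \<zeta>
  have fact: "factorizing f"
    unfolding factorizing_def
  proof
    fix t :: real assume t: "t \<in> {0..1}"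
    define y where "y = t *\<^sub>R x"
    have y: "y \<in> P" "x - y \<in> P"
      using t x P_scaleR[of x t] P_scaleR[of x "1 - t"] by (auto simp: y_def scaleR_left_diff_distrib)
    obtain v w where vw: "v \<in> E y" "w \<in> E (x - y)" "u = v o\<^sub>L w" using split[OF y] by blast
    have "f \<zeta> = cinner (v vac) (exp_vec (\<zeta> - range_proj y \<zeta>)) * cinner (w vac) (exp_vec (Vadj y (range_proj y \<zeta>)))"
      if \<zeta>: "\<zeta> \<in> defect x" for \<zeta>
    proof -
      obtain \<zeta>1 \<zeta>2 where d: "\<zeta>1 = \<zeta> - range_proj y \<zeta>" "\<zeta>2 = Vadj y \<zeta>" "\<zeta>1 \<in> defect y" "\<zeta>2 \<in> defect (x - y)"
        "exp_unit x \<zeta> = exp_unit y \<zeta>1 o\<^sub>L exp_unit (x - y) \<zeta>2"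
        using defect_decomposition[OF x y \<zeta>] by metis
      have "f \<zeta> = cinner (v (w vac)) (exp_unit y \<zeta>1 (exp_unit (x - y) \<zeta>2 vac))"
        using exp_unit_vacuum[OF x \<zeta>] by (simp add: f_def vw(3) d(5))
      also have "\<dots> = cinner (v vac) (exp_vec \<zeta>1) * cinner (w vac) (exp_vec \<zeta>2)"
        using cinner_E[OF y(1) vw(1) exp_unit_in_E[OF y(1) d(3)], of "w vac" "exp_unit (x - y) \<zeta>2 vac"]
        by (simp add: exp_unit_vacuum y d(3,4))
      finally show ?thesis by (simp add: d(1,2) range_proj_def Vadj_V y)
    qed
    then show "\<exists>A B. \<forall>\<zeta>\<in>defect x. f \<zeta> = A (\<zeta> - range_proj (t *\<^sub>R x) \<zeta>) * B (range_proj (t *\<^sub>R x) \<zeta>)"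
      unfolding y_def[symmetric]
      by (intro exI[of _ "\<lambda>\<zeta>. cinner (v vac) (exp_vec \<zeta>)"] exI[of _ "\<lambda>\<zeta>. cinner (w vac) (exp_vec (Vadj y \<zeta>))"]) blast
  qed
  have cont: "isCont f \<zeta>" for \<zeta>
    unfolding f_def isCont_def by (intro tendsto_cinner_right tendsto_exp_vec tendsto_ident_at)
  obtain \<zeta>0 where "\<zeta>0 \<in> defect x" "f \<zeta>0 \<noteq> 0"
    using E_zero_if_orthogonal[OF x uE] u0 unfolding f_def by blast
  then have f0: "f 0 \<noteq> 0" by (rule factorizing_nonzero_at_0[OF fact cont])
  \<comment> \<open>normalise the vacuum component to 1\<close>
  define w where "w = inverse (f 0) *\<^sub>C u vac"
  have w: "cinner w \<eta> = cinner (u vac) \<eta> / f 0" for \<eta>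
    by (simp add: w_def cinner_scaleC_left divide_inverse mult.commute)
  have "factorizing (\<lambda>\<zeta>. cinner w (exp_vec \<zeta>))"
    unfolding factorizing_def
  proof
    fix t :: real assume "t \<in> {0..1}"
    then obtain A B where "\<And>\<zeta>. \<zeta> \<in> defect x \<Longrightarrow> f \<zeta> = A (\<zeta> - range_proj (t *\<^sub>R x) \<zeta>) * B (range_proj (t *\<^sub>R x) \<zeta>)"
      using fact unfolding factorizing_def by blast
    then show "\<exists>A B. \<forall>\<zeta>\<in>defect x. cinner w (exp_vec \<zeta>) = A (\<zeta> - range_proj (t *\<^sub>R x) \<zeta>) * B (range_proj (t *\<^sub>R x) \<zeta>)"
      by (intro exI[of _ "\<lambda>\<zeta>. A \<zeta> / f 0"] exI[of _ B]) (simp add: w f_def)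
  qed
  moreover have "cinner w vac = 1" using f0 by (simp add: w f_def)
  ultimately have exp_w: "cinner w (exp_vec \<zeta>) = exp (cinner w (one_particle \<zeta>))" if "\<zeta> \<in> defect x" for \<zeta>
    using that by (rule factorizing_fock_exponential)
  have "cmod (cinner (one_particle \<zeta>) w) \<le> norm w * norm \<zeta>" for \<zeta> :: 'h
    using cmod_cinner_le[of "one_particle \<zeta>" w] by (simp add: norm_one_particle mult.commute)
  then obtain \<xi>' where \<xi>': "\<And>\<zeta>. cinner (one_particle \<zeta>) w = cinner \<zeta> \<xi>'"
    using riesz_representation[of "\<lambda>\<zeta>. cinner (one_particle \<zeta>) w" "norm w"]
    by (auto simp: one_particle_add one_particle_scaleC cinner_add_left cinner_scaleC_left)
  define \<xi> where "\<xi> = \<xi>' - range_proj x \<xi>'"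
  have \<xi>: "\<xi> \<in> defect x" unfolding \<xi>_def by (rule diff_range_proj_defect[OF x])
  have "cinner (u vac) (exp_vec \<zeta>) = cinner ((f 0 *\<^sub>C exp_unit x \<xi>) vac) (exp_vec \<zeta>)" if \<zeta>: "\<zeta> \<in> defect x" for \<zeta>
  proof -
    have "cinner w (one_particle \<zeta>) = cinner \<xi>' \<zeta>"
      using \<xi>'[of \<zeta>] by (metis cinner_commute)
    also have "\<dots> = cinner \<xi> \<zeta>"
      using \<zeta> by (simp add: \<xi>_def cinner_diff_left cinner_range_proj[OF x] defect_def)
    finally have "cinner w (exp_vec \<zeta>) = exp (cinner \<xi> \<zeta>)" by (simp add: exp_w[OF \<zeta>])
    then show ?thesis
      using f0 by (simp add: w scaleC_blinfun.rep_eq cinner_scaleC_left exp_unit_vacuum[OF x \<xi>] cinner_exp_vec field_simps)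
  qed
  then have "u = f 0 *\<^sub>C exp_unit x \<xi>"
    by (intro E_eqI[OF x uE complex_vector.subspace_scale[OF subspace_E[OF x] exp_unit_in_E[OF x \<xi>]]])
  then show ?thesis using that f0 \<xi> by blast
qed

lemma decomposable_vectors_compose:
  assumes x: "x \<in> P" and y: "y \<in> P"
    and u: "u \<in> decomposable_vectors P \<alpha> x" and v: "v \<in> decomposable_vectors P \<alpha> y"
  shows "u o\<^sub>L v \<in> decomposable_vectors P \<alpha> (x + y)"
proof -
  obtain c \<xi> where c: "c \<noteq> 0" "\<xi> \<in> defect x" "u = c *\<^sub>C exp_unit x \<xi>"
    by (rule decomposable_vector_exponential[OF x u])
  obtain d \<eta> where d: "d \<noteq> 0" "\<eta> \<in> defect y" "v = d *\<^sub>C exp_unit y \<eta>"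
    by (rule decomposable_vector_exponential[OF y v])
  have "u o\<^sub>L v = (c * d) *\<^sub>C (exp_unit x \<xi> o\<^sub>L exp_unit y \<eta>)"
    by (rule blinfun_eqI)
       (simp add: c(3) d(3) scaleC_blinfun.rep_eq scaleC_scaleC bounded_opsD[OF E_bounded_ops[OF exp_unit_in_E[OF x c(2)]]])
  then show ?thesis
    unfolding exp_unit_compose[OF x y c(2) d(2)]
    using exp_unit_decomposable[OF P_add[OF x y] defect_add[OF x y c(2) d(2)], of "c * d"] c(1) d(1) by simp
qed

lemma ps_norm_eq:
  assumes x: "x \<in> P" and T: "T \<in> E x"
  shows "ps_norm T = norm (T vac)"
proof -
  have eq: "cadjoint T o\<^sub>L T = cinner (T vac) (T vac) *\<^sub>C id_blinfun"
  proof (rule blinfun_eqI)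
    fix a
    have "cinner (cadjoint T (T a)) b = cinner (cinner (T vac) (T vac) *\<^sub>C a) b" for b
      by (simp add: cinner_cadjoint_left[OF E_bounded_ops[OF T]] cinner_E[OF x T T, of a b] cinner_scaleC_left)
    then have "cadjoint T (T a) = cinner (T vac) (T vac) *\<^sub>C a"
      by (intro eq_if_cinner_total[OF exp_vec_total])
    then show "(cadjoint T o\<^sub>L T) a = (cinner (T vac) (T vac) *\<^sub>C id_blinfun) a"
      by (simp add: scaleC_blinfun.rep_eq)
  qed
  have "ps_inner T T = cinner (T vac) (T vac)"
    unfolding ps_inner_def eq
  proof (rule the_equality)
    fix c :: complex
    assume "c *\<^sub>C id_blinfun = cinner (T vac) (T vac) *\<^sub>C (id_blinfun :: 'h fock \<Rightarrow>\<^sub>L 'h fock)"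
    from arg_cong[OF this, of "\<lambda>A. blinfun_apply A vac"]
    have "c *\<^sub>C vac = cinner (T vac) (T vac) *\<^sub>C vac" by (simp add: scaleC_blinfun.rep_eq)
    then show "c = cinner (T vac) (T vac)" using exp_vec_nonzero[of "0::'h"] by simp
  qed simp
  then show ?thesis by (simp add: ps_norm_def cinner_self del: of_real_power)
qed

text \<open>The fibre embeds isometrically by \<open>T \<mapsto> T \<Omega>\<close>. The component \<open>n\<close> of \<open>T \<Omega>\<close> orthogonal to the closed span of
  the vectors \<open>S \<Omega>\<close> with \<open>S\<close> decomposable stays in the range of \<open>q = \<theta>(|\<Omega>\<rangle>\<langle>\<Omega>|)\<close>, which is
  closed; so \<open>n = R \<Omega>\<close> for an element \<open>R\<close> of the fibre orthogonal to all exponential units, and \<open>R = 0\<close>.\<close>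

lemma decomposable_vectors_total:
  assumes x: "x \<in> P"
  shows "ps_total (decomposable_vectors P \<alpha> x) (E x)"
  unfolding ps_total_def
proof (intro conjI ballI allI impI)
  let ?D = "decomposable_vectors P \<alpha> x"
  interpret normal_endomorphism "\<alpha> x" by (rule normal_endomorphism_flow[OF x])
  show DE: "?D \<subseteq> E x" by (auto simp: decomposable_vectors_def)
  have span_E: "S \<in> E x" if "S \<in> cspan ?D" for S
    using complex_vector.span_minimal[OF DE subspace_E[OF x]] that by blast
  fix T and e :: real assume T: "T \<in> E x" and e: "e > 0"
  define N where "N = (\<lambda>S. blinfun_apply S vac) ` cspan ?D"
  have "complex_vector.subspace N"
  proof (rule complex_vector.subspaceI)
    show "0 \<in> N" unfolding N_def
      using complex_vector.span_zero by (intro image_eqI[of _ _ 0]) auto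
    fix a b assume "a \<in> N" "b \<in> N"
    then obtain S S' where "S \<in> cspan ?D" "a = S vac" "S' \<in> cspan ?D" "b = S' vac" unfolding N_def by blast
    then show "a + b \<in> N" unfolding N_def
      by (intro image_eqI[of _ _ "S + S'"]) (simp_all add: blinfun.add_left complex_vector.span_add)
  next
    fix c a assume "a \<in> N"
    then obtain S where "S \<in> cspan ?D" "a = S vac" unfolding N_def by blast
    then show "c *\<^sub>C a \<in> N" unfolding N_def
      by (intro image_eqI[of _ _ "c *\<^sub>C S"]) (simp_all add: scaleC_blinfun.rep_eq complex_vector.span_scale)
  qed
  then obtain m where m: "m \<in> closure N" "\<And>y. y \<in> closure N \<Longrightarrow> cinner (T vac - m) y = 0"
    using orthogonal_decomposition[of "closure N" "T vac"] subspace_closure by blast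
  define n where "n = T vac - m"
  define q where "q = \<alpha> x (ketbra vac vac)"
  have q_E: "q (S vac) = S vac" if "S \<in> E x" for S
    unfolding q_def using that intertwiner_apply[OF _ norm_vacuum, of S vac]
    by (simp add: product_system_eq_intertwiners)
  obtain X where X: "\<And>k. X k \<in> N" "X \<longlonglongrightarrow> m" using m(1) unfolding closure_sequential by blast
  have "q (X k) = X k" for k using X(1)[of k] q_E span_E unfolding N_def by auto
  then have "X \<longlonglongrightarrow> q m" using blinfun.tendsto[OF tendsto_const X(2), of q] by simp
  then have "q m = m" using X(2) LIMSEQ_unique by blast
  then have "q n = n" by (simp add: n_def blinfun.diff_right q_E[OF T])
  moreover obtain R where R: "R \<in> E x" "\<And>a. blinfun_apply R a = \<alpha> x (ketbra a vac) n"
    using intertwiner_from_vector[OF norm_vacuum, of n] unfolding product_system_eq_intertwiners by blast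
  ultimately have Rn: "R vac = n" by (simp add: q_def)
  have "R = 0"
  proof (rule E_zero_if_orthogonal[OF x R(1)])
    fix \<zeta> assume \<zeta>: "\<zeta> \<in> defect x"
    have "exp_unit x \<zeta> \<in> ?D" using exp_unit_decomposable[OF x \<zeta>, of 1] by (simp add: scaleC_one)
    then have "exp_unit x \<zeta> vac \<in> N" unfolding N_def using complex_vector.span_base by blast
    then have "cinner n (exp_unit x \<zeta> vac) = 0" unfolding n_def using m(2) closure_subset by blast
    then show "cinner (R vac) (exp_vec \<zeta>) = 0" by (simp add: Rn exp_unit_vacuum[OF x \<zeta>])
  qed
  then have "T vac \<in> closure N" using Rn m(1) by (simp add: n_def)
  then obtain S where S: "S \<in> cspan ?D" "dist (S vac) (T vac) < e"
    using e unfolding closure_approachable N_def by blast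
  have "ps_norm (T - S) = norm (T vac - S vac)"
    using ps_norm_eq[OF x complex_vector.subspace_diff[OF subspace_E[OF x] T span_E[OF S(1)]]]
    by (simp add: blinfun.diff_left)
  then show "\<exists>S\<in>cspan ?D. ps_norm (T - S) < e"
    using S by (intro bexI[of _ S]) (auto simp: dist_norm norm_minus_commute)
qed

end

theorem proposition3p2:
  fixes P :: "(real ^ 'd) set"
    and V :: "real ^ 'd \<Rightarrow> 'h::chilbert_space \<Rightarrow>\<^sub>L 'h"
    and \<alpha> :: "real ^ 'd \<Rightarrow> ('h fock \<Rightarrow>\<^sub>L 'h fock) \<Rightarrow> ('h fock \<Rightarrow>\<^sub>L 'h fock)"
  assumes "closed_pointed_spanning_cone P"
    and "separable_space (euclidean :: 'h topology)"
    and "isometric_representation P V"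
    and "is_CCR_flow P V \<alpha>"
  shows "decomposable P \<alpha>"
proof -
  interpret ccr_flow P V \<alpha> by unfold_locales (fact assms)+
  show ?thesis
    unfolding decomposable_def
    using decomposable_vectors_compose decomposable_vectors_total by blast
qed

end
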